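(* For every constant $\alpha\ge1$, it is NP-hard (under polynomial-time many-one reductions) to approximate within factor $\alpha$ the optimum value of the Global Constrained Minimization problem. This holds both for its size version and for its depth version.
   Context: $\mathscr G_N=\{(i,j)\in[N]\times[N]: i\neq j\}$ is the set of CNOT gates on $N$ qubits, where $(i,j)$ means qubit $i$ controls qubit $j$. For $S\subseteq\mathscr G_N$, $\mathscr L(S)$ is the set of layers under $S$: subsets $T\subseteq S$ such that any two distinct $(i,j),(i',j')\in T$ satisfy $\{i,j\}\cap\{i',j'\}=\emptyset$. $\mathcal C(g_1,\dots,g_s)$ denotes the circuit applying gates $g_1,\dots,g_s$ in order, and $\mathcal C(\ell_1,\dots,\ell_v)$ the circuit applying layers $\ell_1,\dots,\ell_v$ in order. An $n$-qubit $m$-ancilla CNOT circuit is a CNOT circuit on $n+m$ qubits that, for every $\mathbf x\in\mathbb F_2^n$, maps $(\mathbf x,0^m)$ to $(\mathbf y,0^m)$ for some $\mathbf y$. Two such circuits $\mathcal C_1,\mathcal C_2$ with the same $n$ are equivalent, written $\mathcal C_1\cong\mathcal C_2$, if for every $\mathbf x\in\mathbb F_2^n$ their outputs on $(\mathbf x,0^{m})$ agree on the first $n$ qubits. Global Constrained Minimization (GCM): - Input: positive integers $n,m,s$, a set $S\subseteq\mathscr G_{n+m}$, and gates $g_1,\dots,g_s\in S$ such that $\mathcal C(g_1,\dots,g_s)$ is an $n$-qubit $m$-ancilla CNOT circuit. - Size version output: the minimum $u\ge0$ such that there exist $h_1,\dots,h_u\in S$ with $\mathcal C(g_1,\dots,g_s)\cong\mathcal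 C(h_1,\dots,h_u)$. - Depth version output: the minimum $v\ge0$ such that there exist layers $\ell_1,\dots,\ell_v\in\mathscr L(S)$ with $\mathcal C(g_1,\dots,g_s)\cong\mathcal C(\ell_1,\dots,\ell_v)$. *)

theory Defs
  imports Complex_Main
begin

text \<open>A machine has finitely many states (0 = start, 1 = halt) and finitely many tape
  symbols (0 = blank, 1 = bit False, 2 = bit True). The transition function maps
  (state, read symbol) to (new state, written symbol, head move in {-1,0,1}).\<close>

datatype tm = TM (tm_states: nat) (tm_syms: nat) (tm_delta: "nat \<Rightarrow> nat \<Rightarrow> nat \<times> nat \<times> int")

definition wf_tm :: "tm \<Rightarrow> bool" where
  "wf_tm M \<longleftrightarrow> 2 \<le> tm_states M \<and> 3 \<le> tm_syms M \<and>
     (\<forall>q < tm_states M. \<forall>a < tm_syms M.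
        (case tm_delta M q a of (q', a', d) \<Rightarrow>
           q' < tm_states M \<and> a' < tm_syms M \<and> d \<in> {-1, 0, 1}))"

type_synonym config = "nat \<times> (int \<Rightarrow> nat) \<times> int"

definition tm_step :: "tm \<Rightarrow> config \<Rightarrow> config" where
  "tm_step M c = (case c of (q, tape, h) \<Rightarrow>
     if q = 1 then c
     else (case tm_delta M q (tape h) of (q', a', d) \<Rightarrow> (q', tape(h := a'), h + d)))"

definition tm_run :: "tm \<Rightarrow> nat \<Rightarrow> config \<Rightarrow> config" where
  "tm_run M t c = (tm_step M ^^ t) c"

definition bit_sym :: "bool \<Rightarrow> nat" where
  "bit_sym b = (if b then 2 else 1)"

definition tm_init :: "bool list \<Rightarrow> config" where
  "tm_init x = (0, (\<lambda>i. if 0 \<le> i \<and> i < int (length x) then bit_sym (x ! nat i) else 0), 0)"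

definition tape_output :: "(int \<Rightarrow> nat) \<Rightarrow> bool list" where
  "tape_output tape = map (\<lambda>i. tape (int i) = 2) [0..<(LEAST k. tape (int k) \<notin> {1, 2})]"

definition poly_time_computable :: "(bool list \<Rightarrow> bool list) \<Rightarrow> bool" where
  "poly_time_computable f \<longleftrightarrow>
     (\<exists>M c k. wf_tm M \<and> (\<forall>x. \<exists>t. t \<le> c * length x ^ k + c \<and>
        fst (tm_run M t (tm_init x)) = 1 \<and>
        tape_output (fst (snd (tm_run M t (tm_init x)))) = f x))"

definition poly_time_decidable :: "(bool list \<Rightarrow> bool) \<Rightarrow> bool" where
  "poly_time_decidable P \<longleftrightarrow> poly_time_computable (\<lambda>x. [P x])"

definition pair_enc :: "bool list \<Rightarrow> bool list \<Rightarrow> bool list" where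
  "pair_enc x w = concat (map (\<lambda>b. [b, b]) x) @ [True, False] @ w"

definition in_NP :: "(bool list \<Rightarrow> bool) \<Rightarrow> bool" where
  "in_NP L \<longleftrightarrow> (\<exists>V c k. poly_time_decidable V \<and>
     (\<forall>x. L x \<longleftrightarrow> (\<exists>w. length w \<le> c * length x ^ k + c \<and> V (pair_enc x w))))"

fun nat_bits :: "nat \<Rightarrow> bool list" where
  "nat_bits n = (if n = 0 then [] else odd n # nat_bits (n div 2))"

definition enc_nat :: "nat \<Rightarrow> bool list" where
  "enc_nat n = concat (map (\<lambda>b. [b, b]) (nat_bits n)) @ [True, False]"

definition enc_pairs :: "(nat \<times> nat) list \<Rightarrow> bool list" where
  "enc_pairs ps = enc_nat (length ps) @ concat (map (\<lambda>(a, b). enc_nat a @ enc_nat b) ps)"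

text \<open>A GCM instance: n, m, s, the allowed gate set S (given as a list), and g_1..g_s.
  Qubits are numbered 0..n+m-1; qubits 0..n-1 are the data qubits, n..n+m-1 the ancillas.\<close>
record gcm_inst =
  gi_n :: nat
  gi_m :: nat
  gi_s :: nat
  gi_S :: "(nat \<times> nat) list"
  gi_gates :: "(nat \<times> nat) list"

definition enc_gap :: "gcm_inst \<times> nat \<Rightarrow> bool list" where
  "enc_gap Ik = (case Ik of (I, k) \<Rightarrow>
     enc_nat (gi_n I) @ enc_nat (gi_m I) @ enc_nat (gi_s I) @
     enc_pairs (gi_S I) @ enc_pairs (gi_gates I) @ enc_nat k)"

definition cnot_gates :: "nat \<Rightarrow> (nat \<times> nat) set" where
  "cnot_gates N = {(i, j). i < N \<and> j < N \<and> i \<noteq> j}"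

definition layers :: "(nat \<times> nat) set \<Rightarrow> (nat \<times> nat) set set" where
  "layers S = {T. T \<subseteq> S \<and> (\<forall>i j i' j'. (i, j) \<in> T \<longrightarrow> (i', j') \<in> T \<longrightarrow>
       (i, j) \<noteq> (i', j') \<longrightarrow> {i, j} \<inter> {i', j'} = {})}"

type_synonym qstate = "nat \<Rightarrow> bool"

definition apply_gate :: "nat \<times> nat \<Rightarrow> qstate \<Rightarrow> qstate" where
  "apply_gate g x = (case g of (i, j) \<Rightarrow> x(j := (x j \<noteq> x i)))"

definition run_gates :: "(nat \<times> nat) list \<Rightarrow> qstate \<Rightarrow> qstate" where
  "run_gates gs x = fold apply_gate gs x"

definition apply_layer :: "(nat \<times> nat) set \<Rightarrow> qstate \<Rightarrow> qstate" where
  "apply_layer T x = (\<lambda>q. if \<exists>i. (i, q) \<in> T then (x q \<noteq> x (THE i. (i, q) \<in> T)) else x q)"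

definition run_layers :: "(nat \<times> nat) set list \<Rightarrow> qstate \<Rightarrow> qstate" where
  "run_layers ls x = fold apply_layer ls x"

text \<open>Inputs (x, 0^m): all qubits from n on are 0.\<close>
definition valid_input :: "nat \<Rightarrow> qstate \<Rightarrow> bool" where
  "valid_input n x \<longleftrightarrow> (\<forall>q \<ge> n. \<not> x q)"

definition is_ancilla_circuit :: "nat \<Rightarrow> nat \<Rightarrow> (qstate \<Rightarrow> qstate) \<Rightarrow> bool" where
  "is_ancilla_circuit n m C \<longleftrightarrow>
     (\<forall>x. valid_input n x \<longrightarrow> (\<forall>q. n \<le> q \<and> q < n + m \<longrightarrow> \<not> C x q))"

definition circ_equiv :: "nat \<Rightarrow> (qstate \<Rightarrow> qstate) \<Rightarrow> (qstate \<Rightarrow> qstate) \<Rightarrow> bool" where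
  "circ_equiv n C1 C2 \<longleftrightarrow> (\<forall>x. valid_input n x \<longrightarrow> (\<forall>q < n. C1 x q = C2 x q))"

definition gcm_valid :: "gcm_inst \<Rightarrow> bool" where
  "gcm_valid I \<longleftrightarrow> 0 < gi_n I \<and> 0 < gi_m I \<and> 0 < gi_s I \<and>
     set (gi_S I) \<subseteq> cnot_gates (gi_n I + gi_m I) \<and>
     length (gi_gates I) = gi_s I \<and> set (gi_gates I) \<subseteq> set (gi_S I) \<and>
     is_ancilla_circuit (gi_n I) (gi_m I) (run_gates (gi_gates I))"

definition gcm_opt_size :: "gcm_inst \<Rightarrow> nat" where
  "gcm_opt_size I = (LEAST u. \<exists>hs. length hs = u \<and> set hs \<subseteq> set (gi_S I) \<and>
     is_ancilla_circuit (gi_n I) (gi_m I) (run_gates hs) \<and>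
     circ_equiv (gi_n I) (run_gates (gi_gates I)) (run_gates hs))"

definition gcm_opt_depth :: "gcm_inst \<Rightarrow> nat" where
  "gcm_opt_depth I = (LEAST v. \<exists>ls. length ls = v \<and> set ls \<subseteq> layers (set (gi_S I)) \<and>
     is_ancilla_circuit (gi_n I) (gi_m I) (run_layers ls) \<and>
     circ_equiv (gi_n I) (run_gates (gi_gates I)) (run_layers ls))"

text \<open>Approximating opt within factor alpha is NP-hard under polynomial-time many-one
  reductions: every NP language reduces to the gap problem whose YES instances
  (I, k) have opt I \<le> k and whose NO instances have opt I > alpha * k.\<close>
definition NP_hard_to_approx :: "(gcm_inst \<Rightarrow> nat) \<Rightarrow> real \<Rightarrow> bool" where
  "NP_hard_to_approx opt \<alpha> \<longleftrightarrow>
     (\<forall>L. in_NP L \<longrightarrow>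
        (\<exists>g :: bool list \<Rightarrow> gcm_inst \<times> nat.
           poly_time_computable (\<lambda>x. enc_gap (g x)) \<and>
           (\<forall>x. gcm_valid (fst (g x)) \<and>
                (L x \<longrightarrow> real (opt (fst (g x))) \<le> real (snd (g x))) \<and>
                (\<not> L x \<longrightarrow> real (opt (fst (g x))) > \<alpha> * real (snd (g x))))))"

end

theory Submission
  imports Defs
begin

text \<open>The gap is produced without the PCP theorem. The tableau of the verifier is a constraint
  problem on \<open>N\<close> variables over a fixed domain, with constraints on four variables. The vertices
  \<open>R\<close> of a graph are the windows of \<open>d\<close> variables together with a palette that assigns one of \<open>k\<close>
  colours to every label (assignment of the window); \<open>d\<close> and \<open>k\<close> are constants depending on
  the approximation factor and the domain size. The circuit has to add data qubit \<open>D R\<close> to data qubit \<open>B R\<close>, for all \<open>R\<close>, in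
  each of \<open>W\<close> copies. The gate set allows this only through \<open>k\<close> long chains of ancillas, one for each
  colour, which \<open>R\<close> may use if its palette gives the colour to a locally correct label;
  cross terms \<open>D R'\<close> arising from a shared chain can be cancelled at \<open>B R\<close> if \<open>R\<close> and \<open>R'\<close>
  have consistent labels of the same colour.

  A global solution colours the vertices by the label it induces, and then one pass through every
  chain suffices. Conversely, cut each chain at its least used link: the values that pass
  through the cuts are linear forms, and a circuit that is too cheap leaves most colours with few
  forms. Such a colour cannot carry many vertices with pairwise inconsistent labels, so
  picking for every window a label whose colours are really used gives local solutions without large
  pairwise inconsistent families, and these can be glued to a global solution.

  The reduction is programmed in a counter language that is simulated by Turing machines.\<close>

section \<open>From local to global assignments\<close>

text \<open>A circuit need not choose colours: it may send arbitrary sums through the chains. Hence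
  the lower bound is one of rank. Beyond the cuts the circuit has to assemble a matrix over the
  two-element field that agrees with the identity at all pairs that are not \<open>free\<close>,
  written as a sum of one matrix per colour; the number of forms bounds the ranks. This is a
  minrank-type quantity, at most one form per colour when the constraints are satisfiable and more
  than \<open>a\<close> per colour on average otherwise. A colour with at most \<open>2 * a\<close>
  forms can still serve many vertices whose labels agree. To see which label a vertex owes its
  colour to, all palettes are present: among the vertices with a given window some have palettes
  that meet other palettes in a single colour, and there no cancellation between colours can hide
  the rank. The two cost measures need different amplification. Long chains make the gates outside
  them negligible in size. For depth, parallel copies would cost nothing, so all copies share one
  hub per colour, which they can only pass one after the other.\<close>

fun level :: "nat \<Rightarrow> nat \<Rightarrow> nat" where
  "level m 0 = 1"
| "level m (Suc s) = m * (level m s + 4)"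

lemma level_mono:
  assumes "m \<ge> 1" "s \<le> t" shows "level m s \<le> level m t"
proof -
  have *: "level m s \<le> level m (Suc s)" for s
  proof -
    have "1 * level m s \<le> m * (level m s + 4)" using assms(1) by (intro mult_le_mono) auto
    then show ?thesis by simp
  qed
  show ?thesis using assms(2) by (induction t rule: dec_induct) (use * le_trans in blast)+
qed

definition clash :: "('v set \<Rightarrow> 'v \<Rightarrow> 'd) \<Rightarrow> 'v set \<Rightarrow> 'v set \<Rightarrow> bool" where
  "clash f S T \<longleftrightarrow> (\<exists>w \<in> S \<inter> T. f S w \<noteq> f T w)"

definition clashing :: "('v set \<Rightarrow> 'v \<Rightarrow> 'd) \<Rightarrow> 'v set set \<Rightarrow> bool" where
  "clashing f F \<longleftrightarrow> (\<forall>S\<in>F. \<forall>T\<in>F. S \<noteq> T \<longrightarrow> clash f S T)"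

definition windows :: "'v set \<Rightarrow> nat \<Rightarrow> 'v set set" where
  "windows V d = {S. S \<subseteq> V \<and> S \<noteq> {} \<and> card S \<le> d}"

lemma clash_sym: "clash f S T \<Longrightarrow> clash f T S"
  unfolding clash_def by (metis Int_commute)

lemma clash_irrefl: "\<not> clash f S S"
  unfolding clash_def by simp

text \<open>Two consecutive levels have clashing families of the same maximal size; let \<open>F\<close> be one of the lower
  level. A window of the higher level that contains \<open>\<Union>F\<close> agrees with exactly one member of \<open>F\<close>,
  and two such windows that agree with the same member do not clash, by maximality; so each
  member of \<open>F\<close> induces an assignment. If all of these were wrong, the window consisting of \<open>\<Union>F\<close> and four
  violating variables for each member would agree with none.\<close>

lemma local_to_global:
  fixes f :: "'v set \<Rightarrow> 'v \<Rightarrow> 'd"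
  assumes finV: "finite V" and neV: "V \<noteq> {}"
    and loc: "\<And>S. S \<in> windows V (level m m) \<Longrightarrow>
        (\<forall>v\<in>S. f S v \<in> D) \<and>
        (\<forall>v1\<in>S. \<forall>v2\<in>S. \<forall>v3\<in>S. \<forall>v4\<in>S. \<not> bad v1 v2 v3 v4 (f S v1) (f S v2) (f S v3) (f S v4))"
    and small: "\<And>F. F \<subseteq> windows V (level m m) \<Longrightarrow> clashing f F \<Longrightarrow> card F < m"
  shows "\<exists>A. (\<forall>v\<in>V. A v \<in> D) \<and>
        (\<forall>v1\<in>V. \<forall>v2\<in>V. \<forall>v3\<in>V. \<forall>v4\<in>V. \<not> bad v1 v2 v3 v4 (A v1) (A v2) (A v3) (A v4))"
proof -
  have m1: "m \<ge> 1" using small[of "{}"] by (auto simp: clashing_def)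
  let ?W = "\<lambda>s. windows V (level m s)"
  have finW: "finite (?W s)" for s using finV by (auto simp: windows_def)
  have Wmono: "?W s \<subseteq> ?W t" if "s \<le> t" for s t
    using level_mono[OF m1 that] unfolding windows_def by force
  \<comment> \<open>If the maximal size grew at every level, level \<open>m\<close> would carry a
    clashing family of size \<open>Suc m\<close>, against \<open>small\<close>.\<close>
  have "\<exists>s<m. \<exists>F. F \<noteq> {} \<and> F \<subseteq> ?W s \<and> clashing f F \<and>
      (\<forall>F'. F' \<subseteq> ?W (Suc s) \<longrightarrow> clashing f F' \<longrightarrow> card F' \<le> card F)"
  proof (rule ccontr)
    assume neg: "\<not> ?thesis"
    have "\<exists>F. F \<subseteq> ?W s \<and> clashing f F \<and> card F \<ge> Suc s" if "s \<le> m" for s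
      using that
    proof (induction s)
      case 0
      obtain v where "v \<in> V" using neV by blast
      then have "{{v}} \<subseteq> ?W 0" "clashing f {{v}}" by (auto simp: windows_def clashing_def)
      then show ?case by (intro exI[of _ "{{v}}"]) auto
    next
      case (Suc s)
      then obtain F where F: "F \<subseteq> ?W s" "clashing f F" "card F \<ge> Suc s" by auto
      then have "F \<noteq> {}" by auto
      then obtain F' where "F' \<subseteq> ?W (Suc s)" "clashing f F'" "card F' > card F"
        using neg F Suc.prems by (meson Suc_le_lessD not_le)
      then show ?case using F(3) by (intro exI[of _ F']) auto
    qed
    from this[of m] obtain F where "F \<subseteq> ?W m" "clashing f F" "card F \<ge> Suc m" by auto
    then show False using small[of F] by simp
  qed
  then obtain s F where s: "s < m" and F: "F \<noteq> {}" "F \<subseteq> ?W s" "clashing f F"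
    and mx: "\<And>F'. F' \<subseteq> ?W (Suc s) \<Longrightarrow> clashing f F' \<Longrightarrow> card F' \<le> card F" by blast
  have finF: "finite F" using F(2) finW finite_subset by blast
  have cF: "card F < m" using small F Wmono[of s m] s by (meson less_imp_le_nat order_trans)
  define U where "U = \<Union>F"
  have Usub: "U \<subseteq> V" using F(2) by (auto simp: U_def windows_def)
  have finU: "finite U" using Usub finV finite_subset by blast
  have FW: "F \<subseteq> ?W (Suc s)" using F(2) Wmono[of s "Suc s"] by simp
  have loc': "S \<in> ?W (Suc s) \<Longrightarrow> S \<in> ?W m" for S using Wmono[of "Suc s" m] s by auto
  \<comment> \<open>Otherwise \<open>T\<close> could be added to \<open>F\<close>, against
    maximality.\<close>
  have ex1: "\<exists>S\<in>F. \<not> clash f S T" if T: "T \<in> ?W (Suc s)" "U \<subseteq> T" for T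
  proof (rule ccontr)
    assume neg: "\<not> ?thesis"
    then have nT: "T \<notin> F" using clash_irrefl by blast
    have "clashing f (insert T F)" using F(3) neg clash_sym unfolding clashing_def by (metis insert_iff)
    then show False using mx[of "insert T F"] FW T finF nT by auto
  qed
  \<comment> \<open>\<open>S\<close> and \<open>S'\<close> clash at a variable of \<open>U\<close>,
    where \<open>T\<close> repeats the value of \<open>S\<close>.\<close>
  have inh: "clash f T S'" if T: "U \<subseteq> T" and S: "S \<in> F" "S' \<in> F" "S \<noteq> S'" "\<not> clash f S T" for T S S'
  proof -
    obtain w where w: "w \<in> S \<inter> S'" "f S w \<noteq> f S' w" using F(3) S unfolding clashing_def clash_def by blast
    then have "w \<in> T" using S T unfolding U_def by blast
    then have "f S w = f T w" using S(4) w by (auto simp: clash_def)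
    then show ?thesis using w \<open>w \<in> T\<close> unfolding clash_def by auto
  qed
  have same: "\<not> clash f T T'" if T: "T \<in> ?W (Suc s)" "U \<subseteq> T" "T' \<in> ?W (Suc s)" "U \<subseteq> T'"
    and S: "S \<in> F" "\<not> clash f S T" "\<not> clash f S T'" for S T T'
  proof
    assume c: "clash f T T'"
    then have ne: "T \<noteq> T'" using clash_irrefl by metis
    \<comment> \<open>Trading \<open>S\<close> for both \<open>T\<close> and \<open>T'\<close> keeps
      the family clashing, by \<open>inh\<close>, and makes it larger by one.\<close>
    let ?F = "insert T (insert T' (F - {S}))"
    have cT: "clash f T S'" "clash f T' S'" if "S' \<in> F - {S}" for S'
      using inh[of T S S'] inh[of T' S S'] that T S by auto
    have nin: "T \<notin> F - {S}" "T' \<notin> F - {S}" using cT clash_irrefl by metis+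
    have "clashing f ?F"
      using F(3) cT c clash_sym unfolding clashing_def by (metis DiffD1 insert_iff)
    moreover have "?F \<subseteq> ?W (Suc s)" using FW T by auto
    moreover have "card ?F = card F + 1"
    proof -
      have "card F = Suc (card (F - {S}))" using finF S(1) by (rule card.remove)
      moreover have "card ?F = Suc (Suc (card (F - {S})))" using nin ne finF by (subst card_insert_disjoint; simp)+
      ultimately show ?thesis by simp
    qed
    ultimately show False using mx[of ?F] by linarith
  qed
  define Ty where "Ty S = {T \<in> ?W (Suc s). U \<subseteq> T \<and> \<not> clash f S T}" for S
  \<comment> \<open>By \<open>same\<close> the value does not depend on the chosen window. Where no
    window of \<open>Ty S\<close> contains \<open>v\<close> it is arbitrary, which is harmless: it
    can only produce violations that no member of \<open>Ty S\<close> contains.\<close>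
  define A where "A S v = f (SOME T. T \<in> Ty S \<and> v \<in> T) v" for S v
  have Aeq: "A S v = f T v" if "S \<in> F" "T \<in> Ty S" "v \<in> T" for S T v
  proof -
    have "f T0 v = f T v" if "T0 \<in> Ty S \<and> v \<in> T0" for T0
    proof -
      have "\<not> clash f T0 T" using same[of T0 T S] that \<open>S \<in> F\<close> \<open>T \<in> Ty S\<close> unfolding Ty_def by blast
      then show ?thesis using that \<open>v \<in> T\<close> unfolding clash_def by blast
    qed
    then show ?thesis unfolding A_def
      using someI[of "\<lambda>T. T \<in> Ty S \<and> v \<in> T" T] that by blast
  qed
  show ?thesis
  proof (rule ccontr)
    assume neg: "\<not> ?thesis"
    have "\<forall>S\<in>F. \<exists>C. C \<subseteq> V \<and> finite C \<and> card C \<le> 4 \<and> (\<forall>T\<in>Ty S. \<not> C \<subseteq> T)"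
    proof
      fix S assume S: "S \<in> F"
      have "\<not> ((\<forall>v\<in>V. A S v \<in> D) \<and>
        (\<forall>v1\<in>V. \<forall>v2\<in>V. \<forall>v3\<in>V. \<forall>v4\<in>V. \<not> bad v1 v2 v3 v4 (A S v1) (A S v2) (A S v3) (A S v4)))"
        using neg by blast
      then consider (a) v where "v \<in> V" "A S v \<notin> D" |
        (b) v1 v2 v3 v4 where "v1 \<in> V" "v2 \<in> V" "v3 \<in> V" "v4 \<in> V" "bad v1 v2 v3 v4 (A S v1) (A S v2) (A S v3) (A S v4)"
        by blast
      then show "\<exists>C. C \<subseteq> V \<and> finite C \<and> card C \<le> 4 \<and> (\<forall>T\<in>Ty S. \<not> C \<subseteq> T)"
      proof cases
        case a
        have "\<not> {v} \<subseteq> T" if T: "T \<in> Ty S" for T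
        proof
          assume "{v} \<subseteq> T"
          then have "v \<in> T" by auto
          moreover have "T \<in> ?W m" using T loc' unfolding Ty_def by auto
          ultimately show False using Aeq[OF S T] a loc by auto
        qed
        then show ?thesis using a(1) by (intro exI[of _ "{v}"]) auto
      next
        case b
        have "\<not> {v1,v2,v3,v4} \<subseteq> T" if T: "T \<in> Ty S" for T
        proof
          assume "{v1,v2,v3,v4} \<subseteq> T"
          then have v: "v1 \<in> T" "v2 \<in> T" "v3 \<in> T" "v4 \<in> T" by auto
          moreover have "T \<in> ?W m" using T loc' unfolding Ty_def by auto
          ultimately show False using Aeq[OF S T] b(5) loc[of T] by auto
        qed
        moreover have "card {v1,v2,v3,v4} \<le> 4"
          using card_length[of "[v1,v2,v3,v4]"] by simp
        ultimately show ?thesis using b(1-4) by (intro exI[of _ "{v1,v2,v3,v4}"]) auto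
      qed
    qed
    then obtain C where C: "\<And>S. S \<in> F \<Longrightarrow> C S \<subseteq> V \<and> finite (C S) \<and> card (C S) \<le> 4 \<and> (\<forall>T\<in>Ty S. \<not> C S \<subseteq> T)"
      by metis
    define T where "T = (\<Union>S\<in>F. S \<union> C S)"
    have TV: "T \<subseteq> V" using C F(2) unfolding T_def windows_def by blast
    have "card T \<le> (\<Sum>S\<in>F. card (S \<union> C S))" unfolding T_def by (rule card_UN_le[OF finF])
    \<comment> \<open>Origin of the recursion of \<open>level\<close>: fewer than \<open>m\<close>
      members, each contributing a window of the lower level and at most four violating
      variables.\<close>
    also have "\<dots> \<le> (\<Sum>S\<in>F. level m s + 4)"
    proof (rule sum_mono)
      fix S assume "S \<in> F"
      then have "card S \<le> level m s" "card (C S) \<le> 4" using F(2) C unfolding windows_def by auto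
      then show "card (S \<union> C S) \<le> level m s + 4" using card_Un_le[of S "C S"] by linarith
    qed
    also have "\<dots> \<le> m * (level m s + 4)" using cF by (simp add: mult_le_mono)
    finally have "card T \<le> level m (Suc s)" by simp
    moreover have "U \<subseteq> T" unfolding U_def T_def by blast
    moreover have "T \<noteq> {}" using F(1,2) unfolding T_def windows_def by blast
    ultimately have TW: "T \<in> ?W (Suc s)" and UT: "U \<subseteq> T" using TV by (auto simp: windows_def)
    obtain S where "S \<in> F" "\<not> clash f S T" using ex1[OF TW UT] by blast
    then have "T \<in> Ty S" using TW UT unfolding Ty_def by blast
    moreover have "C S \<subseteq> T" using \<open>S \<in> F\<close> unfolding T_def by blast
    ultimately show False using C[OF \<open>S \<in> F\<close>] by blast
  qed
qed

section \<open>Free choices for set mappings\<close>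

fun free_set_bound :: "nat \<Rightarrow> nat \<Rightarrow> nat" where
  "free_set_bound h 0 = 0"
| "free_set_bound h (Suc j) = 2 * (free_set_bound h j + h + 1) + 2 * h * j + 1"

text \<open>A finite free-set theorem, proved greedily. The colour \<open>c0\<close> of one element
  \<open>s0\<close> is chosen such that, for every other element, at most half of the candidates
  forbid it; the candidates in conflict with \<open>c0\<close> are then deleted. In
  \<open>free_set_bound\<close>, the summand \<open>2 * h * j + 1\<close> guarantees that such a
  \<open>c0\<close> exists, and the doubled summand that enough candidates survive the halving and
  \<open>h + 1\<close> further deletions.\<close>

lemma free_choice:
  fixes X :: "'c \<Rightarrow> 's \<Rightarrow> 'c set"
  assumes "finite L" "card L = j"
    and "\<And>s. s \<in> L \<Longrightarrow> finite (C s) \<and> card (C s) \<ge> free_set_bound h j"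
    and "\<And>s c. finite (X c s) \<and> card (X c s) \<le> h"
  shows "\<exists>b. \<forall>s\<in>L. b s \<in> C s \<and> (\<forall>s'\<in>L. s' \<noteq> s \<longrightarrow> b s' \<notin> X (b s) s \<and> b s' \<noteq> b s)"
  using assms(1,2,3)
proof (induction j arbitrary: L C)
  case 0
  then show ?case by auto
next
  case (Suc j)
  define M where "M = free_set_bound h (Suc j)"
  have M: "M = 2 * (free_set_bound h j + h + 1) + 2 * h * j + 1" by (simp add: M_def)
  obtain s0 L' where L: "L = insert s0 L'" "s0 \<notin> L'" "card L' = j" "finite L'"
    using Suc.prems(1,2) by (metis card_Suc_eq finite_insert)
  \<comment> \<open>Candidate sets of equal size \<open>M\<close> make the double count below
    independent of the element.\<close>
  have "\<forall>s\<in>L. \<exists>C'. C' \<subseteq> C s \<and> finite C' \<and> card C' = M"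
    using Suc.prems(3) unfolding M_def by (metis obtain_subset_with_card_n)
  then obtain E where E: "\<And>s. s \<in> L \<Longrightarrow> E s \<subseteq> C s \<and> finite (E s) \<and> card (E s) = M" by metis
  define hit where "hit s c0 = {c \<in> E s. c0 \<in> X c s}" for s c0
  define B where "B s = {c0 \<in> E s0. 2 * card (hit s c0) > M}" for s
  have finE0: "finite (E s0)" using E L by auto
  \<comment> \<open>Double counting of the pairs with \<open>c0\<close> in \<open>X c s\<close>:
    there are at most \<open>M * h\<close> of them, and every member of \<open>B s\<close> lies in
    more than \<open>M / 2\<close>.\<close>
  have B: "card (B s) \<le> 2 * h" if s: "s \<in> L'" for s
  proof -
    have fE: "finite (E s)" "card (E s) = M" using E L s by auto
    have "(\<Sum>c0\<in>E s0. card (hit s c0)) = (\<Sum>c0\<in>E s0. \<Sum>c\<in>E s. (if c0 \<in> X c s then 1 else 0))"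
      unfolding hit_def using fE by (simp add: sum.If_cases Int_def)
    also have "\<dots> = (\<Sum>c\<in>E s. \<Sum>c0\<in>E s0. (if c0 \<in> X c s then 1 else 0))" by (rule sum.swap)
    also have "\<dots> = (\<Sum>c\<in>E s. card (E s0 \<inter> X c s))"
      using finE0 by (simp add: sum.If_cases)
    also have "\<dots> \<le> (\<Sum>c\<in>E s. h)"
    proof (rule sum_mono)
      fix c show "card (E s0 \<inter> X c s) \<le> h"
        using assms(4)[where c=c and s=s] card_mono[of "X c s" "E s0 \<inter> X c s"] by (meson Int_lower2 le_trans)
    qed
    also have "\<dots> = M * h" using fE by simp
    finally have tot: "(\<Sum>c0\<in>E s0. card (hit s c0)) \<le> M * h" .
    have "card (B s) * M = (\<Sum>c0\<in>B s. M)" by simp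
    also have "\<dots> \<le> (\<Sum>c0\<in>B s. 2 * card (hit s c0))" by (rule sum_mono) (simp add: B_def)
    also have "\<dots> \<le> (\<Sum>c0\<in>E s0. 2 * card (hit s c0))" by (rule sum_mono2) (auto simp: finE0 B_def)
    also have "\<dots> = 2 * (\<Sum>c0\<in>E s0. card (hit s c0))" by (simp add: sum_distrib_left)
    finally have "card (B s) * M \<le> 2 * (\<Sum>c0\<in>E s0. card (hit s c0))" .
    also have "\<dots> \<le> 2 * (M * h)" using tot by (rule mult_le_mono2)
    finally have "card (B s) * M \<le> (2 * h) * M" by (simp only: ac_simps)
    moreover have "M > 0" using M by simp
    ultimately show ?thesis by (metis mult_le_cancel2)
  qed
  have "card (\<Union>s\<in>L'. B s) \<le> (\<Sum>s\<in>L'. card (B s))" by (rule card_UN_le[OF L(4)])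
  also have "\<dots> \<le> (\<Sum>s\<in>L'. 2 * h)" by (rule sum_mono) (rule B)
  also have "\<dots> < card (E s0)" using L E[of s0] M by (simp add: algebra_simps)
  finally have "\<not> E s0 \<subseteq> (\<Union>s\<in>L'. B s)"
    using card_mono[of "\<Union>s\<in>L'. B s" "E s0"] finE0 L(4) B_def by fastforce
  then obtain c0 where c0: "c0 \<in> E s0" "\<And>s. s \<in> L' \<Longrightarrow> c0 \<notin> B s" by blast
  \<comment> \<open>Three kinds of conflict are removed: candidates that forbid \<open>c0\<close>,
    candidates that \<open>c0\<close> forbids, and \<open>c0\<close> itself.\<close>
  define C' where "C' s = E s - hit s c0 - X c0 s0 - {c0}" for s
  have C': "finite (C' s) \<and> card (C' s) \<ge> free_set_bound h j" if s: "s \<in> L'" for s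
  proof -
    have fE: "finite (E s)" "card (E s) = M" using E L s by auto
    have h1: "2 * card (hit s c0) \<le> M" using c0 s unfolding B_def by force
    have "card (C' s) \<ge> card (E s - hit s c0 - X c0 s0) - card {c0}"
      unfolding C'_def by (rule diff_card_le_card_Diff) simp
    moreover have "card (E s - hit s c0 - X c0 s0) \<ge> card (E s - hit s c0) - card (X c0 s0)"
      by (rule diff_card_le_card_Diff) (simp add: assms(4))
    moreover have "card (E s - hit s c0) \<ge> card (E s) - card (hit s c0)"
      by (rule diff_card_le_card_Diff) (simp add: hit_def fE)
    moreover have "card (X c0 s0) \<le> h" using assms(4) by simp
    ultimately have b1: "M \<le> card (C' s) + card (hit s c0) + h + 1" using fE by simp
    have b2: "2 * free_set_bound h j + 2 * h + 2 \<le> M" using M by simp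
    have "2 * M \<le> 2 * card (C' s) + M + 2 * h + 2" using b1 h1 by simp
    then have "free_set_bound h j \<le> card (C' s)" using b2 by simp
    then show ?thesis using fE by (simp add: C'_def)
  qed
  obtain b where b: "\<forall>s\<in>L'. b s \<in> C' s \<and> (\<forall>s'\<in>L'. s' \<noteq> s \<longrightarrow> b s' \<notin> X (b s) s \<and> b s' \<noteq> b s)"
    using Suc.IH[OF L(4,3), of C'] C' by blast
  let ?b = "b(s0 := c0)"
  have bc: "b s \<in> E s" "c0 \<notin> X (b s) s" "b s \<notin> X c0 s0" "b s \<noteq> c0" if "s \<in> L'" for s
  proof -
    have "b s \<in> C' s" using b that by auto
    then show "b s \<in> E s" "c0 \<notin> X (b s) s" "b s \<notin> X c0 s0" "b s \<noteq> c0" by (auto simp: C'_def hit_def)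
  qed
  have "?b s \<in> C s \<and> (\<forall>s'\<in>L. s' \<noteq> s \<longrightarrow> ?b s' \<notin> X (?b s) s \<and> ?b s' \<noteq> ?b s)" if "s \<in> L" for s
    using that L c0(1) E[of s0] E[of s] bc b by (auto simp del: free_set_bound.simps)
  then show ?case by blast
qed

section \<open>The window graph\<close>

lemma digits_exist:
  fixes b :: nat
  assumes "\<And>j. j < n \<Longrightarrow> f j < b"
  shows "\<exists>x < b ^ n. \<forall>j<n. (x div b ^ j) mod b = f j"
  using assms
proof (induction n)
  case 0
  then show ?case by simp
next
  case (Suc n)
  then obtain x where x: "x < b ^ n" "\<forall>j<n. (x div b ^ j) mod b = f j" by auto
  have fn: "f n < b" using Suc.prems by simp
  have "x + f n * b ^ n < b ^ n + f n * b ^ n" using x(1) by simp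
  also have "\<dots> = (f n + 1) * b ^ n" by simp
  also have "\<dots> \<le> b * b ^ n" using fn by (intro mult_le_mono1) simp
  finally have "x + f n * b ^ n < b ^ Suc n" by simp
  moreover have "((x + f n * b ^ n) div b ^ j) mod b = f j" if "j < Suc n" for j
  proof (cases "j = n")
    case True
    then show ?thesis using x(1) fn by simp
  next
    case False
    then have j: "j < n" using that by simp
    then have "b ^ n = b ^ j * (b * b ^ (n - Suc j))"
      by (metis Suc_diff_Suc le_add_diff_inverse less_imp_le_nat power_Suc power_add)
    then have "x + f n * b ^ n = x + b ^ j * (b * (f n * b ^ (n - Suc j)))" by simp
    moreover have "b ^ j \<noteq> 0" using fn by simp
    ultimately have "(x + f n * b ^ n) div b ^ j = b * (f n * b ^ (n - Suc j)) + x div b ^ j"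
      by (metis div_mult_self2)
    then show ?thesis using x(2) j by simp
  qed
  ultimately show ?case by blast
qed

section \<open>Linear forms over the two-element field: spans of lists of predicates\<close>

fun spn :: "('a \<Rightarrow> bool) list \<Rightarrow> ('a \<Rightarrow> bool) set" where
  "spn [] = {\<lambda>_. False}"
| "spn (p # ps) = spn ps \<union> (\<lambda>g x. g x \<noteq> p x) ` spn ps"

lemma spn_finite_card: "finite (spn ps) \<and> card (spn ps) \<le> 2 ^ length ps"
proof (induction ps)
  case (Cons p ps)
  have "card (spn (p # ps)) \<le> card (spn ps) + card ((\<lambda>g x. g x \<noteq> p x) ` spn ps)"
    by (simp add: card_Un_le)
  also have "\<dots> \<le> card (spn ps) + card (spn ps)" using Cons by (intro add_mono card_image_le) auto
  finally show ?case using Cons by auto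
qed simp

lemma spn_zero: "(\<lambda>_. False) \<in> spn ps"
  by (induction ps) auto

lemma spn_xor: "f \<in> spn ps \<Longrightarrow> g \<in> spn ps \<Longrightarrow> (\<lambda>x. f x \<noteq> g x) \<in> spn ps"
proof (induction ps arbitrary: f g)
  case Nil
  then show ?case by (auto simp: fun_eq_iff)
next
  case (Cons p ps)
  then obtain f' g' where f': "f' \<in> spn ps" "f = f' \<or> f = (\<lambda>x. f' x \<noteq> p x)"
    and g': "g' \<in> spn ps" "g = g' \<or> g = (\<lambda>x. g' x \<noteq> p x)" by auto
  have fg: "(\<lambda>x. f' x \<noteq> g' x) \<in> spn ps" using Cons.IH f'(1) g'(1) .
  have "(\<lambda>x. f x \<noteq> g x) = (\<lambda>x. f' x \<noteq> g' x) \<or> (\<lambda>x. f x \<noteq> g x) = (\<lambda>x. (f' x \<noteq> g' x) \<noteq> p x)"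
    using f'(2) g'(2) by (elim disjE) (simp_all add: fun_eq_iff, blast+)
  then show ?case
  proof
    assume "(\<lambda>x. f x \<noteq> g x) = (\<lambda>x. f' x \<noteq> g' x)"
    then show ?thesis using fg by simp
  next
    assume *: "(\<lambda>x. f x \<noteq> g x) = (\<lambda>x. (f' x \<noteq> g' x) \<noteq> p x)"
    have "(\<lambda>x. f x \<noteq> g x) \<in> (\<lambda>g x. g x \<noteq> p x) ` spn ps"
      by (rule image_eqI[OF _ fg]) (rule *)
    then show ?thesis by simp
  qed
qed

lemma odd_card_insert:
  assumes "finite I" "i \<notin> I"
  shows "odd (card {j \<in> insert i I. P j}) = (P i \<noteq> odd (card {j \<in> I. P j}))"
proof -
  have "{j \<in> insert i I. P j} = (if P i then insert i {j \<in> I. P j} else {j \<in> I. P j})" by auto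
  then show ?thesis using assms by auto
qed

lemma spn_sum:
  assumes "finite I" "\<And>i. i \<in> I \<Longrightarrow> w i \<in> spn ps"
  shows "(\<lambda>x. odd (card {i \<in> I. w i x})) \<in> spn ps"
  using assms
proof (induction I rule: finite_induct)
  case empty
  then show ?case by (simp add: spn_zero)
next
  case (insert i I)
  have "(\<lambda>x. odd (card {j \<in> insert i I. w j x})) = (\<lambda>x. w i x \<noteq> odd (card {j \<in> I. w j x}))"
    by (rule ext, rule odd_card_insert[OF insert(1,2)])
  moreover have "(\<lambda>x. w i x \<noteq> odd (card {j \<in> I. w j x})) \<in> spn ps"
    using insert by (intro spn_xor) blast+
  ultimately show ?case by (simp only:)
qed

text \<open>Counting replaces dimension: the \<open>2 ^ m\<close> sums over subsets are distinct,
  since evaluation at \<open>r j\<close> reveals whether \<open>j\<close> belongs to the subset,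
  while the span has at most \<open>2 ^ length ps\<close> elements.\<close>

lemma independent_le_length:
  assumes "\<And>i. i < m \<Longrightarrow> w i \<in> spn ps"
    and "\<And>i j. i < m \<Longrightarrow> j < m \<Longrightarrow> w i (r j) \<longleftrightarrow> i = j"
  shows "m \<le> length ps"
proof -
  define vec where "vec I x = odd (card {i \<in> I. w i x})" for I x
  have "vec ` Pow {..<m} \<subseteq> spn ps"
  proof
    fix g assume "g \<in> vec ` Pow {..<m}"
    then obtain I where I: "I \<subseteq> {..<m}" "g = vec I" by auto
    have "(\<lambda>x. odd (card {i \<in> I. w i x})) \<in> spn ps"
      by (rule spn_sum) (use I assms(1) finite_subset in auto)
    then show "g \<in> spn ps" using I unfolding vec_def by simp
  qed
  moreover have "inj_on vec (Pow {..<m})"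
  proof (rule inj_onI)
    have ev: "vec I (r j) \<longleftrightarrow> j \<in> I" if "I \<subseteq> {..<m}" "j < m" for I j
    proof -
      have "{i \<in> I. w i (r j)} = (if j \<in> I then {j} else {})" using that assms(2) by auto
      then show ?thesis unfolding vec_def by simp
    qed
    fix I J assume "I \<in> Pow {..<m}" "J \<in> Pow {..<m}" "vec I = vec J"
    then show "I = J" using ev[of I] ev[of J] by auto
  qed
  ultimately have "card (Pow {..<m}) \<le> card (spn ps)"
    using card_inj_on_le spn_finite_card by blast
  also have "\<dots> \<le> 2 ^ length ps" using spn_finite_card by blast
  finally have "(2::nat) ^ m \<le> 2 ^ length ps" by (simp add: card_Pow)
  then show ?thesis by simp
qed

text \<open>A vertex \<open>R\<close> codes in base \<open>N\<close> a window of \<open>d\<close> variables, and above that in base \<open>k\<close> a palette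
  of colours for the labels \<open>s < q ^ d\<close>; the base \<open>q\<close> digits of a label are the values of the window variables.
  A void vertex, which has no correct label, keeps all labels, so that it lies on some chain
  even though it already refutes satisfiability.\<close>

locale gap_graph =
  fixes N q d k :: nat and bad :: "nat \<Rightarrow> nat \<Rightarrow> nat \<Rightarrow> nat \<Rightarrow> nat \<Rightarrow> nat \<Rightarrow> nat \<Rightarrow> nat \<Rightarrow> bool"
begin

definition win :: "nat \<Rightarrow> nat \<Rightarrow> nat" where "win R j = (R div N ^ j) mod N"

definition pal :: "nat \<Rightarrow> nat \<Rightarrow> nat" where "pal R s = (R div (N ^ d * k ^ s)) mod k"

definition lab :: "nat \<Rightarrow> nat \<Rightarrow> nat" where "lab s j = (s div q ^ j) mod q"

text \<open>The first condition is needed because a window is a sequence in which variables may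
  repeat; sets with fewer than \<open>d\<close> elements are represented by padding.\<close>

definition valid :: "nat \<Rightarrow> nat \<Rightarrow> bool" where
  "valid R s \<longleftrightarrow> (\<forall>i<d. \<forall>j<d. win R i = win R j \<longrightarrow> lab s i = lab s j) \<and>
     (\<forall>j1<d. \<forall>j2<d. \<forall>j3<d. \<forall>j4<d.
        \<not> bad (win R j1) (win R j2) (win R j3) (win R j4) (lab s j1) (lab s j2) (lab s j3) (lab s j4))"

definition cons :: "nat \<Rightarrow> nat \<Rightarrow> nat \<Rightarrow> nat \<Rightarrow> bool" where
  "cons R s R' s' \<longleftrightarrow> (\<forall>i<d. \<forall>j<d. win R i = win R' j \<longrightarrow> lab s i = lab s' j)"

definition void :: "nat \<Rightarrow> bool" where "void R \<longleftrightarrow> (\<forall>s < q ^ d. \<not> valid R s)"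

definition ok :: "nat \<Rightarrow> nat \<Rightarrow> bool" where "ok R s \<longleftrightarrow> valid R s \<or> void R"

definition mem :: "nat \<Rightarrow> nat \<Rightarrow> bool" where "mem R c \<longleftrightarrow> (\<exists>s < q ^ d. ok R s \<and> pal R s = c)"

text \<open>These are the pairs for which the gate set will contain a direct gate from the data
  qubit of \<open>R'\<close> to the target of \<open>R\<close>. The relation must be generous enough
  to clean up after any colouring by a global assignment, yet leave entries with inconsistent labels
  under control.\<close>

definition free :: "nat \<Rightarrow> nat \<Rightarrow> bool" where
  "free R' R \<longleftrightarrow> R \<noteq> R' \<and> (\<exists>s < q ^ d. \<exists>s' < q ^ d. ok R s \<and> ok R' s' \<and> cons R s R' s' \<and> pal R s = pal R' s')"

definition verts :: nat where "verts = N ^ d * k ^ (q ^ d)"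

definition sat :: bool where
  "sat \<longleftrightarrow> (\<exists>A. (\<forall>v<N. A v < q) \<and>
     (\<forall>v1<N. \<forall>v2<N. \<forall>v3<N. \<forall>v4<N. \<not> bad v1 v2 v3 v4 (A v1) (A v2) (A v3) (A v4)))"

text \<open>Every combination of a window with a palette occurs; this freedom is what the lower
  bound exploits.\<close>

lemma vertex_exists:
  assumes "\<And>j. j < d \<Longrightarrow> v j < N" "\<And>s. s < q ^ d \<Longrightarrow> b s < k"
  shows "\<exists>R<verts. (\<forall>j<d. win R j = v j) \<and> (\<forall>s<q ^ d. pal R s = b s)"
proof -
  obtain x where x: "x < N ^ d" "\<forall>j<d. (x div N ^ j) mod N = v j"
    using digits_exist[of d v N] assms(1) by blast
  obtain y where y: "y < k ^ (q ^ d)" "\<forall>s<q ^ d. (y div k ^ s) mod k = b s"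
    using digits_exist[of "q ^ d" b k] assms(2) by blast
  let ?R = "x + N ^ d * y"
  have "?R < N ^ d + N ^ d * y" using x(1) by simp
  also have "\<dots> = N ^ d * (y + 1)" by simp
  also have "\<dots> \<le> N ^ d * k ^ (q ^ d)" using y(1) by (intro mult_le_mono2) simp
  finally have "?R < verts" by (simp add: verts_def)
  moreover have "win ?R j = v j" if j: "j < d" for j
  proof -
    have N0: "N > 0" using assms(1)[OF j] by simp
    have "N ^ d = N ^ j * (N * N ^ (d - Suc j))"
      by (metis Suc_diff_Suc j le_add_diff_inverse less_imp_le_nat power_Suc power_add)
    then have "?R = x + N ^ j * (N * (N ^ (d - Suc j) * y))" by simp
    then have "?R div N ^ j = N * (N ^ (d - Suc j) * y) + x div N ^ j"
      using N0 by (metis div_mult_self2 gr_implies_not0 power_not_zero)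
    then show ?thesis using x(2) j by (simp add: win_def)
  qed
  moreover have "pal ?R s = b s" if s: "s < q ^ d" for s
  proof -
    have "N ^ d \<noteq> 0" using x(1) by linarith
    then have "?R div N ^ d = y" using div_mult_self2[of "N ^ d" x y] x(1) by simp
    then show ?thesis using y(2) s by (simp add: pal_def div_mult2_eq)
  qed
  ultimately show ?thesis by blast
qed

lemma win_less: "N > 0 \<Longrightarrow> win R j < N" by (simp add: win_def)

lemma pal_less: "k > 0 \<Longrightarrow> pal R s < k" by (simp add: pal_def)

text \<open>Labels that are restrictions of one assignment are consistent with each other, so two
  vertices that receive the same colour through them are automatically \<open>free\<close>.\<close>

lemma sat_coloring:
  assumes sat and N0: "N > 0"
  shows "(\<forall>R. \<not> void R) \<and> (\<exists>col. (\<forall>R. \<exists>s < q ^ d. ok R s \<and> pal R s = col R) \<and>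
    (\<forall>R R'. R \<noteq> R' \<longrightarrow> col R = col R' \<longrightarrow> free R' R))"
proof -
  obtain A where A0: "(\<forall>v<N. A v < q) \<and>
     (\<forall>v1<N. \<forall>v2<N. \<forall>v3<N. \<forall>v4<N. \<not> bad v1 v2 v3 v4 (A v1) (A v2) (A v3) (A v4))"
    using assms(1) unfolding sat_def by (elim exE)
  then have A: "\<And>v. v < N \<Longrightarrow> A v < q"
    "\<And>v1 v2 v3 v4. v1 < N \<Longrightarrow> v2 < N \<Longrightarrow> v3 < N \<Longrightarrow> v4 < N \<Longrightarrow> \<not> bad v1 v2 v3 v4 (A v1) (A v2) (A v3) (A v4)"
    by simp_all
  have "\<exists>s<q ^ d. \<forall>j<d. lab s j = A (win R j)" for R
    unfolding lab_def by (rule digits_exist) (use A(1) win_less N0 in blast)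
  then obtain S where S: "\<And>R. S R < q ^ d" "\<And>R j. j < d \<Longrightarrow> lab (S R) j = A (win R j)" by metis
  have v: "valid R (S R)" for R unfolding valid_def using S A win_less[OF N0] by simp
  then have "\<not> void R" for R using S(1) unfolding void_def by blast
  moreover have c: "cons R (S R) R' (S R')" for R R' unfolding cons_def using S by simp
  moreover have ok: "ok R (S R)" for R using v[of R] unfolding ok_def ..
  moreover have "free R' R" if "R \<noteq> R'" "pal R (S R) = pal R' (S R')" for R R'
    unfolding free_def
    by (rule conjI[OF that(1)], rule exI[of _ "S R"], rule conjI[OF S(1)], rule exI[of _ "S R'"])
      (use ok c S(1) that(2) in simp)
  moreover have "\<exists>s < q ^ d. ok R s \<and> pal R s = pal R (S R)" for R using ok S(1) by auto
  ultimately show ?thesis by (intro conjI allI exI[of _ "\<lambda>R. pal R (S R)"] impI)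
qed

end

text \<open>The parameters of the reduction: \<open>a\<close> is the gap aimed at, \<open>q\<close> the domain size.
  Windows have \<open>level m m\<close> variables, where \<open>m\<close> exceeds the rank available to a typical gate.\<close>

definition gap_m :: "nat \<Rightarrow> nat" where "gap_m a = 2 * a + 1"
definition gap_d :: "nat \<Rightarrow> nat" where "gap_d a = level (gap_m a) (gap_m a)"
definition gap_k :: "nat \<Rightarrow> nat \<Rightarrow> nat" where
  "gap_k a q = 2 * gap_m a * (free_set_bound (gap_m a * q ^ gap_d a) (q ^ gap_d a) + 1)"

section \<open>Rank lower bound for unsatisfiable constraints\<close>

lemma free_set_bound_mono: "i \<le> j \<Longrightarrow> free_set_bound h i \<le> free_set_bound h j"
  by (rule lift_Suc_mono_le[of "free_set_bound h"]) auto

lemma gap_d_pos: "gap_d a \<ge> 1"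
  using level_mono[of "gap_m a" 0 "gap_m a"] by (simp add: gap_d_def gap_m_def)

lemma gap_k_pos: "gap_k a q > 0"
  by (simp add: gap_k_def gap_m_def)

text \<open>Markov's inequality: at most half of the colours exceed twice the allowed
  average.\<close>

lemma many_good:
  fixes len :: "nat \<Rightarrow> nat"
  assumes "(\<Sum>c<k. len c) \<le> a * k"
  shows "k \<le> 2 * card {c. c < k \<and> len c \<le> 2 * a}"
proof -
  let ?B = "{c. c < k \<and> \<not> len c \<le> 2 * a}" and ?G = "{c. c < k \<and> len c \<le> 2 * a}"
  have "card ?G + card ?B = card (?G \<union> ?B)" by (subst card_Un_disjoint) auto
  also have "?G \<union> ?B = {..<k}" by auto
  finally have tot: "card ?G + card ?B = k" by simp
  have "card ?B * (2 * a + 1) = (\<Sum>c\<in>?B. 2 * a + 1)" by simp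
  also have "\<dots> \<le> (\<Sum>c\<in>?B. len c)" by (rule sum_mono) auto
  also have "\<dots> \<le> (\<Sum>c<k. len c)" by (rule sum_mono2) auto
  also have "\<dots> \<le> a * k" by (rule assms)
  finally have "card ?B * (2 * a + 1) \<le> a * k" .
  then have "2 * card ?B * (2 * a + 1) \<le> 2 * a * k" by simp
  also have "\<dots> \<le> k * (2 * a + 1)" by simp
  finally have "2 * card ?B \<le> k" by (rule mult_right_le_imp_le) simp
  then show ?thesis using tot by linarith
qed

context gap_graph
begin

definition labels :: "nat \<Rightarrow> nat set" where "labels R = {s. s < q ^ d \<and> valid R s}"

definition same_win :: "nat \<Rightarrow> nat \<Rightarrow> bool" where "same_win R Q \<longleftrightarrow> (\<forall>j<d. win R j = win Q j)"

lemma valid_cong: "same_win R Q \<Longrightarrow> valid R s = valid Q s"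
  unfolding valid_def same_win_def by auto

lemma labels_cong: "same_win R Q \<Longrightarrow> labels R = labels Q"
  unfolding labels_def using valid_cong by auto

lemma cons_cong: "same_win R Q \<Longrightarrow> same_win R' Q' \<Longrightarrow> cons R s R' s' = cons Q s Q' s'"
  unfolding cons_def same_win_def by auto

lemma valid_cons: "valid R s \<Longrightarrow> cons R s R s"
  unfolding valid_def cons_def by blast

lemma finite_labels: "finite (labels R)" and card_labels: "card (labels R) \<le> q ^ d"
proof -
  have "labels R \<subseteq> {..<q ^ d}" unfolding labels_def by auto
  then show "finite (labels R)" "card (labels R) \<le> q ^ d"
    using finite_subset card_mono[of "{..<q ^ d}" "labels R"] by auto
qed

text \<open>For the label \<open>s\<close> of the window of \<open>Q\<close>, colour \<open>c\<close> is really used: some vertex with this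
  window chooses \<open>c\<close> because of \<open>s\<close>, and the rest of its palette avoids any given small set of colours.\<close>

definition forced :: "(nat \<Rightarrow> nat) \<Rightarrow> nat \<Rightarrow> nat \<Rightarrow> nat \<Rightarrow> nat \<Rightarrow> bool" where
  "forced ch h Q c s \<longleftrightarrow> s \<in> labels Q \<and> (\<forall>X. finite X \<longrightarrow> card X \<le> h \<longrightarrow> c \<notin> X \<longrightarrow>
     (\<exists>R<verts. same_win R Q \<and> inj_on (pal R) (labels Q) \<and> pal R ` labels Q \<inter> X = {} \<and> pal R s = c \<and> ch R = c))"

text \<open>Otherwise every correct label \<open>s\<close> has many colours \<open>c\<close> with a
  witness \<open>X c s\<close> against \<open>forced\<close>. By \<open>free_choice\<close> one of
  them can be picked for each label such that all are distinct and none lies in the witness of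
  another. The vertex with this palette uses one of its colours, say that of \<open>s\<close>, and
  is just the vertex that the witness of \<open>s\<close> excludes.\<close>

lemma forced_label:
  assumes N0: "N > 0" and k0: "k > 0"
    and nv: "\<And>R. R < verts \<Longrightarrow> \<not> void R"
    and ch: "\<And>R. R < verts \<Longrightarrow> mem R (ch R)"
    and G: "G \<subseteq> {..<k}"
  shows "\<exists>s\<in>labels Q. card {c\<in>G. \<not> forced ch h Q c s} \<le> free_set_bound h (q ^ d)"
proof (rule ccontr)
  let ?C = "\<lambda>s. {c\<in>G. \<not> forced ch h Q c s}"
  assume "\<not> ?thesis"
  then have big: "card (?C s) \<ge> free_set_bound h (q ^ d)" if "s \<in> labels Q" for s
    using that by (meson nat_le_linear)
  define P where "P c s X \<longleftrightarrow> finite X \<and> card X \<le> h \<and> c \<notin> X \<and>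
     \<not> (\<exists>R<verts. same_win R Q \<and> inj_on (pal R) (labels Q) \<and> pal R ` labels Q \<inter> X = {} \<and> pal R s = c \<and> ch R = c)" for c s X
  have "\<exists>X. (s \<in> labels Q \<and> \<not> forced ch h Q c s \<longrightarrow> P c s X) \<and> finite X \<and> card X \<le> h" for c s
  proof (cases "s \<in> labels Q \<and> \<not> forced ch h Q c s")
    case True
    then have "\<exists>X. P c s X" unfolding forced_def P_def by blast
    then show ?thesis unfolding P_def by blast
  next
    case False
    then show ?thesis by (intro exI[of _ "{}"]) auto
  qed
  then have "\<forall>c. \<forall>s. \<exists>X. (s \<in> labels Q \<and> \<not> forced ch h Q c s \<longrightarrow> P c s X) \<and> finite X \<and> card X \<le> h"
    by (intro allI)
  then obtain X where "\<forall>c s. (s \<in> labels Q \<and> \<not> forced ch h Q c s \<longrightarrow> P c s (X c s)) \<and> finite (X c s) \<and> card (X c s) \<le> h"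
    unfolding choice_iff by (elim exE)
  then have X: "\<And>c s. s \<in> labels Q \<Longrightarrow> \<not> forced ch h Q c s \<Longrightarrow> P c s (X c s)"
    "\<And>s c. finite (X c s) \<and> card (X c s) \<le> h" by auto
  have "\<exists>b. \<forall>s\<in>labels Q. b s \<in> ?C s \<and> (\<forall>s'\<in>labels Q. s' \<noteq> s \<longrightarrow> b s' \<notin> X (b s) s \<and> b s' \<noteq> b s)"
  proof (rule free_choice[OF finite_labels refl _ X(2)])
    fix s assume s: "s \<in> labels Q"
    have "free_set_bound h (card (labels Q)) \<le> free_set_bound h (q ^ d)"
      by (rule free_set_bound_mono[OF card_labels])
    moreover have "finite (?C s)" using finite_subset[OF G] by auto
    ultimately show "finite (?C s) \<and> free_set_bound h (card (labels Q)) \<le> card (?C s)"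
      using big[OF s] by simp
  qed
  then obtain b where b: "\<And>s. s \<in> labels Q \<Longrightarrow> b s \<in> ?C s"
    "\<And>s s'. s \<in> labels Q \<Longrightarrow> s' \<in> labels Q \<Longrightarrow> s' \<noteq> s \<Longrightarrow> b s' \<notin> X (b s) s \<and> b s' \<noteq> b s" by blast
  \<comment> \<open>Incorrect labels get the dummy colour 0. It does no harm: as no vertex is void,
    membership in a colour can only come from a correct label.\<close>
  have "\<exists>R<verts. (\<forall>j<d. win R j = win Q j) \<and> (\<forall>s<q ^ d. pal R s = (if s \<in> labels Q then b s else 0))"
  proof (rule vertex_exists)
    show "win Q j < N" for j using win_less[OF N0] .
    show "(if s \<in> labels Q then b s else 0) < k" for s using b(1)[of s] G k0 by auto
  qed
  then obtain R where R: "R < verts" "same_win R Q" "\<And>s. s \<in> labels Q \<Longrightarrow> pal R s = b s"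
    unfolding same_win_def labels_def by auto
  obtain s where s: "s < q ^ d" "ok R s" "pal R s = ch R" using ch[OF R(1)] unfolding mem_def by blast
  have sl: "s \<in> labels Q"
    using s nv[OF R(1)] valid_cong[OF R(2)] unfolding ok_def labels_def by blast
  have bs: "b s = ch R" using s(3) R(3)[OF sl] by simp
  have nf: "\<not> forced ch h Q (ch R) s" using b(1)[OF sl] bs by simp
  have PX: "P (ch R) s (X (ch R) s)" using X(1)[OF sl nf] .
  have "inj_on (pal R) (labels Q)"
    by (rule inj_onI) (metis R(3) b(2))
  moreover have "pal R ` labels Q \<inter> X (ch R) s = {}"
  proof -
    have "b s' \<notin> X (ch R) s" if "s' \<in> labels Q" for s'
      using b(2)[OF sl that] PX bs unfolding P_def by metis
    then show ?thesis using R(3) by auto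
  qed
  ultimately show False using PX R(1,2) s(3) unfolding P_def by blast
qed

text \<open>The vertices are chosen one after the other. The set to be avoided consists of all
  earlier palettes without \<open>c\<close>; it has at most \<open>m * q ^ d\<close> elements, which
  is why \<open>forced\<close> is used with this bound.\<close>

lemma isolated_family:
  assumes "\<And>i. i < m \<Longrightarrow> forced ch (m * q ^ d) (Q i) c (s i)"
  shows "n \<le> m \<Longrightarrow> \<exists>R. \<forall>i<n. R i < verts \<and> same_win (R i) (Q i) \<and> inj_on (pal (R i)) (labels (Q i)) \<and>
      pal (R i) (s i) = c \<and> ch (R i) = c \<and> (\<forall>j<i. pal (R i) ` labels (Q i) \<inter> pal (R j) ` labels (Q j) \<subseteq> {c})"
proof (induction n)
  case 0
  then show ?case by simp
next
  case (Suc n)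
  then obtain R where R: "\<forall>i<n. R i < verts \<and> same_win (R i) (Q i) \<and> inj_on (pal (R i)) (labels (Q i)) \<and>
      pal (R i) (s i) = c \<and> ch (R i) = c \<and> (\<forall>j<i. pal (R i) ` labels (Q i) \<inter> pal (R j) ` labels (Q j) \<subseteq> {c})"
    by auto
  let ?U = "\<Union>j<n. pal (R j) ` labels (Q j)"
  have fU: "finite ?U" using finite_labels by auto
  have "card (?U - {c}) \<le> card ?U" using fU by (intro card_mono) auto
  also have "\<dots> \<le> (\<Sum>j<n. card (pal (R j) ` labels (Q j)))" by (rule card_UN_le) simp
  also have "\<dots> \<le> (\<Sum>j<n. q ^ d)"
    by (rule sum_mono) (meson card_image_le card_labels finite_labels le_trans)
  also have "\<dots> \<le> m * q ^ d" using Suc.prems by simp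
  finally have cU: "card (?U - {c}) \<le> m * q ^ d" .
  have "forced ch (m * q ^ d) (Q n) c (s n)" using assms Suc.prems by simp
  then have "\<forall>X. finite X \<longrightarrow> card X \<le> m * q ^ d \<longrightarrow> c \<notin> X \<longrightarrow>
     (\<exists>R<verts. same_win R (Q n) \<and> inj_on (pal R) (labels (Q n)) \<and> pal R ` labels (Q n) \<inter> X = {} \<and>
        pal R (s n) = c \<and> ch R = c)" unfolding forced_def by (rule conjunct2)
  from this[rule_format, OF _ cU] fU obtain Rn where Rn: "Rn < verts" "same_win Rn (Q n)" "inj_on (pal Rn) (labels (Q n))"
    "pal Rn ` labels (Q n) \<inter> (?U - {c}) = {}" "pal Rn (s n) = c" "ch Rn = c"
    by auto
  have "pal Rn ` labels (Q n) \<inter> pal (R j) ` labels (Q j) \<subseteq> {c}" if "j < n" for j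
    using Rn(4) that by blast
  then show ?case using R Rn by (intro exI[of _ "R(n := Rn)"]) (simp add: less_Suc_eq)
qed

end

text \<open>Some colour \<open>c\<close> with at most \<open>2 * a\<close> forms is forced for all
  labels \<open>s i\<close>, and an isolated family for it makes \<open>u (R i) c (R j)\<close> the
  identity matrix. Off the diagonal, the palettes share only \<open>c\<close>, which stands for
  inconsistent labels on the two sides; so the pair is not \<open>free\<close> and the parity over
  all colours is even, while no colour but \<open>c\<close> can contribute. An identity matrix of
  order \<open>gap_m a = 2 * a + 1\<close> has too large a rank.\<close>

lemma (in gap_graph) no_clash:
  assumes k: "k = gap_k a q" and d: "d = gap_d a"
    and nv: "\<And>R. R < verts \<Longrightarrow> \<not> void R"
    and u1: "\<And>R c. R < verts \<Longrightarrow> c < k \<Longrightarrow> u R c \<in> spn (ps c)"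
    and u2: "\<And>R c R'. R < verts \<Longrightarrow> c < k \<Longrightarrow> R' < verts \<Longrightarrow> u R c R' \<Longrightarrow> mem R c \<and> mem R' c"
    and u3: "\<And>R R'. R < verts \<Longrightarrow> R' < verts \<Longrightarrow> \<not> free R' R \<Longrightarrow>
        odd (card {c. c < k \<and> u R c R'}) \<longleftrightarrow> R = R'"
    and chu: "\<And>R. R < verts \<Longrightarrow> ch R < k \<and> u R (ch R) R"
    and G: "G = {c. c < k \<and> length (ps c) \<le> 2 * a}" and kG: "k \<le> 2 * card G"
    and la: "\<And>i. i < gap_m a \<Longrightarrow> s i \<in> labels (Q i) \<and>
      card {c\<in>G. \<not> forced ch (gap_m a * q ^ d) (Q i) c (s i)} \<le> free_set_bound (gap_m a * q ^ d) (q ^ d)"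
    and incons: "\<And>i j. i < gap_m a \<Longrightarrow> j < gap_m a \<Longrightarrow> i \<noteq> j \<Longrightarrow> \<not> cons (Q i) (s i) (Q j) (s j)"
  shows False
proof -
  let ?m = "gap_m a"
  define h where "h = ?m * q ^ d"
  define B where "B = free_set_bound h (q ^ d)"
  have m1: "?m \<ge> 1" by (simp add: gap_m_def)
  have finG: "finite G" using G by auto
  let ?E = "\<lambda>i. {c\<in>G. \<not> forced ch h (Q i) c (s i)}"
  have "card (\<Union>i<?m. ?E i) \<le> (\<Sum>i<?m. card (?E i))" by (rule card_UN_le) simp
  also have "\<dots> \<le> (\<Sum>i<?m. B)" by (rule sum_mono) (use la in \<open>simp add: h_def B_def\<close>)
  also have "\<dots> < ?m * (B + 1)" using m1 by simp
  \<comment> \<open>Origin of \<open>gap_k\<close>: half of the \<open>k\<close> colours are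
    \<open>gap_m a * (B + 1)\<close> many, so one remains after each of the \<open>gap_m a\<close>
    labels has excluded \<open>B\<close>.\<close>
  also have "\<dots> \<le> card G" using kG k d by (simp add: gap_k_def B_def h_def)
  finally have "card (\<Union>i<?m. ?E i) < card G" .
  moreover have "finite (\<Union>i<?m. ?E i)" by (rule finite_subset[OF _ finG]) auto
  ultimately have "\<not> G \<subseteq> (\<Union>i<?m. ?E i)" using card_mono leD by blast
  then obtain c where c: "c \<in> G" "\<And>i. i < ?m \<Longrightarrow> forced ch h (Q i) c (s i)" by blast
  have ck: "c < k" and lc: "length (ps c) \<le> 2 * a" using c(1) G by auto
  obtain R where R: "\<forall>i<?m. R i < verts \<and> same_win (R i) (Q i) \<and> inj_on (pal (R i)) (labels (Q i)) \<and>
      pal (R i) (s i) = c \<and> ch (R i) = c \<and> (\<forall>j<i. pal (R i) ` labels (Q i) \<inter> pal (R j) ` labels (Q j) \<subseteq> {c})"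
    using isolated_family[of ?m ch Q c s ?m] c(2) unfolding h_def by blast
  have iso: "x = c" if "i < ?m" "j < ?m" "i \<noteq> j" "x \<in> pal (R i) ` labels (Q i)" "x \<in> pal (R j) ` labels (Q j)" for i j x
  proof (cases "j < i")
    case True
    then have "pal (R i) ` labels (Q i) \<inter> pal (R j) ` labels (Q j) \<subseteq> {c}" using R that(1) by simp
    then show ?thesis using that by blast
  next
    case False
    then have "i < j" using that(3) by simp
    then have "pal (R j) ` labels (Q j) \<inter> pal (R i) ` labels (Q i) \<subseteq> {c}" using R that(2) by simp
    then show ?thesis using that by blast
  qed
  have mem_pal: "x \<in> pal (R i) ` labels (Q i)" if i: "i < ?m" and mx: "mem (R i) x" for i x
  proof -
    have "R i < verts" "same_win (R i) (Q i)" using R i by auto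
    moreover obtain t where "t < q ^ d" "ok (R i) t" "pal (R i) t = x" using mx unfolding mem_def by blast
    ultimately have "t \<in> labels (Q i)" using nv valid_cong unfolding ok_def labels_def by blast
    then show ?thesis using \<open>pal (R i) t = x\<close> by blast
  qed
  have sl: "s i \<in> labels (Q i)" if "i < ?m" for i using la that by blast
  have indep: "u (R i) c (R j) \<longleftrightarrow> i = j" if ij: "i < ?m" "j < ?m" for i j
  proof (cases "i = j")
    case True
    then have "R i < verts" "ch (R i) = c" using R ij by auto
    then show ?thesis using chu True by blast
  next
    case False
    have Ri: "R i < verts" "same_win (R i) (Q i)" "inj_on (pal (R i)) (labels (Q i))" "pal (R i) (s i) = c" using R ij by auto
    have Rj: "R j < verts" "same_win (R j) (Q j)" "inj_on (pal (R j)) (labels (Q j))" "pal (R j) (s j) = c" using R ij by auto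
    have nc: "\<not> cons (R i) (s i) (R j) (s j)"
      using incons[OF ij False] cons_cong[OF Ri(2) Rj(2)] by simp
    have ne: "R i \<noteq> R j"
    proof
      assume e: "R i = R j"
      have "labels (Q i) = labels (Q j)" using e Ri(2) Rj(2) labels_cong by metis
      then have "s i = s j" using e Ri(3,4) Rj(4) sl ij by (metis inj_onD)
      moreover have "valid (R i) (s i)" using sl[OF ij(1)] valid_cong[OF Ri(2)] unfolding labels_def by simp
      ultimately show False using nc e valid_cons by metis
    qed
    have "\<not> free (R j) (R i)"
    proof
      assume "free (R j) (R i)"
      then obtain t t' where t: "t < q ^ d" "t' < q ^ d" "ok (R i) t" "ok (R j) t'" "cons (R i) t (R j) t'" "pal (R i) t = pal (R j) t'"
        unfolding free_def by blast
      have tl: "t \<in> labels (Q i)" "t' \<in> labels (Q j)"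
        using t nv[OF Ri(1)] nv[OF Rj(1)] valid_cong[OF Ri(2)] valid_cong[OF Rj(2)] unfolding ok_def labels_def by auto
      have "pal (R i) t \<in> pal (R i) ` labels (Q i)" using tl(1) by (rule imageI)
      moreover have "pal (R i) t \<in> pal (R j) ` labels (Q j)" unfolding t(6) using tl(2) by (rule imageI)
      ultimately have "pal (R i) t = c" by (rule iso[OF ij False])
      then have "pal (R i) t = pal (R i) (s i)" "pal (R j) t' = pal (R j) (s j)" using Ri(4) Rj(4) t(6) by simp_all
      then have "t = s i" "t' = s j" using inj_onD[OF Ri(3)] inj_onD[OF Rj(3)] tl sl ij by blast+
      then show False using nc t(5) by simp
    qed
    then have ev: "\<not> odd (card {c'. c' < k \<and> u (R i) c' (R j)})" using u3[OF Ri(1) Rj(1)] ne by simp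
    have only: "c' = c" if c': "c' < k" "u (R i) c' (R j)" for c'
    proof (rule iso[OF ij False])
      have "mem (R i) c'" "mem (R j) c'" using u2[OF Ri(1) c'(1) Rj(1) c'(2)] by auto
      then show "c' \<in> pal (R i) ` labels (Q i)" "c' \<in> pal (R j) ` labels (Q j)" using mem_pal ij by auto
    qed
    have "\<not> u (R i) c (R j)"
    proof
      assume a: "u (R i) c (R j)"
      have "{c'. c' < k \<and> u (R i) c' (R j)} = {c}"
        by (rule equalityI) (use only in blast, simp add: ck a)
      then show False using ev by simp
    qed
    then show ?thesis using False by simp
  qed
  have "?m \<le> length (ps c)"
  proof (rule independent_le_length)
    show "u (R i) c \<in> spn (ps c)" if "i < ?m" for i using u1 R that ck by blast
    show "u (R i) c (R j) \<longleftrightarrow> i = j" if "i < ?m" "j < ?m" for i j using indep that by blast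
  qed
  then show False using lc by (simp add: gap_m_def)
qed

text \<open>If there were few forms, \<open>forced_label\<close> would give every window a correct
  label. These labels are locally correct by definition and have no clashing family of size
  \<open>gap_m a\<close> by \<open>no_clash\<close>, so \<open>local_to_global\<close> would glue
  them to a satisfying assignment.\<close>

theorem (in gap_graph) unsat_rank:
  assumes k: "k = gap_k a q" and d: "d = gap_d a" and N0: "N > 0" and unsat: "\<not> sat"
    and nv: "\<And>R. R < verts \<Longrightarrow> \<not> void R"
    and u1: "\<And>R c. R < verts \<Longrightarrow> c < k \<Longrightarrow> u R c \<in> spn (ps c)"
    and u2: "\<And>R c R'. R < verts \<Longrightarrow> c < k \<Longrightarrow> R' < verts \<Longrightarrow> u R c R' \<Longrightarrow> mem R c \<and> mem R' c"
    and u3: "\<And>R R'. R < verts \<Longrightarrow> R' < verts \<Longrightarrow> \<not> free R' R \<Longrightarrow>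
        odd (card {c. c < k \<and> u R c R'}) \<longleftrightarrow> R = R'"
  shows "a * k < (\<Sum>c<k. length (ps c))"
proof (rule ccontr)
  let ?m = "gap_m a"
  assume "\<not> ?thesis"
  then have "(\<Sum>c<k. length (ps c)) \<le> a * k" by simp
  define G where "G = {c. c < k \<and> length (ps c) \<le> 2 * a}"
  have kG: "k \<le> 2 * card G" unfolding G_def by (rule many_good) fact
  have k0: "k > 0" using k gap_k_pos by simp
  have d1: "d \<ge> 1" using d gap_d_pos by simp
  have nfree: "\<not> free R R" for R by (simp add: free_def)
  \<comment> \<open>No vertex is \<open>free\<close> with itself, so the diagonal parity is odd and
    some colour carries the input of \<open>R\<close> to its own target. \<open>ch\<close> picks
    such a colour.\<close>
  have "\<exists>c<k. u R c R" if "R < verts" for R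
  proof (rule ccontr)
    assume "\<not> ?thesis"
    then have e: "{c. c < k \<and> u R c R} = {}" by blast
    show False using u3[OF that that nfree] unfolding e by simp
  qed
  then obtain ch where chu: "\<And>R. R < verts \<Longrightarrow> ch R < k \<and> u R (ch R) R" by metis
  have chm: "mem R (ch R)" if "R < verts" for R using u2[OF that _ that] chu[OF that] by blast
  let ?h = "?m * q ^ d"
  have "\<forall>Q. \<exists>s\<in>labels Q. card {c\<in>G. \<not> forced ch ?h Q c s} \<le> free_set_bound ?h (q ^ d)"
    using forced_label[OF N0 k0 nv chm, of G] unfolding G_def by blast
  then obtain lam where lam: "\<And>Q. lam Q \<in> labels Q"
    "\<And>Q. card {c\<in>G. \<not> forced ch ?h Q c (lam Q)} \<le> free_set_bound ?h (q ^ d)" by metis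
  have q0: "q > 0"
  proof (rule ccontr)
    assume "\<not> q > 0"
    then have "q ^ d = 0" using d1 by simp
    then have "labels 0 = {}" unfolding labels_def by (simp only: not_less_zero simp_thms Collect_empty_eq)
    then show False using lam(1)[of 0] by blast
  qed
  \<comment> \<open>A vertex always has \<open>d\<close> window entries; a smaller set is enumerated
    and then padded with its first element. The palette is irrelevant here.\<close>
  have ex_win: "\<exists>Q. win Q ` {..<d} = S" if "S \<in> windows {..<N} d" for S
  proof -
    have S: "S \<subseteq> {..<N}" "S \<noteq> {}" "card S \<le> d" using that unfolding windows_def by auto
    then have fS: "finite S" using finite_subset by blast
    obtain g where g: "g ` {..<card S} = S" using ex_bij_betw_nat_finite[OF fS] unfolding bij_betw_def atLeast0LessThan by blast
    have cS: "card S > 0" using fS S(2) by (simp add: card_gt_0_iff)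
    define v where "v j = (if j < card S then g j else g 0)" for j
    have v: "v j \<in> S" for j using g cS unfolding v_def by auto
    have "S \<subseteq> v ` {..<d}"
    proof
      fix x assume "x \<in> S"
      then obtain j where "j < card S" "x = g j" using g by auto
      then show "x \<in> v ` {..<d}" using S(3) unfolding v_def by (intro image_eqI[of _ _ j]) auto
    qed
    then have "v ` {..<d} = S" using v by auto
    moreover obtain Q where "\<forall>j<d. win Q j = v j"
      using vertex_exists[of v "\<lambda>_. 0"] v S(1) k0 by blast
    ultimately have "win Q ` {..<d} = S" by (metis (no_types, lifting) image_cong lessThan_iff)
    then show ?thesis by blast
  qed
  then obtain Q where Q: "\<And>S. S \<in> windows {..<N} d \<Longrightarrow> win (Q S) ` {..<d} = S" by metis
  \<comment> \<open>Any position of \<open>w\<close> in the window gives the same value, because the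
    label is valid.\<close>
  define f where "f S w = lab (lam (Q S)) (SOME j. j < d \<and> win (Q S) j = w)" for S w
  have vl: "valid (Q S) (lam (Q S))" for S using lam(1) unfolding labels_def by blast
  have f: "f S (win (Q S) j) = lab (lam (Q S)) j" if "j < d" for S j
  proof -
    have eq: "lab (lam (Q S)) i = lab (lam (Q S)) j" if "i < d \<and> win (Q S) i = win (Q S) j" for i
      using vl[of S] that \<open>j < d\<close> unfolding valid_def by blast
    show ?thesis unfolding f_def by (rule someI2[of _ j]) (simp add: \<open>j < d\<close>, erule eq)
  qed
  have dl: "d = level ?m ?m" using d by (simp add: gap_d_def)
  have "\<exists>A. (\<forall>v\<in>{..<N}. A v \<in> {..<q}) \<and> (\<forall>v1\<in>{..<N}. \<forall>v2\<in>{..<N}. \<forall>v3\<in>{..<N}. \<forall>v4\<in>{..<N}.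
      \<not> bad v1 v2 v3 v4 (A v1) (A v2) (A v3) (A v4))"
  proof (rule local_to_global[where f = f and m = ?m])
    show "finite {..<N}" "{..<N} \<noteq> {}" using N0 by auto
    fix S assume "S \<in> windows {..<N} (level ?m ?m)"
    then have S: "win (Q S) ` {..<d} = S" using Q dl by simp
    have "\<exists>j<d. v = win (Q S) j" if "v \<in> S" for v using that S by blast
    then obtain J where J: "\<And>v. v \<in> S \<Longrightarrow> J v < d \<and> v = win (Q S) (J v)" by metis
    have fJ: "f S v = lab (lam (Q S)) (J v)" if "v \<in> S" for v using f J that by metis
    have "f S v \<in> {..<q}" if "v \<in> S" for v using fJ[OF that] q0 by (simp add: lab_def)
    moreover have "\<not> bad v1 v2 v3 v4 (f S v1) (f S v2) (f S v3) (f S v4)"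
      if v: "v1 \<in> S" "v2 \<in> S" "v3 \<in> S" "v4 \<in> S" for v1 v2 v3 v4
    proof -
      let ?s = "lam (Q S)"
      have "\<not> bad (win (Q S) (J v1)) (win (Q S) (J v2)) (win (Q S) (J v3)) (win (Q S) (J v4))
          (lab ?s (J v1)) (lab ?s (J v2)) (lab ?s (J v3)) (lab ?s (J v4))"
        by (rule vl[of S, unfolded valid_def, THEN conjunct2, rule_format]) (use J v in simp_all)
      then show ?thesis using J v fJ by metis
    qed
    ultimately show "(\<forall>v\<in>S. f S v \<in> {..<q}) \<and> (\<forall>v1\<in>S. \<forall>v2\<in>S. \<forall>v3\<in>S. \<forall>v4\<in>S.
        \<not> bad v1 v2 v3 v4 (f S v1) (f S v2) (f S v3) (f S v4))" by blast
  next
    fix F assume F: "F \<subseteq> windows {..<N} (level ?m ?m)" "clashing f F"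
    show "card F < ?m"
    proof (rule ccontr)
      assume "\<not> card F < ?m"
      then obtain F' where F': "F' \<subseteq> F" "card F' = ?m" "finite F'"
        using obtain_subset_with_card_n[of ?m F] by (metis not_less)
      obtain g where "bij_betw g {..<?m} F'"
        using ex_bij_betw_nat_finite[OF F'(3)] F'(2) by (auto simp: atLeast0LessThan)
      then have g: "\<And>i. i < ?m \<Longrightarrow> g i \<in> F" "\<And>i j. i < ?m \<Longrightarrow> j < ?m \<Longrightarrow> i \<noteq> j \<Longrightarrow> g i \<noteq> g j"
        using F'(1) unfolding bij_betw_def inj_on_def by blast+
      show False
      proof (rule no_clash[OF k d nv u1 u2 u3 chu G_def kG, where Q = "\<lambda>i. Q (g i)" and s = "\<lambda>i. lam (Q (g i))"])
        show "lam (Q (g i)) \<in> labels (Q (g i)) \<and>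
          card {c \<in> G. \<not> forced ch (?m * q ^ d) (Q (g i)) c (lam (Q (g i)))} \<le> free_set_bound (?m * q ^ d) (q ^ d)" for i
          using lam by blast
        fix i j assume ij: "i < ?m" "j < ?m" "i \<noteq> j"
        have "clash f (g i) (g j)"
          by (rule F(2)[unfolded clashing_def, rule_format, OF g(1) g(1) g(2)]) (use ij in simp_all)
        then obtain w where w: "w \<in> g i" "w \<in> g j" "f (g i) w \<noteq> f (g j) w" unfolding clash_def by blast
        have "g i \<in> windows {..<N} d" "g j \<in> windows {..<N} d"
          using subsetD[OF F(1) g(1)[OF ij(1)]] subsetD[OF F(1) g(1)[OF ij(2)]] dl by simp_all
        then have "win (Q (g i)) ` {..<d} = g i" "win (Q (g j)) ` {..<d} = g j" using Q by blast+
        then obtain x y where xy: "x < d" "w = win (Q (g i)) x" "y < d" "w = win (Q (g j)) y" using w(1,2) by blast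
        show "\<not> cons (Q (g i)) (lam (Q (g i))) (Q (g j)) (lam (Q (g j)))"
        proof
          assume "cons (Q (g i)) (lam (Q (g i))) (Q (g j)) (lam (Q (g j)))"
          then have "lab (lam (Q (g i))) x = lab (lam (Q (g j))) y"
            unfolding cons_def using xy by metis
          then show False using w(3) f[OF xy(1), of "g i"] f[OF xy(3), of "g j"] xy(2,4) by simp
        qed
      qed
    qed
  qed
  then show False using unsat unfolding sat_def by auto
qed

section \<open>The CNOT network and its lower bounds\<close>

definition ag :: "'q \<times> 'q \<Rightarrow> ('q \<Rightarrow> bool) \<Rightarrow> 'q \<Rightarrow> bool" where
  "ag g x = x(snd g := (x (snd g) \<noteq> x (fst g)))"

definition rg :: "('q \<times> 'q) list \<Rightarrow> ('q \<Rightarrow> bool) \<Rightarrow> 'q \<Rightarrow> bool" where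
  "rg gs x = fold ag gs x"

lemma rg_Nil [simp]: "rg [] x = x" and rg_Cons [simp]: "rg (g # gs) x = rg gs (ag g x)"
  and rg_append [simp]: "rg (as @ bs) x = rg bs (rg as x)"
  by (simp_all add: rg_def)

lemma ag_apply: "ag g x q = (if q = snd g then x q \<noteq> x (fst g) else x q)"
  by (auto simp: ag_def)

lemma rg_frame: "q \<notin> snd ` set gs \<Longrightarrow> rg gs x q = x q"
  by (induction gs arbitrary: x) (auto simp: ag_apply)

lemma rg_rev: "(\<And>g. g \<in> set gs \<Longrightarrow> fst g \<noteq> snd g) \<Longrightarrow> rg (rev gs) (rg gs x) = x"
proof (induction gs arbitrary: x)
  case (Cons g gs)
  have "rg (rev (g # gs)) (rg (g # gs) x) = ag g (ag g x)"
    using Cons by simp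
  also have "\<dots> = x" using Cons.prems[of g] by (auto simp: ag_def fun_eq_iff)
  finally show ?case .
qed simp

lemma rg_cong:
  assumes "\<And>g. g \<in> set gs \<Longrightarrow> fst g \<in> X" "\<And>q. q \<in> X \<Longrightarrow> x q = y q"
  shows "q \<in> X \<Longrightarrow> rg gs x q = rg gs y q"
  using assms
proof (induction gs arbitrary: x y)
  case (Cons g gs)
  have "rg gs (ag g x) q = rg gs (ag g y) q"
    by (rule Cons.IH) (use Cons.prems in \<open>auto simp: ag_apply\<close>)
  then show ?case by simp
qed simp

text \<open>Compute, use, uncompute: \<open>bs\<close> may read everything but writes only to
  \<open>X\<close>, which \<open>as\<close> does not touch, so the reversed \<open>as\<close> undoes
  the first pass outside \<open>X\<close>.\<close>

lemma rg_sandwich: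
  assumes A: "\<And>g. g \<in> set as \<Longrightarrow> fst g \<noteq> snd g \<and> fst g \<notin> X \<and> snd g \<notin> X"
    and B: "\<And>g. g \<in> set bs \<Longrightarrow> snd g \<in> X"
  shows "rg (as @ bs @ rev as) z = (\<lambda>q. if q \<in> X then rg bs (rg as z) q else z q)"
proof
  fix q
  show "rg (as @ bs @ rev as) z q = (if q \<in> X then rg bs (rg as z) q else z q)"
  proof (cases "q \<in> X")
    case True
    then have "q \<notin> snd ` set (rev as)" using A by auto
    then show ?thesis using True by (simp add: rg_frame del: set_rev)
  next
    case False
    have "rg (rev as) (rg bs (rg as z)) q = rg (rev as) (rg as z) q"
    proof (rule rg_cong[where X = "- X"])
      show "rg bs (rg as z) q' = rg as z q'" if "q' \<in> - X" for q'
        by (rule rg_frame) (use B that in auto)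
    qed (use A False in auto)
    also have "\<dots> = z q" using rg_rev[of as z] A by simp
    finally show ?thesis using False by simp
  qed
qed

lemma sum_count_le_length:
  assumes "finite X" shows "(\<Sum>e\<in>X. count_list xs e) \<le> length xs"
proof -
  have "(\<Sum>e\<in>X. count_list xs e) \<le> (\<Sum>e\<in>X \<union> set xs. count_list xs e)"
    by (rule sum_mono2) (use assms in auto)
  also have "\<dots> = length xs" by (rule sum_count_set) (use assms in auto)
  finally show ?thesis .
qed

lemma count_list_filter: "P e \<Longrightarrow> count_list (filter P xs) e = count_list xs e"
  by (induction xs) auto

text \<open>In copy \<open>i\<close>, \<open>Dq i R\<close> and \<open>Bq i R\<close> are the data qubits of vertex \<open>R\<close>, \<open>Gq i c\<close> collects the inputs of
  colour \<open>c\<close>, and \<open>Pq i c 0, \<dots>, Pq i c (l - 1)\<close> is the chain of colour \<open>c\<close>. All copies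
  of colour \<open>c\<close> pass through the hub \<open>Hq c\<close>, which bounds the depth from below.\<close>

datatype qb = Dq nat nat | Bq nat nat | Hq nat | Gq nat nat | Pq nat nat nat

locale net =
  fixes M k W l :: nat and mem free :: "nat \<Rightarrow> nat \<Rightarrow> bool"
begin

inductive_set edge :: "(qb \<times> qb) set" where
  DG: "i < W \<Longrightarrow> R < M \<Longrightarrow> c < k \<Longrightarrow> mem R c \<Longrightarrow> (Dq i R, Gq i c) \<in> edge"
| GH: "i < W \<Longrightarrow> c < k \<Longrightarrow> (Gq i c, Hq c) \<in> edge"
| HP: "i < W \<Longrightarrow> c < k \<Longrightarrow> (Hq c, Pq i c 0) \<in> edge"
| PP: "i < W \<Longrightarrow> c < k \<Longrightarrow> Suc j < l \<Longrightarrow> (Pq i c j, Pq i c (Suc j)) \<in> edge"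
| PB: "i < W \<Longrightarrow> R < M \<Longrightarrow> c < k \<Longrightarrow> mem R c \<Longrightarrow> (Pq i c (l - 1), Bq i R) \<in> edge"
| DB: "i < W \<Longrightarrow> R < M \<Longrightarrow> R' < M \<Longrightarrow> free R' R \<Longrightarrow> (Dq i R', Bq i R) \<in> edge"

definition tgt :: "(qb \<Rightarrow> bool) \<Rightarrow> qb \<Rightarrow> bool" where
  "tgt z q = (case q of Bq i R \<Rightarrow> (if i < W \<and> R < M then z q \<noteq> z (Dq i R) else z q) | _ \<Rightarrow> z q)"

definition link :: "nat \<Rightarrow> nat \<Rightarrow> nat \<Rightarrow> qb \<times> qb" where
  "link i c j = (case j of 0 \<Rightarrow> (Hq c, Pq i c 0) | Suc j' \<Rightarrow> (Pq i c j', Pq i c j))"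

definition bas :: "nat \<Rightarrow> nat \<Rightarrow> qb \<Rightarrow> bool" where "bas i R q \<longleftrightarrow> q = Dq i R"

text \<open>The content of every qubit, as a linear form in the inputs of copy \<open>i\<close>.\<close>

definition form :: "nat \<Rightarrow> (qb \<times> qb) list \<Rightarrow> qb \<Rightarrow> nat \<Rightarrow> bool" where
  "form i gs q R' = rg gs (bas i R') q"

lemma form_snoc:
  "form i (gs @ [(p, t)]) q = (if q = t then (\<lambda>R'. form i gs q R' \<noteq> form i gs p R') else form i gs q)"
  by (auto simp: form_def fun_eq_iff ag_apply)

fun gate_of :: "qb \<Rightarrow> nat option" where
  "gate_of (Gq i c) = Some c"
| "gate_of (Hq c) = Some c"
| "gate_of (Pq i c j) = Some c"
| "gate_of _ = None"

text \<open>The chain of colour \<open>c\<close> is cut at link \<open>j0 c\<close>; \<open>ps c\<close> lists the linear forms that were sent across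
  the cut, and \<open>u R c\<close> is the form that reached \<open>Bq i R\<close> from beyond it.\<close>

definition cutinv where
  "cutinv i j0 gs ps u \<longleftrightarrow>
     (\<forall>c. length (ps c) = count_list gs (link i c (j0 c))) \<and>
     (\<forall>i' R R'. form i gs (Dq i' R) R' \<longleftrightarrow> i' = i \<and> R = R') \<and>
     (\<forall>q c R'. gate_of q = Some c \<longrightarrow> form i gs q R' \<longrightarrow> mem R' c) \<and>
     (\<forall>c j. j0 c \<le> j \<longrightarrow> form i gs (Pq i c j) \<in> spn (ps c)) \<and>
     (\<forall>R c. u R c \<in> spn (ps c)) \<and>
     (\<forall>R c R'. u R c R' \<longrightarrow> mem R c \<and> mem R' c) \<and>
     (\<forall>R R'. \<not> free R' R \<longrightarrow> form i gs (Bq i R) R' = odd (card {c. c < k \<and> u R c R'}))"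

lemma cutinvD:
  assumes "cutinv i j0 gs ps u"
  shows "length (ps c) = count_list gs (link i c (j0 c))"
    and "form i gs (Dq i' R) R' \<longleftrightarrow> i' = i \<and> R = R'"
    and "gate_of q = Some c \<Longrightarrow> form i gs q R' \<Longrightarrow> mem R' c"
    and "j0 c \<le> j \<Longrightarrow> form i gs (Pq i c j) \<in> spn (ps c)"
    and "u R c \<in> spn (ps c)"
    and "u R c R' \<Longrightarrow> mem R c \<and> mem R' c"
    and "\<not> free R' R \<Longrightarrow> form i gs (Bq i R) R' = odd (card {c. c < k \<and> u R c R'})"
  using assms unfolding cutinv_def by blast+

lemma link_inj: "link i c j = link i' c' j' \<Longrightarrow> i = i' \<and> c = c' \<and> j = j'"
  by (auto simp: link_def split: nat.splits)

lemma link_snd: "link i c j \<noteq> (p, t)" if "t \<noteq> Pq i c j"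
  using that by (auto simp: link_def split: nat.splits)

lemma cutinv_mem:
  assumes "cutinv i j0 gs ps u"
  shows "form i gs (Gq i' c) R' \<Longrightarrow> mem R' c" and "form i gs (Hq c) R' \<Longrightarrow> mem R' c"
    and "form i gs (Pq i' c j) R' \<Longrightarrow> mem R' c"
  by (rule cutinvD(3)[OF assms]; simp)+

text \<open>Covers all gates except the cut links of copy \<open>i\<close> and the gates from its
  chain ends to its targets. Premise \<open>bq\<close> admits the direct gates: they change a target
  only at a \<open>free\<close> pair, about which the invariant says nothing.\<close>

lemma cutinv_other:
  assumes inv: "cutinv i j0 gs ps u" and nl: "\<And>c. link i c (j0 c) \<noteq> (p, t)"
    and nd: "\<And>i R. t \<noteq> Dq i R"
    and mm: "\<And>c R'. gate_of t = Some c \<Longrightarrow> form i gs p R' \<Longrightarrow> mem R' c"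
    and sp: "\<And>c j. t = Pq i c j \<Longrightarrow> j0 c \<le> j \<Longrightarrow> form i gs p \<in> spn (ps c)"
    and bq: "\<And>R R'. t = Bq i R \<Longrightarrow> \<not> free R' R \<Longrightarrow> \<not> form i gs p R'"
  shows "cutinv i j0 (gs @ [(p, t)]) ps u"
proof -
  note D = cutinvD[OF inv]
  have a3: "mem R' c" if "gate_of q = Some c" "form i (gs @ [(p, t)]) q R'" for q c R'
  proof -
    have "form i gs q R' \<or> (q = t \<and> form i gs p R')" using that(2) by (auto simp: form_snoc split: if_splits)
    then show ?thesis using that(1) D(3) mm by blast
  qed
  have a4: "form i (gs @ [(p, t)]) (Pq i c j) \<in> spn (ps c)" if "j0 c \<le> j" for c j
  proof (cases "t = Pq i c j")
    case True
    then show ?thesis using spn_xor[OF D(4)[OF that] sp[OF True that]] by (simp add: form_snoc)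
  next
    case False
    then have "form i (gs @ [(p, t)]) (Pq i c j) = form i gs (Pq i c j)" by (auto simp: form_snoc)
    then show ?thesis using D(4)[OF that] by simp
  qed
  have a7: "form i (gs @ [(p, t)]) (Bq i R) R' = odd (card {c. c < k \<and> u R c R'})" if "\<not> free R' R" for R R'
    using D(7)[OF that] bq[OF _ that] by (auto simp: form_snoc)
  show ?thesis unfolding cutinv_def
  proof (intro conjI allI)
    show "length (ps c) = count_list (gs @ [(p, t)]) (link i c (j0 c))" for c
      using D(1)[of c] nl[of c] by simp
    show "form i (gs @ [(p, t)]) (Dq i' R) R' \<longleftrightarrow> i' = i \<and> R = R'" for i' R R'
      using D(2)[of i' R R'] nd[of i' R] by (auto simp: form_snoc)
  qed (use a3 a4 a7 D(5,6) in blast)+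
qed

text \<open>The only way for new information to get behind the cut; it costs one form and one use of
  the cut link.\<close>

lemma cutinv_cut:
  assumes inv: "cutinv i j0 gs ps u" and e: "(p, Pq i c j) = link i c (j0 c)" and ij: "j = j0 c"
    and m: "\<And>R'. form i gs p R' \<Longrightarrow> mem R' c"
  shows "cutinv i j0 (gs @ [(p, Pq i c j)]) (ps(c := form i gs p # ps c)) u"
proof -
  note D = cutinvD[OF inv]
  let ?ps = "ps(c := form i gs p # ps c)"
  have sub: "spn (ps c') \<subseteq> spn (?ps c')" for c' by auto
  have a3: "mem R' c'" if "gate_of q = Some c'" "form i (gs @ [(p, Pq i c j)]) q R'" for q c' R'
  proof -
    have "form i gs q R' \<or> (q = Pq i c j \<and> form i gs p R')" using that(2) by (auto simp: form_snoc split: if_splits)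
    then show ?thesis using that(1) D(3) m by auto
  qed
  have a4: "form i (gs @ [(p, Pq i c j)]) (Pq i c' j') \<in> spn (?ps c')" if "j0 c' \<le> j'" for c' j'
  proof (cases "c' = c \<and> j' = j")
    case True
    then show ?thesis using D(4)[OF that] by (auto simp: form_snoc)
  next
    case False
    then have "form i (gs @ [(p, Pq i c j)]) (Pq i c' j') = form i gs (Pq i c' j')" by (auto simp: form_snoc)
    then show ?thesis using D(4)[OF that] sub by auto
  qed
  have a5: "u R c' \<in> spn (?ps c')" for R c' using D(5)[of R c'] sub by blast
  have a7: "form i (gs @ [(p, Pq i c j)]) (Bq i R) R' = odd (card {c. c < k \<and> u R c R'})" if "\<not> free R' R" for R R'
    using D(7)[OF that] by (auto simp: form_snoc)
  show ?thesis unfolding cutinv_def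
  proof (intro conjI allI)
    show "length (?ps c') = count_list (gs @ [(p, Pq i c j)]) (link i c' (j0 c'))" for c'
    proof (cases "c' = c")
      case True
      then show ?thesis using D(1)[of c] e by simp
    next
      case False
      then have "(p, Pq i c j) \<noteq> link i c' (j0 c')" using e link_inj by metis
      then show ?thesis using D(1)[of c'] False by simp
    qed
    show "form i (gs @ [(p, Pq i c j)]) (Dq i' R) R' \<longleftrightarrow> i' = i \<and> R = R'" for i' R R'
      using D(2) by (simp add: form_snoc)
    show "gate_of q = Some c' \<longrightarrow> form i (gs @ [(p, Pq i c j)]) q R' \<longrightarrow> mem R' c'" for q c' R' using a3 by blast
    show "j0 c' \<le> j' \<longrightarrow> form i (gs @ [(p, Pq i c j)]) (Pq i c' j') \<in> spn (?ps c')" for c' j' using a4 by blast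
    show "u R c' \<in> spn (?ps c')" for R c' by (rule a5)
    show "u R c R' \<longrightarrow> mem R c \<and> mem R' c" for R c R' using D(6) by blast
    show "\<not> free R' R \<longrightarrow> form i (gs @ [(p, Pq i c j)]) (Bq i R) R' = odd (card {c. c < k \<and> u R c R'})" for R R'
      using a7 by blast
  qed
qed

lemma card_flip:
  assumes "c < k"
  shows "odd (card {c'. c' < k \<and> (if c' = c then f c' \<noteq> b else f c')}) = (odd (card {c'. c' < k \<and> f c'}) \<noteq> b)"
proof -
  have *: "odd (card {c'. c' < k \<and> g c'}) = (g c \<noteq> odd (card {c' \<in> {..<k} - {c}. g c'}))" for g
  proof -
    have "{c'. c' < k \<and> g c'} = {c' \<in> insert c ({..<k} - {c}). g c'}" using assms by auto
    then show ?thesis using odd_card_insert[of "{..<k} - {c}" c g] by simp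
  qed
  have "{c' \<in> {..<k} - {c}. if c' = c then f c' \<noteq> b else f c'} = {c' \<in> {..<k} - {c}. f c'}" by auto
  then show ?thesis using *[of "\<lambda>c'. if c' = c then f c' \<noteq> b else f c'"] *[of f] by auto
qed

lemma cutinv_step:
  assumes inv: "cutinv i j0 gs ps u" and g: "g \<in> edge" and i: "i < W" and j0: "\<forall>c. j0 c < l"
  shows "\<exists>ps u. cutinv i j0 (gs @ [g]) ps u"
proof -
  obtain p t where g': "g = (p, t)" by (cases g)
  have "(p, t) \<in> edge" using g g' by simp
  then have "\<exists>ps u. cutinv i j0 (gs @ [(p, t)]) ps u"
proof (cases rule: edge.cases)
  case (DG i' R c)
  have "cutinv i j0 (gs @ [(Dq i' R, Gq i' c)]) ps u"
    by (rule cutinv_other[OF inv link_snd]) (use DG cutinvD(2)[OF inv] in auto)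
  then show ?thesis using DG by blast
next
  case (GH i' c)
  have "cutinv i j0 (gs @ [(Gq i' c, Hq c)]) ps u"
    by (rule cutinv_other[OF inv link_snd]) (use cutinv_mem[OF inv] in auto)
  then show ?thesis using GH by blast
next
  case (HP i' c)
  show ?thesis
  proof (cases "i' = i \<and> j0 c = 0")
    case True
    have "cutinv i j0 (gs @ [(Hq c, Pq i c 0)]) (ps(c := form i gs (Hq c) # ps c)) u"
      by (rule cutinv_cut[OF inv]) (use True cutinv_mem[OF inv] in \<open>auto simp: link_def\<close>)
    then show ?thesis using HP True by blast
  next
    case False
    have "cutinv i j0 (gs @ [(Hq c, Pq i' c 0)]) ps u"
      by (rule cutinv_other[OF inv]) (use False cutinv_mem[OF inv] in \<open>auto simp: link_def split: nat.splits\<close>)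
    then show ?thesis using HP by blast
  qed
next
  case (PP i' c j)
  show ?thesis
  proof (cases "i' = i \<and> j0 c = Suc j")
    case True
    have "cutinv i j0 (gs @ [(Pq i c j, Pq i c (Suc j))]) (ps(c := form i gs (Pq i c j) # ps c)) u"
      by (rule cutinv_cut[OF inv]) (use True cutinv_mem[OF inv] in \<open>auto simp: link_def\<close>)
    then show ?thesis using PP True by blast
  next
    case False
    have "cutinv i j0 (gs @ [(Pq i' c j, Pq i' c (Suc j))]) ps u"
    proof (rule cutinv_other[OF inv])
      show "form i gs (Pq i' c j) \<in> spn (ps c')" if "Pq i' c (Suc j) = Pq i c' j'" "j0 c' \<le> j'" for c' j'
        using that False cutinvD(4)[OF inv, of c j] by auto
    qed (use False cutinv_mem[OF inv] in \<open>auto simp: link_def split: nat.splits\<close>)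
    then show ?thesis using PP by blast
  qed
next
  case (PB i' R c)
  show ?thesis
  proof (cases "i' = i")
    case False
    have "cutinv i j0 (gs @ [(Pq i' c (l - 1), Bq i' R)]) ps u"
      by (rule cutinv_other[OF inv link_snd]) (use False in auto)
    then show ?thesis using PB by blast
  next
    case True
    note D = cutinvD[OF inv]
    let ?p = "form i gs (Pq i c (l - 1))" and ?gs = "gs @ [(Pq i c (l - 1), Bq i R)]"
    \<comment> \<open>The target receives the content of the chain end, a form from behind the cut,
      and this is booked under colour \<open>c\<close>.\<close>
    define u' where "u' = (\<lambda>R1 c1. if R1 = R \<and> c1 = c then (\<lambda>R'. u R c R' \<noteq> ?p R') else u R1 c1)"
    have "j0 c < l" using j0 by simp
    then have p: "?p \<in> spn (ps c)" "\<And>R'. ?p R' \<Longrightarrow> mem R' c"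
      using D(4)[of c "l - 1"] cutinv_mem(3)[OF inv] by auto
    have a5: "u' R1 c1 \<in> spn (ps c1)" for R1 c1
      using D(5)[of R1 c1] spn_xor[OF D(5)[of R c] p(1)] unfolding u'_def by simp
    have a6: "mem R1 c1 \<and> mem R' c1" if "u' R1 c1 R'" for R1 c1 R'
      using that D(6) p(2) PB(6) unfolding u'_def by (auto split: if_splits)
    have a7: "form i ?gs (Bq i R1) R' = odd (card {c. c < k \<and> u' R1 c R'})" if nf: "\<not> free R' R1" for R1 R'
    proof (cases "R1 = R")
      case True
      have "{c'. c' < k \<and> u' R1 c' R'} = {c'. c' < k \<and> (if c' = c then u R c' R' \<noteq> ?p R' else u R c' R')}"
        using True by (auto simp: u'_def)
      then show ?thesis using card_flip[OF PB(5), of "\<lambda>c. u R c R'" "?p R'"] D(7)[OF nf] True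
        by (simp add: form_snoc)
    next
      case False
      then show ?thesis using D(7)[OF nf] by (simp add: form_snoc u'_def)
    qed
    have "cutinv i j0 ?gs ps u'" unfolding cutinv_def
    proof (intro conjI allI)
      show "length (ps c') = count_list ?gs (link i c' (j0 c'))" for c'
        using D(1)[of c'] by (simp add: link_def split: nat.splits)
      show "form i ?gs (Dq i' R) R' \<longleftrightarrow> i' = i \<and> R = R'" for i' R R'
        using D(2) by (simp add: form_snoc)
      show "gate_of q = Some c \<longrightarrow> form i ?gs q R' \<longrightarrow> mem R' c" for q c R'
        using D(3)[of q c R'] by (auto simp: form_snoc split: if_splits)
      show "j0 c \<le> j \<longrightarrow> form i ?gs (Pq i c j) \<in> spn (ps c)" for c j
        using D(4)[of c j] by (simp add: form_snoc)
    qed (use a5 a6 a7 in blast)+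
    then show ?thesis using PB True by blast
  qed
next
  \<comment> \<open>The data qubit holds a single input, and the pair is \<open>free\<close>, so the
    controlled entries of the target stay as they are.\<close>
  case (DB i' R R1)
  have "cutinv i j0 (gs @ [(Dq i' R1, Bq i' R)]) ps u"
    by (rule cutinv_other[OF inv link_snd]) (use DB cutinvD(2)[OF inv] in auto)
  then show ?thesis using DB by blast
qed
  then show ?thesis using g' by simp
qed

lemma cut_forms:
  assumes i: "i < W" and j0: "\<forall>c. j0 c < l"
  shows "set gs \<subseteq> edge \<Longrightarrow> \<exists>ps u. cutinv i j0 gs ps u"
proof (induction gs rule: rev_induct)
  case Nil
  have "cutinv i j0 [] (\<lambda>_. []) (\<lambda>_ _ _. False)"
    by (auto simp: cutinv_def form_def bas_def fun_eq_iff)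
  then show ?case by blast
next
  case (snoc g gs)
  then obtain ps u where "cutinv i j0 gs ps u" by auto
  moreover have "g \<in> edge" using snoc.prems by simp
  ultimately show ?case by (rule cutinv_step[OF _ _ i j0])
qed

text \<open>The interface to the constraint problem: the conclusion of \<open>unsat_rank\<close>,
  stated for the abstract relations \<open>mem\<close> and \<open>free\<close>.\<close>

definition rank_exceeds :: "nat \<Rightarrow> bool" where
  "rank_exceeds B \<longleftrightarrow> (\<forall>ps u. (\<forall>R<M. \<forall>c<k. u R c \<in> spn (ps c)) \<longrightarrow>
     (\<forall>R<M. \<forall>c<k. \<forall>R'<M. u R c R' \<longrightarrow> mem R c \<and> mem R' c) \<longrightarrow>
     (\<forall>R<M. \<forall>R'<M. \<not> free R' R \<longrightarrow> odd (card {c. c < k \<and> u R c R'}) = (R = R')) \<longrightarrow>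
     B < (\<Sum>c<k. length (ps c)))"

lemma copy_bound:
  assumes B: "rank_exceeds B" and gs: "set gs \<subseteq> edge" and i: "i < W" and j0: "\<forall>c. j0 c < l"
    and res: "\<And>R R'. R < M \<Longrightarrow> R' < M \<Longrightarrow> rg gs (bas i R') (Bq i R) = (R = R')"
  shows "B < (\<Sum>c<k. count_list gs (link i c (j0 c)))"
proof -
  obtain ps u where inv: "cutinv i j0 gs ps u" using cut_forms[OF i j0 gs] by blast
  have "B < (\<Sum>c<k. length (ps c))"
  proof (rule B[unfolded rank_exceeds_def, rule_format])
    show "u R c \<in> spn (ps c)" for R c using inv unfolding cutinv_def by simp
    show "mem R c \<and> mem R' c" if "u R c R'" for R c R' using inv that unfolding cutinv_def by simp
    fix R R' assume R: "R < M" "R' < M" "\<not> free R' R"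
    have "form i gs (Bq i R) R' = odd (card {c. c < k \<and> u R c R'})" using inv R(3) unfolding cutinv_def by simp
    then show "odd (card {c. c < k \<and> u R c R'}) = (R = R')" using res[OF R(1,2)] by (simp add: form_def)
  qed
  moreover have "length (ps c) = count_list gs (link i c (j0 c))" for c using inv unfolding cutinv_def by simp
  ultimately show ?thesis by simp
qed

text \<open>In every copy each chain is cut at its least used link. All \<open>l\<close> links of
  the chain are then used at least as often as the cut, and links of different chains or copies are
  different gates.\<close>

lemma size_bound:
  assumes B: "rank_exceeds B" and gs: "set gs \<subseteq> edge" and l: "l > 0"
    and res: "\<And>i R R'. i < W \<Longrightarrow> R < M \<Longrightarrow> R' < M \<Longrightarrow> rg gs (bas i R') (Bq i R) = (R = R')"
  shows "W * l * (B + 1) \<le> length gs"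
proof -
  have "\<exists>j<l. \<forall>j'<l. count_list gs (link i c j) \<le> count_list gs (link i c j')" for i c
    using ex_min_if_finite[of "(\<lambda>j. count_list gs (link i c j)) ` {..<l}"] l
    by (force simp: not_less)
  then obtain j0 where j0: "\<And>i c. j0 i c < l"
    "\<And>i c j. j < l \<Longrightarrow> count_list gs (link i c (j0 i c)) \<le> count_list gs (link i c j)" by metis
  have "B + 1 \<le> (\<Sum>c<k. count_list gs (link i c (j0 i c)))" if "i < W" for i
    using copy_bound[OF B gs that, of "j0 i"] j0(1) res that by (simp add: Suc_le_eq)
  then have "(\<Sum>i<W. l * (B + 1)) \<le> (\<Sum>i<W. l * (\<Sum>c<k. count_list gs (link i c (j0 i c))))"
    by (intro sum_mono mult_le_mono2) simp
  also have "\<dots> = (\<Sum>i<W. \<Sum>c<k. \<Sum>j<l. count_list gs (link i c (j0 i c)))"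
    by (simp add: sum_distrib_left)
  also have "\<dots> \<le> (\<Sum>i<W. \<Sum>c<k. \<Sum>j<l. count_list gs (link i c j))"
    by (intro sum_mono) (use j0(2) in simp)
  also have "\<dots> = (\<Sum>(i, c, j) \<in> {..<W} \<times> {..<k} \<times> {..<l}. count_list gs (link i c j))"
    by (simp add: sum.cartesian_product split_def)
  also have "\<dots> = (\<Sum>e \<in> (\<lambda>(i, c, j). link i c j) ` ({..<W} \<times> {..<k} \<times> {..<l}). count_list gs e)"
    by (subst sum.reindex) (auto simp: inj_on_def split_def dest: link_inj)
  also have "\<dots> \<le> length gs" by (rule sum_count_le_length) simp
  finally show ?thesis by (simp add: algebra_simps)
qed

text \<open>Here all chains are cut at their first link. For fixed \<open>c\<close> these links
  leave the common hub \<open>Hq c\<close> in every copy, and a layer contains at most one gate with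
  this source.\<close>

lemma depth_bound:
  assumes B: "rank_exceeds B" and Ls: "\<And>L. L \<in> set Ls \<Longrightarrow> set L \<subseteq> edge" and l: "l > 0"
    and par: "\<And>L c. L \<in> set Ls \<Longrightarrow> length (filter (\<lambda>g. fst g = Hq c) L) \<le> 1"
    and res: "\<And>i R R'. i < W \<Longrightarrow> R < M \<Longrightarrow> R' < M \<Longrightarrow> rg (concat Ls) (bas i R') (Bq i R) = (R = R')"
  shows "W * (B + 1) \<le> k * length Ls"
proof -
  let ?gs = "concat Ls"
  have "B + 1 \<le> (\<Sum>c<k. count_list ?gs (link i c 0))" if "i < W" for i
    using copy_bound[OF B _ that, of ?gs "\<lambda>_. 0"] Ls l res that by (fastforce simp: Suc_le_eq)
  then have "(\<Sum>i<W. B + 1) \<le> (\<Sum>i<W. \<Sum>c<k. count_list ?gs (link i c 0))"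
    by (intro sum_mono) simp
  also have "\<dots> = (\<Sum>c<k. \<Sum>i<W. count_list ?gs (link i c 0))" by (rule sum.swap)
  also have "\<dots> \<le> (\<Sum>c<k. length Ls)"
  proof (rule sum_mono)
    fix c
    let ?P = "\<lambda>g. fst g = Hq c"
    have "(\<Sum>i<W. count_list ?gs (link i c 0)) = (\<Sum>i<W. count_list (filter ?P ?gs) (link i c 0))"
      by (intro sum.cong refl count_list_filter[symmetric]) (simp add: link_def)
    also have "\<dots> = (\<Sum>e \<in> (\<lambda>i. link i c 0) ` {..<W}. count_list (filter ?P ?gs) e)"
      by (subst sum.reindex) (auto simp: inj_on_def dest: link_inj)
    also have "\<dots> \<le> length (filter ?P ?gs)" by (rule sum_count_le_length) simp
    also have "\<dots> \<le> length Ls" using par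
    proof (induction Ls)
      case (Cons L Ls)
      have "length (filter ?P L) \<le> 1" "length (filter ?P (concat Ls)) \<le> length Ls" using Cons by auto
      then show ?case by simp
    qed simp
    finally show "(\<Sum>i<W. count_list ?gs (link i c 0)) \<le> length Ls" .
  qed
  finally show ?thesis by simp
qed

end

section \<open>Cheap circuits from colourings\<close>

lemma odd_card_Suc: "odd (card {j. j < Suc n \<and> P j}) = (P n \<noteq> odd (card {j. j < n \<and> P j}))"
proof -
  have 1: "{j. j < Suc n \<and> P j} = {j \<in> insert n {..<n}. P j}" by auto
  have 2: "{j. j < n \<and> P j} = {j \<in> {..<n}. P j}" by auto
  show ?thesis unfolding 1 2 by (rule odd_card_insert) auto
qed

lemma odd_card_remove:
  fixes n :: nat
  assumes "r < n"
  shows "odd (card {j. j < n \<and> P j}) = (P r \<noteq> odd (card {j. j < n \<and> r \<noteq> j \<and> P j}))"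
proof -
  have 1: "{j. j < n \<and> P j} = {j \<in> insert r ({..<n} - {r}). P j}" using assms by auto
  have 2: "{j. j < n \<and> r \<noteq> j \<and> P j} = {j \<in> {..<n} - {r}. P j}" by auto
  show ?thesis unfolding 1 2 by (rule odd_card_insert) auto
qed

definition par :: "('q \<times> 'q) list \<Rightarrow> bool" where
  "par L \<longleftrightarrow> distinct L \<and> (\<forall>g\<in>set L. \<forall>g'\<in>set L. g \<noteq> g' \<longrightarrow> {fst g, snd g} \<inter> {fst g', snd g'} = {})"

lemma par_rev: "par L \<Longrightarrow> par (rev L)"
  by (simp add: par_def)

lemma par_map:
  assumes "\<And>i j. i < n \<Longrightarrow> j < n \<Longrightarrow> i \<noteq> j \<Longrightarrow> {fst (f i), snd (f i)} \<inter> {fst (f j), snd (f j)} = {}"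
  shows "par (map f [0..<n])"
proof -
  have "inj_on f {0..<n}"
  proof (rule inj_onI, rule ccontr)
    fix i j assume "i \<in> {0..<n}" "j \<in> {0..<n}" "f i = f j" "i \<noteq> j"
    then show False using assms[of i j] by auto
  qed
  then have "distinct (map f [0..<n])" by (simp add: distinct_map)
  moreover have "{fst g, snd g} \<inter> {fst g', snd g'} = {}"
    if g: "g \<in> set (map f [0..<n])" and g': "g' \<in> set (map f [0..<n])" and ne: "g \<noteq> g'" for g g'
  proof -
    obtain i where i: "i < n" "g = f i" using g by auto
    obtain j where j: "j < n" "g' = f j" using g' by auto
    show ?thesis unfolding i(2) j(2) by (rule assms[OF i(1) j(1)]) (use i j ne in blast)
  qed
  ultimately show ?thesis unfolding par_def by blast
qed

lemma par_concat_map: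
  assumes "\<And>i j i' j'. i < n \<Longrightarrow> i' < n \<Longrightarrow> j < m \<Longrightarrow> j' < m \<Longrightarrow> (i, j) \<noteq> (i', j') \<Longrightarrow>
    {fst (f i j), snd (f i j)} \<inter> {fst (f i' j'), snd (f i' j')} = {}"
  shows "par (concat (map (\<lambda>i. map (f i) [0..<m]) [0..<n]))"
  using assms
proof (induction n)
  case 0
  then show ?case by (simp add: par_def)
next
  case (Suc n)
  have a: "par (concat (map (\<lambda>i. map (f i) [0..<m]) [0..<n]))" by (rule Suc.IH) (use Suc.prems in auto)
  have b: "par (map (f n) [0..<m])" by (rule par_map) (use Suc.prems in auto)
  have dis: "{fst g, snd g} \<inter> {fst g', snd g'} = {}"
    if g: "g \<in> set (concat (map (\<lambda>i. map (f i) [0..<m]) [0..<n]))" and g': "g' \<in> set (map (f n) [0..<m])" for g g'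
  proof -
    obtain i j where "i < n" "j < m" "g = f i j" using g by auto
    moreover obtain j' where "j' < m" "g' = f n j'" using g' by auto
    ultimately show ?thesis using Suc.prems[of i n j j'] by auto
  qed
  then have "set (concat (map (\<lambda>i. map (f i) [0..<m]) [0..<n])) \<inter> set (map (f n) [0..<m]) = {}" by blast
  moreover have "par (as @ bs)" if "par as" "par bs" "set as \<inter> set bs = {}"
    and cross: "\<And>g g'. g \<in> set as \<Longrightarrow> g' \<in> set bs \<Longrightarrow> {fst g, snd g} \<inter> {fst g', snd g'} = {}" for as bs :: "('a \<times> 'a) list"
  proof -
    have "{fst g, snd g} \<inter> {fst g', snd g'} = {}" if g: "g \<in> set (as @ bs)" "g' \<in> set (as @ bs)" and ne: "g \<noteq> g'" for g g'
    proof -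
      consider "g \<in> set as" "g' \<in> set as" | "g \<in> set bs" "g' \<in> set bs" | "g \<in> set as" "g' \<in> set bs" | "g \<in> set bs" "g' \<in> set as"
        using g by auto
      then show ?thesis
      proof cases
        case 1
        then show ?thesis using \<open>par as\<close> ne unfolding par_def by meson
      next
        case 2
        then show ?thesis using \<open>par bs\<close> ne unfolding par_def by meson
      next
        case 3
        then show ?thesis by (rule cross)
      next
        case 4
        then show ?thesis using cross[of g' g] by (simp only: Int_commute)
      qed
    qed
    then show ?thesis using \<open>par as\<close> \<open>par bs\<close> \<open>set as \<inter> set bs = {}\<close> unfolding par_def by simp
  qed
  ultimately have "par (concat (map (\<lambda>i. map (f i) [0..<m]) [0..<n]) @ map (f n) [0..<m])"
    using a b dis by blast
  then show ?case by simp
qed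

context net
begin

definition zero_anc :: "(qb \<Rightarrow> bool) \<Rightarrow> bool" where
  "zero_anc z \<longleftrightarrow> (\<forall>i c j. \<not> z (Hq c) \<and> \<not> z (Gq i c) \<and> \<not> z (Pq i c j))"

lemma run_DG: "rg (map (\<lambda>i. (Dq i R, Gq i c0)) [0..<n]) z =
    (\<lambda>q. case q of Gq i c \<Rightarrow> (if i < n \<and> c = c0 then z q \<noteq> z (Dq i R) else z q) | _ \<Rightarrow> z q)"
  by (induction n) (auto simp: fun_eq_iff ag_apply less_Suc_eq split: qb.splits)

lemma run_load: "rg (concat (map (\<lambda>R. map (\<lambda>i. (Dq i R, Gq i (col R))) [0..<W]) [0..<n])) z =
    (\<lambda>q. case q of Gq i c \<Rightarrow> (if i < W then z q \<noteq> odd (card {R. R < n \<and> col R = c \<and> z (Dq i R)}) else z q) | _ \<Rightarrow> z q)"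
  by (induction n) (auto simp: fun_eq_iff run_DG odd_card_Suc simp del: odd_card_Suc[symmetric] split: qb.splits)

lemma run_GH: "rg (map (\<lambda>c. (Gq i0 c, Hq c)) [0..<n]) z =
    (\<lambda>q. case q of Hq c \<Rightarrow> (if c < n then z q \<noteq> z (Gq i0 c) else z q) | _ \<Rightarrow> z q)"
  by (induction n) (auto simp: fun_eq_iff ag_apply less_Suc_eq split: qb.splits)

lemma run_HP: "rg (map (\<lambda>c. (Hq c, Pq i0 c 0)) [0..<n]) z =
    (\<lambda>q. case q of Pq i c j \<Rightarrow> (if i = i0 \<and> c < n \<and> j = 0 then z q \<noteq> z (Hq c) else z q) | _ \<Rightarrow> z q)"
  by (induction n) (auto simp: fun_eq_iff ag_apply less_Suc_eq split: qb.splits)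

text \<open>The copies visit the hub in turn. The second pass of \<open>Gq\<close> into
  \<open>Hq\<close> cancels the first, so each copy finds the hub in its original state.\<close>

lemma run_star: "rg (concat (concat (map (\<lambda>i. [map (\<lambda>c. (Gq i c, Hq c)) [0..<k],
      map (\<lambda>c. (Hq c, Pq i c 0)) [0..<k], map (\<lambda>c. (Gq i c, Hq c)) [0..<k]]) [0..<n]))) z =
    (\<lambda>q. case q of Pq i c j \<Rightarrow> (if i < n \<and> c < k \<and> j = 0 then z q \<noteq> (z (Hq c) \<noteq> z (Gq i c)) else z q) | _ \<Rightarrow> z q)"
  by (induction n) (auto simp: fun_eq_iff run_GH run_HP less_Suc_eq split: qb.splits)

lemma run_PP1: "rg (map (\<lambda>c. (Pq i0 c j, Pq i0 c (Suc j))) [0..<n]) z =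
    (\<lambda>q. case q of Pq i c j' \<Rightarrow> (if i = i0 \<and> c < n \<and> j' = Suc j then z q \<noteq> z (Pq i c j) else z q) | _ \<Rightarrow> z q)"
  by (induction n) (auto simp: fun_eq_iff ag_apply less_Suc_eq split: qb.splits)

lemma run_PP: "rg (concat (map (\<lambda>i. map (\<lambda>c. (Pq i c j, Pq i c (Suc j))) [0..<k]) [0..<n])) z =
    (\<lambda>q. case q of Pq i c j' \<Rightarrow> (if i < n \<and> c < k \<and> j' = Suc j then z q \<noteq> z (Pq i c j) else z q) | _ \<Rightarrow> z q)"
  by (induction n) (auto simp: fun_eq_iff run_PP1 less_Suc_eq split: qb.splits)

lemma run_chain:
  assumes "\<And>i c j. 0 < j \<Longrightarrow> \<not> z (Pq i c j)"
  shows "rg (concat (map (\<lambda>j. concat (map (\<lambda>i. map (\<lambda>c. (Pq i c j, Pq i c (Suc j))) [0..<k]) [0..<W])) [0..<n])) z =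
    (\<lambda>q. case q of Pq i c j \<Rightarrow> (if i < W \<and> c < k \<and> 0 < j \<and> j \<le> n then z (Pq i c 0) else z q) | _ \<Rightarrow> z q)"
proof (induction n)
  case 0
  then show ?case by (auto simp: fun_eq_iff split: qb.splits)
next
  case (Suc n)
  then show ?case using assms by (auto simp: fun_eq_iff run_PP le_Suc_eq split: qb.splits)
qed

lemma run_PB1: "rg (map (\<lambda>i. (Pq i c j, Bq i R)) [0..<n]) z =
    (\<lambda>q. case q of Bq i R' \<Rightarrow> (if i < n \<and> R' = R then z q \<noteq> z (Pq i c j) else z q) | _ \<Rightarrow> z q)"
  by (induction n) (auto simp: fun_eq_iff ag_apply less_Suc_eq split: qb.splits)

lemma run_read: "rg (concat (map (\<lambda>R. map (\<lambda>i. (Pq i (col R) j, Bq i R)) [0..<W]) [0..<n])) z =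
    (\<lambda>q. case q of Bq i R \<Rightarrow> (if i < W \<and> R < n then z q \<noteq> z (Pq i (col R) j) else z q) | _ \<Rightarrow> z q)"
  by (induction n) (auto simp: fun_eq_iff run_PB1 less_Suc_eq split: qb.splits)

lemma run_DB1: "rg (map (\<lambda>i. (Dq i R', Bq i R)) [0..<n]) z =
    (\<lambda>q. case q of Bq i R1 \<Rightarrow> (if i < n \<and> R1 = R then z q \<noteq> z (Dq i R') else z q) | _ \<Rightarrow> z q)"
  by (induction n) (auto simp: fun_eq_iff ag_apply less_Suc_eq split: qb.splits)

lemma run_DB: "rg (concat (map (\<lambda>R'. if P R R' then map (\<lambda>i. (Dq i R', Bq i R)) [0..<W] else []) [0..<n])) z =
    (\<lambda>q. case q of Bq i R1 \<Rightarrow> (if i < W \<and> R1 = R then z q \<noteq> odd (card {R'. R' < n \<and> P R R' \<and> z (Dq i R')}) else z q) | _ \<Rightarrow> z q)"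
  by (induction n) (auto simp: fun_eq_iff run_DB1 odd_card_Suc split: qb.splits)

lemma run_clean: "rg (concat (concat (map (\<lambda>R. map (\<lambda>R'. if P R R' then map (\<lambda>i. (Dq i R', Bq i R)) [0..<W] else []) [0..<m]) [0..<n]))) z =
    (\<lambda>q. case q of Bq i R \<Rightarrow> (if i < W \<and> R < n then z q \<noteq> odd (card {R'. R' < m \<and> P R R' \<and> z (Dq i R')}) else z q) | _ \<Rightarrow> z q)"
  by (induction n) (auto simp: fun_eq_iff run_DB less_Suc_eq split: qb.splits)

text \<open>\<open>layersA\<close> fills the ends of the chains with the sum of all data qubits of one colour; \<open>layersB\<close>
  adds them to the targets and cancels the cross terms; \<open>layersC\<close> finally uncomputes the ancillas.
  Running \<open>Gq \<rightarrow> Hq\<close> twice around \<open>Hq \<rightarrow> Pq\<close> restores the hub.\<close>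

definition layersA :: "(nat \<Rightarrow> nat) \<Rightarrow> (qb \<times> qb) list list" where
  "layersA col = map (\<lambda>R. map (\<lambda>i. (Dq i R, Gq i (col R))) [0..<W]) [0..<M] @
     concat (map (\<lambda>i. [map (\<lambda>c. (Gq i c, Hq c)) [0..<k], map (\<lambda>c. (Hq c, Pq i c 0)) [0..<k],
       map (\<lambda>c. (Gq i c, Hq c)) [0..<k]]) [0..<W]) @
     map (\<lambda>j. concat (map (\<lambda>i. map (\<lambda>c. (Pq i c j, Pq i c (Suc j))) [0..<k]) [0..<W])) [0..<l - 1]"

definition layersB :: "(nat \<Rightarrow> nat) \<Rightarrow> (qb \<times> qb) list list" where
  "layersB col = map (\<lambda>R. map (\<lambda>i. (Pq i (col R) (l - 1), Bq i R)) [0..<W]) [0..<M] @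
     concat (map (\<lambda>R. map (\<lambda>R'. if R \<noteq> R' \<and> col R = col R'
       then map (\<lambda>i. (Dq i R', Bq i R)) [0..<W] else []) [0..<M]) [0..<M])"

definition layersC :: "(nat \<Rightarrow> nat) \<Rightarrow> (qb \<times> qb) list list" where
  "layersC col = layersA col @ layersB col @ rev (map rev (layersA col))"

lemma run_A:
  assumes "zero_anc z"
  shows "rg (concat (layersA col)) z (Dq i R) = z (Dq i R)"
    and "rg (concat (layersA col)) z (Bq i R) = z (Bq i R)"
    and "i < W \<Longrightarrow> c < k \<Longrightarrow> l > 0 \<Longrightarrow>
      rg (concat (layersA col)) z (Pq i c (l - 1)) = odd (card {R. R < M \<and> col R = c \<and> z (Dq i R)})"
proof -
  define y where "y = rg (concat (concat (map (\<lambda>i. [map (\<lambda>c. (Gq i c, Hq c)) [0..<k], map (\<lambda>c. (Hq c, Pq i c 0)) [0..<k],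
       map (\<lambda>c. (Gq i c, Hq c)) [0..<k]]) [0..<W]))) (rg (concat (map (\<lambda>R. map (\<lambda>i. (Dq i R, Gq i (col R))) [0..<W]) [0..<M])) z)"
  have y: "y (Dq i R) = z (Dq i R)" "y (Bq i R) = z (Bq i R)" "0 < j \<Longrightarrow> \<not> y (Pq i c j)"
    "i < W \<Longrightarrow> c < k \<Longrightarrow> y (Pq i c 0) = odd (card {R. R < M \<and> col R = c \<and> z (Dq i R)})" for i R c j
    unfolding y_def run_star run_load using assms by (auto simp: zero_anc_def)
  have "rg (concat (layersA col)) z =
    rg (concat (map (\<lambda>j. concat (map (\<lambda>i. map (\<lambda>c. (Pq i c j, Pq i c (Suc j))) [0..<k]) [0..<W])) [0..<l - 1])) y"
    unfolding layersA_def y_def concat_append rg_append ..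
  also have "\<dots> = (\<lambda>q. case q of Pq i c j \<Rightarrow> (if i < W \<and> c < k \<and> 0 < j \<and> j \<le> l - 1 then y (Pq i c 0) else y q) | _ \<Rightarrow> y q)"
    by (rule run_chain) (rule y(3))
  finally have A: "rg (concat (layersA col)) z = \<dots>" .
  show "rg (concat (layersA col)) z (Dq i R) = z (Dq i R)" "rg (concat (layersA col)) z (Bq i R) = z (Bq i R)"
    unfolding A by (simp_all add: y)
  show "rg (concat (layersA col)) z (Pq i c (l - 1)) = odd (card {R. R < M \<and> col R = c \<and> z (Dq i R)})"
    if "i < W" "c < k" "l > 0"
    unfolding A using that y(4) by (cases "l - 1") simp_all
qed

text \<open>The chain of colour \<open>col R\<close> delivers to \<open>Bq i R\<close> the sum of
  all inputs of that colour. The direct gates add every summand except that of \<open>R\<close> once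
  more, which leaves \<open>Dq i R\<close>; \<open>rg_sandwich\<close> restores the
  ancillas.\<close>

lemma run_C:
  assumes z: "zero_anc z" and l: "l > 0" and col: "\<And>R. R < M \<Longrightarrow> col R < k"
  shows "rg (concat (layersC col)) z = tgt z"
proof -
  let ?A = "concat (layersA col)" and ?B = "concat (layersB col)" and ?X = "{q. \<exists>i R. q = Bq i R}"
  have c: "concat (layersC col) = ?A @ ?B @ rev ?A"
    by (simp add: layersC_def rev_concat rev_map)
  have A: "fst g \<noteq> snd g \<and> fst g \<notin> ?X \<and> snd g \<notin> ?X" if "g \<in> set ?A" for g
    using that unfolding layersA_def by auto
  have B: "snd g \<in> ?X" if "g \<in> set ?B" for g
    using that unfolding layersB_def by (auto split: if_splits)
  have "rg (?A @ ?B @ rev ?A) z = (\<lambda>q. if q \<in> ?X then rg ?B (rg ?A z) q else z q)"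
    by (rule rg_sandwich) (use A B in blast)+
  also have "\<dots> = tgt z"
  proof
    fix q
    show "(if q \<in> ?X then rg ?B (rg ?A z) q else z q) = tgt z q"
    proof (cases q)
      case (Bq i R)
      have "rg ?B y (Bq i R) = (if i < W \<and> R < M then
          (y (Bq i R) \<noteq> y (Pq i (col R) (l - 1))) \<noteq> odd (card {R'. R' < M \<and> (R \<noteq> R' \<and> col R = col R') \<and> y (Dq i R')})
          else y (Bq i R))" for y
        unfolding layersB_def by (simp only: concat_append rg_append run_read run_clean) simp
      moreover have "odd (card {R'. R' < M \<and> col R' = col R \<and> z (Dq i R')}) =
        (z (Dq i R) \<noteq> odd (card {R'. R' < M \<and> (R \<noteq> R' \<and> col R = col R') \<and> z (Dq i R')}))" if "R < M"
        using odd_card_remove[OF that, of "\<lambda>R'. col R' = col R \<and> z (Dq i R')"] by (simp add: conj_assoc eq_commute[of "col R"])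
      ultimately show ?thesis using Bq run_A[OF z] col l by (auto simp: tgt_def)
    qed (auto simp: tgt_def)
  qed
  finally show ?thesis using c by simp
qed

lemma layersC_ok:
  assumes col: "\<And>R. R < M \<Longrightarrow> col R < k \<and> mem R (col R)"
    and fr: "\<And>R R'. R < M \<Longrightarrow> R' < M \<Longrightarrow> R \<noteq> R' \<Longrightarrow> col R = col R' \<Longrightarrow> free R' R"
    and L: "L \<in> set (layersC col)"
  shows "set L \<subseteq> edge \<and> par L"
proof -
  have A: "set L \<subseteq> edge \<and> par L" if L: "L \<in> set (layersA col)" for L
  proof -
    consider (a) "L \<in> set (map (\<lambda>R. map (\<lambda>i. (Dq i R, Gq i (col R))) [0..<W]) [0..<M])"
      | (b) "L \<in> set (concat (map (\<lambda>i. [map (\<lambda>c. (Gq i c, Hq c)) [0..<k], map (\<lambda>c. (Hq c, Pq i c 0)) [0..<k],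
       map (\<lambda>c. (Gq i c, Hq c)) [0..<k]]) [0..<W]))"
      | (c) "L \<in> set (map (\<lambda>j. concat (map (\<lambda>i. map (\<lambda>c. (Pq i c j, Pq i c (Suc j))) [0..<k]) [0..<W])) [0..<l - 1])"
      using L unfolding layersA_def set_append by blast
    then show ?thesis
    proof cases
      case a
      then obtain R where "R < M" "L = map (\<lambda>i. (Dq i R, Gq i (col R))) [0..<W]" by auto
      then show ?thesis by (auto intro!: par_map edge.intros simp: col)
    next
      case b
      then obtain i where "i < W" "L = map (\<lambda>c. (Gq i c, Hq c)) [0..<k] \<or> L = map (\<lambda>c. (Hq c, Pq i c 0)) [0..<k]"
        by auto
      then show ?thesis by (auto intro!: par_map edge.intros)
    next
      case c
      then obtain j where j: "j \<in> set [0..<l - 1]" "L = concat (map (\<lambda>i. map (\<lambda>c. (Pq i c j, Pq i c (Suc j))) [0..<k]) [0..<W])"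
        unfolding set_map by (elim imageE)
      then have "Suc j < l" by auto
      with j(2) show ?thesis by (auto intro!: par_concat_map edge.intros)
    qed
  qed
  have B: "set L \<subseteq> edge \<and> par L" if L: "L \<in> set (layersB col)" for L
  proof -
    consider (a) "L \<in> set (map (\<lambda>R. map (\<lambda>i. (Pq i (col R) (l - 1), Bq i R)) [0..<W]) [0..<M])"
      | (b) "L \<in> set (concat (map (\<lambda>R. map (\<lambda>R'. if R \<noteq> R' \<and> col R = col R'
       then map (\<lambda>i. (Dq i R', Bq i R)) [0..<W] else []) [0..<M]) [0..<M]))"
      using L unfolding layersB_def set_append by blast
    then show ?thesis
    proof cases
      case a
      then obtain R where "R < M" "L = map (\<lambda>i. (Pq i (col R) (l - 1), Bq i R)) [0..<W]" by auto
      then show ?thesis by (auto intro!: par_map edge.intros simp: col simp del: One_nat_def)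
    next
      case b
      then obtain R R' where R: "R < M" "R' < M"
        "L = (if R \<noteq> R' \<and> col R = col R' then map (\<lambda>i. (Dq i R', Bq i R)) [0..<W] else [])" by auto
      show ?thesis
      proof (cases "R \<noteq> R' \<and> col R = col R'")
        case True
        then show ?thesis unfolding R(3) using fr R(1,2) by (auto intro!: par_map edge.intros)
      next
        case False
        then show ?thesis unfolding R(3) if_not_P[OF False] by (simp add: par_def)
      qed
    qed
  qed
  consider (a) "L \<in> set (layersA col)" | (b) "L \<in> set (layersB col)" | (c) x where "x \<in> set (layersA col)" "L = rev x"
    using L unfolding layersC_def by auto
  then show ?thesis
  proof cases
    case (c x)
    then show ?thesis using A[of x] par_rev[of x] by simp
  qed (use A B in blast)+
qed

text \<open>Loading takes \<open>M\<close> layers, the hub \<open>3 * W\<close> and the chains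
  \<open>l - 1\<close>, all of them twice; reading and cleaning add
  \<open>M + M * M\<close>.\<close>

lemma length_layersC: "length (layersC col) \<le> 6 * W + 2 * l + 3 * M + M * M"
proof -
  have "length (concat (map (\<lambda>i. [f i, g i, h i]) [0..<n])) = 3 * n" for f g h :: "nat \<Rightarrow> (qb \<times> qb) list" and n
    by (induction n) auto
  moreover have "length (concat (map (\<lambda>R. map (f R) [0..<m]) [0..<n])) = n * m" for f :: "nat \<Rightarrow> nat \<Rightarrow> (qb \<times> qb) list" and n m
    by (induction n) auto
  ultimately show ?thesis unfolding layersC_def layersA_def layersB_def by simp
qed

lemma size_layersC:
  "length (concat (layersC col)) \<le> W * (3 * M + M * M) + 6 * W * k + 2 * W * k * l"
proof -
  have c1: "length (concat (map (\<lambda>R. map (f R) [0..<m]) [0..<n])) = n * m" for f :: "nat \<Rightarrow> nat \<Rightarrow> qb \<times> qb" and n m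
    by (induction n) auto
  have c2: "length (concat (concat (map (\<lambda>i. [map (f i) [0..<k], map (g i) [0..<k], map (h i) [0..<k]]) [0..<n]))) = n * (3 * k)"
    for f g h :: "nat \<Rightarrow> nat \<Rightarrow> qb \<times> qb" and n
    by (induction n) auto
  have c3: "length (concat (map (\<lambda>j. concat (map (\<lambda>i. map (f i j) [0..<k]) [0..<W])) [0..<n])) = n * (W * k)"
    for f :: "nat \<Rightarrow> nat \<Rightarrow> nat \<Rightarrow> qb \<times> qb" and n
    by (induction n) (auto simp: c1)
  have c4: "length (concat (map (\<lambda>R'. if P R' then map (f R') [0..<W] else []) [0..<n])) \<le> n * W"
    for f :: "nat \<Rightarrow> nat \<Rightarrow> qb \<times> qb" and P n
    by (induction n) auto
  have c5: "length (concat (concat (map (\<lambda>R. map (\<lambda>R'. if P R R' then map (f R R') [0..<W] else []) [0..<m]) [0..<n]))) \<le> n * (m * W)"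
    for f :: "nat \<Rightarrow> nat \<Rightarrow> nat \<Rightarrow> qb \<times> qb" and P n m
  proof (induction n)
    case (Suc n)
    then show ?case using c4[of "P n" "f n" m] by simp
  qed simp
  have A: "length (concat (layersA col)) \<le> M * W + W * (3 * k) + l * (W * k)"
    unfolding layersA_def by (simp add: c1 c2 c3)
  have B: "length (concat (layersB col)) \<le> M * W + M * (M * W)"
    using c5[where n = M and m = M and P = "\<lambda>R R'. R \<noteq> R' \<and> col R = col R'" and f = "\<lambda>R R' i. (Dq i R', Bq i R)"]
    unfolding layersB_def by (simp only: concat_append length_append c1)
  have "length (concat (layersC col)) = 2 * length (concat (layersA col)) + length (concat (layersB col))"
  proof -
    have "concat (rev (map rev (layersA col))) = rev (concat (layersA col))" by (simp add: rev_concat rev_map)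
    then show ?thesis unfolding layersC_def by simp
  qed
  also have "\<dots> \<le> 2 * (M * W + W * (3 * k) + l * (W * k)) + (M * W + M * (M * W))" by (intro add_mono mult_le_mono2 A B)
  also have "\<dots> = W * (3 * M + M * M) + 6 * W * k + 2 * W * k * l" by (simp add: algebra_simps)
  finally show ?thesis .
qed

section \<open>The reference circuit, one vertex at a time\<close>

definition up :: "nat \<Rightarrow> nat \<Rightarrow> nat \<Rightarrow> (qb \<times> qb) list" where
  "up i R c = [(Dq i R, Gq i c), (Gq i c, Hq c), (Hq c, Pq i c 0)] @ map (\<lambda>j. (Pq i c j, Pq i c (Suc j))) [0..<l - 1]"

definition blk :: "nat \<Rightarrow> nat \<Rightarrow> nat \<Rightarrow> (qb \<times> qb) list" where
  "blk i R c = up i R c @ [(Pq i c (l - 1), Bq i R)] @ rev (up i R c)"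

text \<open>Needs only one admissible colour for each vertex, so it exists whether or not the
  constraints are satisfiable and can serve as the given circuit of the instance.\<close>

definition feas :: "(nat \<Rightarrow> nat) \<Rightarrow> (qb \<times> qb) list" where
  "feas c0 = concat (map (\<lambda>i. concat (map (\<lambda>R. blk i R (c0 R)) [0..<M])) [0..<W])"

lemma run_blk:
  assumes "zero_anc z"
  shows "rg (blk i R c) z = z(Bq i R := (z (Bq i R) \<noteq> z (Dq i R)))"
proof -
  let ?X = "{q. \<exists>i R. q = Bq i R}"
  have ch: "rg (map (\<lambda>j. (Pq i c j, Pq i c (Suc j))) [0..<n]) y (Pq i c n) = y (Pq i c 0)"
    if "\<And>j. 0 < j \<Longrightarrow> \<not> y (Pq i c j)" for n y
  proof (induction n)
    case (Suc n)
    have "rg (map (\<lambda>j. (Pq i c j, Pq i c (Suc j))) [0..<n]) y (Pq i c (Suc n)) = y (Pq i c (Suc n))"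
      by (rule rg_frame) auto
    then show ?case using Suc that[of "Suc n"] by (simp add: ag_apply)
  qed simp
  have P: "rg (up i R c) z (Pq i c (l - 1)) = z (Dq i R)"
    unfolding up_def rg_append by (subst ch) (use assms in \<open>auto simp: zero_anc_def ag_apply\<close>)
  have fr: "rg (up i R c) z (Bq i' R') = z (Bq i' R')" for i' R'
    by (rule rg_frame) (auto simp: up_def)
  have "rg (blk i R c) z = (\<lambda>q. if q \<in> ?X then rg [(Pq i c (l - 1), Bq i R)] (rg (up i R c) z) q else z q)"
    unfolding blk_def by (rule rg_sandwich) (auto simp: up_def)
  also have "\<dots> = z(Bq i R := (z (Bq i R) \<noteq> z (Dq i R)))"
    by (auto simp: fun_eq_iff ag_apply P fr simp del: One_nat_def)
  finally show ?thesis .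
qed

lemma run_feas1:
  assumes "zero_anc z"
  shows "rg (concat (map (\<lambda>R. blk i R (c0 R)) [0..<n])) z =
    (\<lambda>q. case q of Bq i' R \<Rightarrow> (if i' = i \<and> R < n then z q \<noteq> z (Dq i R) else z q) | _ \<Rightarrow> z q)"
proof (induction n)
  case 0
  then show ?case by (auto simp: fun_eq_iff split: qb.splits)
next
  case (Suc n)
  let ?y = "rg (concat (map (\<lambda>R. blk i R (c0 R)) [0..<n])) z"
  have "zero_anc ?y" using assms unfolding Suc by (auto simp: zero_anc_def)
  then show ?case by (simp add: run_blk) (auto simp: Suc fun_eq_iff less_Suc_eq split: qb.splits)
qed

lemma run_feas:
  assumes "zero_anc z"
  shows "rg (feas c0) z = tgt z"
proof -
  have "rg (concat (map (\<lambda>i. concat (map (\<lambda>R. blk i R (c0 R)) [0..<M])) [0..<n])) z =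
    (\<lambda>q. case q of Bq i R \<Rightarrow> (if i < n \<and> R < M then z q \<noteq> z (Dq i R) else z q) | _ \<Rightarrow> z q)" for n
  proof (induction n)
    case 0
    then show ?case by (auto simp: fun_eq_iff split: qb.splits)
  next
    case (Suc n)
    let ?y = "rg (concat (map (\<lambda>i. concat (map (\<lambda>R. blk i R (c0 R)) [0..<M])) [0..<n])) z"
    have "zero_anc ?y" using assms unfolding Suc by (auto simp: zero_anc_def)
    then show ?case by (simp add: run_feas1) (auto simp: Suc fun_eq_iff less_Suc_eq split: qb.splits)
  qed
  then show ?thesis unfolding feas_def tgt_def by auto
qed

lemma feas_edges:
  assumes "\<And>R. R < M \<Longrightarrow> c0 R < k \<and> mem R (c0 R)"
  shows "set (feas c0) \<subseteq> edge"
  unfolding feas_def blk_def up_def using assms by (auto intro!: edge.intros simp del: One_nat_def)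

end

section \<open>The network as a GCM instance\<close>

lemma run_gates_rg: "run_gates = rg"
proof -
  have "apply_gate = (ag :: nat \<times> nat \<Rightarrow> _)" by (auto simp: fun_eq_iff apply_gate_def ag_def)
  then show ?thesis by (intro ext) (simp only: run_gates_def rg_def)
qed

lemma par_ConsD: "par (g # L) \<Longrightarrow> par L"
  by (auto simp: par_def)

text \<open>In a layer no gate writes to a qubit that another gate touches, so executing the gates
  in any order amounts to executing them simultaneously.\<close>

lemma rg_par:
  assumes "par L" "\<And>g. g \<in> set L \<Longrightarrow> fst g \<noteq> snd g"
  shows "rg L x q = (if \<exists>p. (p, q) \<in> set L then x q \<noteq> x (THE p. (p, q) \<in> set L) else x q)"
  using assms
proof (induction L arbitrary: x)
  case Nil
  then show ?case by simp
next
  case (Cons g L)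
  obtain a b where g: "g = (a, b)" by (cases g)
  have ab: "a \<noteq> b" using Cons.prems(2)[of g] g by simp
  have dis: "p \<noteq> a \<and> p \<noteq> b \<and> t \<noteq> a \<and> t \<noteq> b" if "(p, t) \<in> set L" for p t
  proof -
    have "(p, t) \<noteq> g" using Cons.prems(1) that by (auto simp: par_def)
    then have "{fst g, snd g} \<inter> {fst (p, t), snd (p, t)} = {}"
      using Cons.prems(1) that unfolding par_def by (metis list.set_intros)
    then show ?thesis using g by auto
  qed
  have IH: "rg L (ag g x) q = (if \<exists>p. (p, q) \<in> set L then ag g x q \<noteq> ag g x (THE p. (p, q) \<in> set L) else ag g x q)"
    by (rule Cons.IH[OF par_ConsD[OF Cons.prems(1)]]) (use Cons.prems(2) in simp)
  show ?case
  proof (cases "q = b")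
    case True
    then have "\<nexists>p. (p, q) \<in> set L" using dis by blast
    moreover have "(THE p. (p, q) \<in> set (g # L)) = a" using dis g True by (intro the_equality) auto
    ultimately show ?thesis using IH g True by (auto simp: ag_apply)
  next
    case False
    then have e: "(p, q) \<in> set (g # L) \<longleftrightarrow> (p, q) \<in> set L" for p using g by auto
    have "(THE p. (p, q) \<in> set L) \<noteq> b" if ex: "\<exists>p. (p, q) \<in> set L"
    proof -
      obtain p where p: "(p, q) \<in> set L" using ex by blast
      have "p' = p" if "(p', q) \<in> set L" for p'
      proof (rule ccontr)
        assume "p' \<noteq> p"
        then have "{fst (p', q), snd (p', q)} \<inter> {fst (p, q), snd (p, q)} = {}"
          using par_ConsD[OF Cons.prems(1)] p that unfolding par_def by (metis prod.inject)
        then show False by simp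
      qed
      then have "(THE p. (p, q) \<in> set L) = p" using p by blast
      then show ?thesis using dis[OF p] by simp
    qed
    then show ?thesis unfolding e using IH False g by (auto simp: ag_apply)
  qed
qed

lemma apply_layer_rg:
  assumes "par L" "\<And>g. g \<in> set L \<Longrightarrow> fst g \<noteq> snd g"
  shows "apply_layer (set L) x = rg L x"
  using rg_par[OF assms] by (auto simp: fun_eq_iff apply_layer_def)

lemma run_layers_rg:
  assumes "\<And>L. L \<in> set Ls \<Longrightarrow> par L \<and> (\<forall>g\<in>set L. fst g \<noteq> snd g)"
  shows "run_layers (map set Ls) x = rg (concat Ls) x"
  using assms unfolding run_layers_def
proof (induction Ls arbitrary: x)
  case (Cons L Ls)
  have "apply_layer (set L) x = rg L x" by (rule apply_layer_rg) (use Cons.prems[of L] in auto)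
  moreover have "fold apply_layer (map set Ls) (rg L x) = rg (concat Ls) (rg L x)"
    by (rule Cons.IH, rule Cons.prems) simp
  ultimately show ?case by simp
qed simp

lemma layers_par:
  assumes "distinct L"
  shows "set L \<in> layers S \<longleftrightarrow> set L \<subseteq> S \<and> par L"
proof -
  have "par L \<longleftrightarrow> (\<forall>i j i' j'. (i, j) \<in> set L \<longrightarrow> (i', j') \<in> set L \<longrightarrow> (i, j) \<noteq> (i', j') \<longrightarrow> {i, j} \<inter> {i', j'} = {})"
    (is "_ \<longleftrightarrow> ?R")
  proof
    assume P: "par L"
    have "{i, j} \<inter> {i', j'} = {}" if m: "(i, j) \<in> set L" "(i', j') \<in> set L" "(i, j) \<noteq> (i', j')" for i j i' j'
    proof -
      have "{fst (i, j), snd (i, j)} \<inter> {fst (i', j'), snd (i', j')} = {}"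
        by (rule P[unfolded par_def, THEN conjunct2, rule_format, OF m])
      then show ?thesis by simp
    qed
    then show ?R by (intro allI impI)
  next
    assume R: ?R
    have "{fst g, snd g} \<inter> {fst g', snd g'} = {}" if "g \<in> set L" "g' \<in> set L" "g \<noteq> g'" for g g'
      using R[rule_format, of "fst g" "snd g" "fst g'" "snd g'"] that by simp
    then show "par L" unfolding par_def using assms by simp
  qed
  then show ?thesis unfolding layers_def by simp
qed

text \<open>Two gates with the same source would share a qubit.\<close>

lemma par_count:
  assumes "par L" shows "length (filter (\<lambda>g. fst g = p) L) \<le> 1"
proof -
  have F: "a \<in> set L \<and> fst a = p" if "a \<in> set (filter (\<lambda>g. fst g = p) L)" for a using that by simp
  have D: "distinct (filter (\<lambda>g. fst g = p) L)" using assms by (simp add: par_def)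
  show ?thesis
  proof (cases "filter (\<lambda>g. fst g = p) L")
    case (Cons a t)
    show ?thesis
    proof (cases t)
      case (Cons b r)
      then have m: "a \<in> set L" "fst a = p" "b \<in> set L" "fst b = p" and ne: "a \<noteq> b"
        using F[of a] F[of b] D \<open>filter (\<lambda>g. fst g = p) L = a # t\<close> by simp_all
      have "{fst a, snd a} \<inter> {fst b, snd b} = {}"
        by (rule assms[unfolded par_def, THEN conjunct2, rule_format, OF m(1,3) ne])
      then show ?thesis using m by simp
    qed (simp add: Cons)
  qed simp
qed

lemma pair_code:
  fixes a b :: nat
  assumes "b < n" "b' < n" "a * n + b = a' * n + b'"
  shows "a = a' \<and> b = b'"
proof -
  have "(a * n + b) div n = a" "(a' * n + b') div n = a'" using assms(1,2) by simp_all
  then have "a = a'" using assms(3) by metis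
  then show ?thesis using assms(3) by simp
qed

lemma pair_code_less: "(a::nat) < m \<Longrightarrow> b < n \<Longrightarrow> a * n + b < m * n"
proof -
  assume "a < m" "b < n"
  then have "a * n + b < (a + 1) * n" by simp
  also have "\<dots> \<le> m * n" using \<open>a < m\<close> by (intro mult_le_mono1) simp
  finally show ?thesis .
qed

lemma pair_code_surj: "(x::nat) < m * n \<Longrightarrow> \<exists>a<m. \<exists>b<n. x = a * n + b"
proof -
  assume x: "x < m * n"
  then have "n > 0" by (cases n) auto
  then have "x div n < m" "x mod n < n" "x = x div n * n + x mod n" using x by (simp_all add: less_mult_imp_div_less)
  then show ?thesis by blast
qed

context net
begin

text \<open>The data qubits come first, as the instance format demands, followed by hubs, collectors
  and chains. The numbering is injective only on the existing qubits \<open>qv\<close>.\<close>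

fun num :: "qb \<Rightarrow> nat" where
  "num (Dq i R) = i * M + R"
| "num (Bq i R) = W * M + (i * M + R)"
| "num (Hq c) = 2 * (W * M) + c"
| "num (Gq i c) = 2 * (W * M) + k + (i * k + c)"
| "num (Pq i c j) = 2 * (W * M) + k + W * k + ((i * k + c) * l + j)"

abbreviation num2 :: "qb \<times> qb \<Rightarrow> nat \<times> nat" where "num2 \<equiv> map_prod num num"

fun qv :: "qb \<Rightarrow> bool" where
  "qv (Dq i R) \<longleftrightarrow> i < W \<and> R < M"
| "qv (Bq i R) \<longleftrightarrow> i < W \<and> R < M"
| "qv (Hq c) \<longleftrightarrow> c < k"
| "qv (Gq i c) \<longleftrightarrow> i < W \<and> c < k"
| "qv (Pq i c j) \<longleftrightarrow> i < W \<and> c < k \<and> j < l"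

definition nd :: nat where "nd = 2 * (W * M)"
definition na :: nat where "na = k + W * k + W * k * l"

lemma num_bounds:
  "qv (Dq i R) \<Longrightarrow> num (Dq i R) < W * M"
  "qv (Bq i R) \<Longrightarrow> num (Bq i R) < 2 * (W * M)"
  "qv (Hq c) \<Longrightarrow> num (Hq c) < 2 * (W * M) + k"
  "qv (Gq i c) \<Longrightarrow> num (Gq i c) < 2 * (W * M) + k + W * k"
  "qv (Pq i c j) \<Longrightarrow> num (Pq i c j) < 2 * (W * M) + k + W * k + W * k * l"
proof -
  have 1: "i * M + R < W * M" if "i < W" "R < M" using pair_code_less that .
  have 2: "i * k + c < W * k" if "i < W" "c < k" using pair_code_less that .
  have 3: "(i * k + c) * l + j < W * k * l" if "i < W" "c < k" "j < l" using pair_code_less[OF 2[OF that(1,2)] that(3)] .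
  show "num (Dq i R) < W * M" if "qv (Dq i R)"
    unfolding num.simps by (rule 1) (use that in simp_all)
  show "num (Bq i R) < 2 * (W * M)" if "qv (Bq i R)"
  proof -
    have "i * M + R < W * M" by (rule 1) (use that in simp_all)
    then show ?thesis unfolding num.simps by linarith
  qed
  show "num (Hq c) < 2 * (W * M) + k" if "qv (Hq c)" using that by simp
  show "num (Gq i c) < 2 * (W * M) + k + W * k" if "qv (Gq i c)"
    unfolding num.simps by (rule add_strict_left_mono, rule 2) (use that in simp_all)
  show "num (Pq i c j) < 2 * (W * M) + k + W * k + W * k * l" if "qv (Pq i c j)"
    unfolding num.simps by (rule add_strict_left_mono, rule 3) (use that in simp_all)
qed

lemma num_inj:
  assumes "qv p" "qv q" "num p = num q" shows "p = q"
proof (cases p)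
  case (Dq i R)
  show ?thesis
  proof (cases q)
    case (Dq i' R')
    then show ?thesis using assms \<open>p = Dq i R\<close> pair_code[of R M R' i i'] by simp
  qed (use assms Dq num_bounds(1)[of i R] in auto)
next
  case (Bq i R)
  show ?thesis
  proof (cases q)
    case (Bq i' R')
    then show ?thesis using assms \<open>p = Bq i R\<close> pair_code[of R M R' i i'] by simp
  next
    case (Dq i' R')
    then show ?thesis using assms Bq num_bounds(1)[of i' R'] by auto
  qed (use assms Bq num_bounds(2)[of i R] in auto)
next
  case (Hq c)
  show ?thesis
  proof (cases q)
    case (Dq i' R')
    then show ?thesis using assms Hq num_bounds(1)[of i' R'] by auto
  next
    case (Bq i' R')
    then show ?thesis using assms Hq num_bounds(2)[of i' R'] by auto
  qed (use assms Hq num_bounds(3)[of c] in auto)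
next
  case (Gq i c)
  show ?thesis
  proof (cases q)
    case (Dq i' R')
    then show ?thesis using assms Gq num_bounds(1)[of i' R'] by auto
  next
    case (Bq i' R')
    then show ?thesis using assms Gq num_bounds(2)[of i' R'] by auto
  next
    case (Hq c')
    then show ?thesis using assms Gq num_bounds(3)[of c'] by auto
  next
    case (Gq i' c')
    then show ?thesis using assms \<open>p = Gq i c\<close> pair_code[of c k c' i i'] by simp
  qed (use assms Gq num_bounds(4)[of i c] in auto)
next
  case (Pq i c j)
  show ?thesis
  proof (cases q)
    case (Dq i' R')
    then show ?thesis using assms Pq num_bounds(1)[of i' R'] by auto
  next
    case (Bq i' R')
    then show ?thesis using assms Pq num_bounds(2)[of i' R'] by auto
  next
    case (Hq c')
    then show ?thesis using assms Pq num_bounds(3)[of c'] by auto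
  next
    case (Gq i' c')
    then show ?thesis using assms Pq num_bounds(4)[of i' c'] by auto
  next
    case (Pq i' c' j')
    then have "i * k + c = i' * k + c' \<and> j = j'"
      using assms \<open>p = Pq i c j\<close> pair_code[of j l j' "i * k + c" "i' * k + c'"] by simp
    then show ?thesis using assms \<open>p = Pq i c j\<close> Pq pair_code[of c k c' i i'] by simp
  qed
qed

lemma num_surj_data:
  assumes "x < nd" shows "\<exists>q. qv q \<and> num q = x \<and> (\<exists>i R. q = Dq i R \<or> q = Bq i R)"
proof (cases "x < W * M")
  case True
  then obtain i R where "i < W" "R < M" "x = i * M + R" using pair_code_surj[of x W M] by blast
  then show ?thesis by (intro exI[of _ "Dq i R"]) auto
next
  case False
  then have "x - W * M < W * M" using assms by (simp add: nd_def)
  then obtain i R where "i < W" "R < M" "x - W * M = i * M + R" using pair_code_surj[of "x - W * M" W M] by blast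
  then show ?thesis using False by (intro exI[of _ "Bq i R"]) auto
qed

lemma num_surj_anc:
  assumes "nd \<le> x" "x < nd + na" shows "\<exists>q. qv q \<and> num q = x \<and> (\<forall>i R. q \<noteq> Dq i R \<and> q \<noteq> Bq i R)"
proof -
  consider "x - nd < k" | "k \<le> x - nd" "x - nd - k < W * k" | "k + W * k \<le> x - nd" by linarith
  then show ?thesis
  proof cases
    case 1
    then show ?thesis using assms by (intro exI[of _ "Hq (x - nd)"]) (auto simp: nd_def)
  next
    case 2
    then obtain i c where "i < W" "c < k" "x - nd - k = i * k + c" using pair_code_surj[of "x - nd - k" W k] by blast
    then show ?thesis using 2 assms by (intro exI[of _ "Gq i c"]) (auto simp: nd_def)
  next
    case 3
    then have "x - nd - k - W * k < (W * k) * l" using assms by (simp add: na_def)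
    then obtain a j where a: "a < W * k" "j < l" "x - nd - k - W * k = a * l + j"
      using pair_code_surj[of "x - nd - k - W * k" "W * k" l] by blast
    then obtain i c where "i < W" "c < k" "a = i * k + c" using pair_code_surj[of a W k] by blast
    then show ?thesis using a 3 assms by (intro exI[of _ "Pq i c j"]) (auto simp: nd_def)
  qed
qed

lemma num_less: "qv q \<Longrightarrow> num q < nd + na"
  using num_bounds by (cases q) (fastforce simp: nd_def na_def)+

lemma edge_qv:
  assumes "l > 0" "(p, q) \<in> edge" shows "qv p \<and> qv q \<and> p \<noteq> q"
  using assms(2,1) by (cases rule: edge.cases) auto

lemma run_num:
  assumes "l > 0" "set gs \<subseteq> edge" "\<And>q. qv q \<Longrightarrow> y (num q) = z q"
  shows "qv q \<Longrightarrow> rg (map num2 gs) y (num q) = rg gs z q"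
  using assms(2,3)
proof (induction gs arbitrary: y z)
  case (Cons g gs)
  obtain a b where g: "g = (a, b)" by (cases g)
  have ab: "qv a" "qv b" using edge_qv[OF assms(1), of a b] Cons.prems g by auto
  have "ag (num2 g) y (num q') = ag g z q'" if "qv q'" for q'
    using num_inj[OF that ab(2)] Cons.prems(3) that ab g by (auto simp: ag_apply)
  then show ?case using Cons by simp
qed simp

definition pull :: "(nat \<Rightarrow> bool) \<Rightarrow> qb \<Rightarrow> bool" where "pull x q \<longleftrightarrow> qv q \<and> x (num q)"

lemma zero_pull: "valid_input nd x \<Longrightarrow> zero_anc (pull x)"
  by (auto simp: zero_anc_def pull_def valid_input_def nd_def)

lemma run_tgt:
  assumes l: "l > 0" and gs: "set gs \<subseteq> edge" and r: "\<And>z. zero_anc z \<Longrightarrow> rg gs z = tgt z"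
    and x: "valid_input nd x" and q: "qv q"
  shows "rg (map num2 gs) x (num q) = tgt (pull x) q"
  using run_num[OF l gs, of x "pull x" q] r[OF zero_pull[OF x]] q by (simp add: pull_def)

lemma ancilla_tgt:
  assumes l: "l > 0" and gs: "set gs \<subseteq> edge" and r: "\<And>z. zero_anc z \<Longrightarrow> rg gs z = tgt z"
  shows "is_ancilla_circuit nd na (rg (map num2 gs))"
  unfolding is_ancilla_circuit_def
proof (intro allI impI)
  fix x q assume x: "valid_input nd x" and q: "nd \<le> q \<and> q < nd + na"
  then obtain p where p: "qv p" "num p = q" "\<forall>i R. p \<noteq> Dq i R \<and> p \<noteq> Bq i R" using num_surj_anc by blast
  have "rg (map num2 gs) x q = tgt (pull x) p" using run_tgt[OF l gs r x p(1)] p(2) by simp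
  also have "\<not> \<dots>" using p(3) zero_pull[OF x] by (cases p) (auto simp: tgt_def zero_anc_def)
  finally show "\<not> rg (map num2 gs) x q" .
qed

lemma equiv_tgt:
  assumes l: "l > 0" and gs: "set gs \<subseteq> edge" and r: "\<And>z. zero_anc z \<Longrightarrow> rg gs z = tgt z"
    and gs': "set gs' \<subseteq> edge" and r': "\<And>z. zero_anc z \<Longrightarrow> rg gs' z = tgt z"
  shows "circ_equiv nd (rg (map num2 gs)) (rg (map num2 gs'))"
  unfolding circ_equiv_def
proof (intro allI impI)
  fix x q assume x: "valid_input nd x" and q: "q < nd"
  then obtain p where p: "qv p" "num p = q" using num_surj_data by blast
  show "rg (map num2 gs) x q = rg (map num2 gs') x q"
    using run_tgt[OF l gs r x p(1)] run_tgt[OF l gs' r' x p(1)] p(2) by simp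
qed

text \<open>Unit vectors are legal inputs, so every equivalent circuit must act on them like the
  reference circuit. This is all that the lower bounds use about equivalence.\<close>

lemma equiv_basis:
  assumes l: "l > 0" and gs: "set gs \<subseteq> edge" and r: "\<And>z. zero_anc z \<Longrightarrow> rg gs z = tgt z"
    and hs: "set hs \<subseteq> edge" and eq: "circ_equiv nd (rg (map num2 gs)) (rg (map num2 hs))"
    and i: "i < W" "R < M" "R' < M"
  shows "rg hs (bas i R') (Bq i R) = (R = R')"
proof -
  define x where "x n \<longleftrightarrow> n = num (Dq i R')" for n
  have D: "qv (Dq i R')" "qv (Bq i R)" using i by auto
  have x: "valid_input nd x"
    unfolding valid_input_def x_def using num_bounds(1)[OF D(1)] unfolding nd_def by (metis leD le_add2 mult_2 order.strict_trans1)
  have xb: "x (num q) = bas i R' q" if "qv q" for q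
    unfolding x_def bas_def using num_inj[OF that D(1)] by blast
  have "num (Bq i R) < nd" using num_bounds(2)[OF D(2)] by (simp add: nd_def)
  then have "rg (map num2 hs) x (num (Bq i R)) = rg (map num2 gs) x (num (Bq i R))"
    using eq x unfolding circ_equiv_def by blast
  also have "\<dots> = rg gs (bas i R') (Bq i R)" using run_num[OF l gs, of x "bas i R'" "Bq i R", OF xb D(2)] .
  also have "\<dots> = tgt (bas i R') (Bq i R)" using r[of "bas i R'"] by (simp add: zero_anc_def bas_def)
  also have "\<dots> = (R = R')" using i by (auto simp: tgt_def bas_def)
  finally show ?thesis using run_num[OF l hs, of x "bas i R'" "Bq i R", OF xb D(2)] by simp
qed

lemma lists_of_edges:
  assumes "set hs \<subseteq> num2 ` edge"
  shows "\<exists>gs. hs = map num2 gs \<and> set gs \<subseteq> edge"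
proof -
  have "hs \<in> lists (num2 ` edge)" using assms by auto
  then show ?thesis unfolding lists_image by auto
qed

lemma num2_neq:
  assumes "l > 0" "g \<in> num2 ` edge" shows "fst g \<noteq> snd g"
proof -
  obtain p q where "(p, q) \<in> edge" "g = (num p, num q)" using assms(2) by auto
  then show ?thesis using edge_qv[OF assms(1), of p q] num_inj[of p q] by auto
qed

lemma par_num2:
  assumes l: "l > 0" and L: "set L \<subseteq> edge" and p: "par L"
  shows "par (map num2 L)"
proof -
  have qv: "qv (fst g) \<and> qv (snd g)" if "g \<in> set L" for g
    using edge_qv[OF l, of "fst g" "snd g"] L that by auto
  have "inj_on num2 (set L)"
  proof (rule inj_onI)
    fix g g' assume g: "g \<in> set L" "g' \<in> set L" "num2 g = num2 g'"
    then have "num (fst g) = num (fst g')" "num (snd g) = num (snd g')" by (metis fst_map_prod, metis snd_map_prod)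
    then show "g = g'" using qv[OF g(1)] qv[OF g(2)] num_inj by (simp add: prod_eq_iff)
  qed
  then have "distinct (map num2 L)" using p by (simp add: distinct_map par_def)
  moreover have "{fst a, snd a} \<inter> {fst b, snd b} = {}"
    if a: "a \<in> set (map num2 L)" and b: "b \<in> set (map num2 L)" and ab: "a \<noteq> b" for a b
  proof -
    obtain g where g: "g \<in> set L" "a = num2 g" using a by auto
    obtain h where h: "h \<in> set L" "b = num2 h" using b by auto
    have gh: "g \<noteq> h" using g h ab by auto
    have "{fst g, snd g} \<inter> {fst h, snd h} = {}"
      by (rule p[unfolded par_def, THEN conjunct2, rule_format, OF g(1) h(1) gh])
    then have "fst g \<noteq> fst h" "fst g \<noteq> snd h" "snd g \<noteq> fst h" "snd g \<noteq> snd h" by auto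
    then show ?thesis unfolding g(2) h(2) using qv[OF g(1)] qv[OF h(1)] num_inj by auto
  qed
  ultimately show ?thesis unfolding par_def by blast
qed

end

section \<open>Bounds for the two optima of an instance\<close>

locale net_inst = net +
  fixes I :: gcm_inst and c0 :: "nat \<Rightarrow> nat"
  assumes pos: "0 < M" "0 < k" "0 < W" "0 < l"
    and c0: "\<And>R. R < M \<Longrightarrow> c0 R < k \<and> mem R (c0 R)"
    and fields: "gi_n I = nd" "gi_m I = na" "gi_s I = length (gi_gates I)"
      "set (gi_S I) = num2 ` edge" "gi_gates I = map num2 (feas c0)"
begin

lemma feas_ok: "set (feas c0) \<subseteq> edge" "zero_anc z \<Longrightarrow> rg (feas c0) z = tgt z"
  using feas_edges c0 run_feas by blast+

lemma feas_nonempty: "feas c0 \<noteq> []"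
proof -
  have "(Pq 0 (c0 0) (l - 1), Bq 0 0) \<in> set (feas c0)"
    unfolding feas_def blk_def using pos by force
  then show ?thesis by auto
qed

lemma valid_inst: "gcm_valid I"
proof -
  have "num2 ` edge \<subseteq> cnot_gates (nd + na)"
  proof
    fix g assume "g \<in> num2 ` edge"
    then obtain p q where pq: "(p, q) \<in> edge" "g = (num p, num q)" by auto
    then show "g \<in> cnot_gates (nd + na)"
      using edge_qv[OF pos(4) pq(1)] num_less num_inj unfolding cnot_gates_def by auto
  qed
  moreover have "set (gi_gates I) \<subseteq> num2 ` edge" using feas_ok(1) fields(5) by auto
  moreover have "is_ancilla_circuit nd na (run_gates (gi_gates I))"
    using ancilla_tgt[OF pos(4) feas_ok] unfolding fields(5) run_gates_rg .
  moreover have "0 < na" "0 < nd" using pos by (simp_all add: na_def nd_def)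
  ultimately show ?thesis unfolding gcm_valid_def using feas_nonempty fields by auto
qed

abbreviation "size_ok hs \<equiv> set hs \<subseteq> set (gi_S I) \<and>
     is_ancilla_circuit (gi_n I) (gi_m I) (run_gates hs) \<and>
     circ_equiv (gi_n I) (run_gates (gi_gates I)) (run_gates hs)"

abbreviation "depth_ok ls \<equiv> set ls \<subseteq> layers (set (gi_S I)) \<and>
     is_ancilla_circuit (gi_n I) (gi_m I) (run_layers ls) \<and>
     circ_equiv (gi_n I) (run_gates (gi_gates I)) (run_layers ls)"

lemma size_okI:
  assumes "set gs \<subseteq> edge" "\<And>z. zero_anc z \<Longrightarrow> rg gs z = tgt z"
  shows "size_ok (map num2 gs)"
  unfolding fields run_gates_rg
  using assms(1) ancilla_tgt[OF pos(4) assms] equiv_tgt[OF pos(4) feas_ok assms] by auto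

lemma depth_okI:
  assumes "\<And>L. L \<in> set Ls \<Longrightarrow> set L \<subseteq> edge \<and> par L" "\<And>z. zero_anc z \<Longrightarrow> rg (concat Ls) z = tgt z"
  shows "depth_ok (map (\<lambda>L. set (map num2 L)) Ls)"
proof -
  let ?Ls = "map (map num2) Ls"
  have e: "set (concat Ls) \<subseteq> edge" using assms(1) by auto
  have P: "par L \<and> set L \<subseteq> num2 ` edge" if L: "L \<in> set ?Ls" for L
  proof -
    obtain K where K: "K \<in> set Ls" "L = map num2 K" using L by auto
    have "set K \<subseteq> edge" "par K" using assms(1)[OF K(1)] by auto
    then show ?thesis using par_num2[OF pos(4)] K(2) by (simp add: image_mono)
  qed
  have "run_layers (map set ?Ls) x = rg (concat ?Ls) x" for x
    by (rule run_layers_rg) (use P num2_neq[OF pos(4)] in blast)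
  moreover have "concat ?Ls = map num2 (concat Ls)" by (simp add: map_concat)
  moreover have "map set ?Ls = map (\<lambda>L. set (map num2 L)) Ls" by simp
  ultimately have r: "run_layers (map (\<lambda>L. set (map num2 L)) Ls) = rg (map num2 (concat Ls))"
    by (metis ext)
  have "set (map num2 L) \<in> layers (num2 ` edge)" if "L \<in> set Ls" for L
  proof -
    have "map num2 L \<in> set ?Ls" using that by simp
    then have "par (map num2 L)" "set (map num2 L) \<subseteq> num2 ` edge" using P by blast+
    then show ?thesis using layers_par[of "map num2 L"] unfolding par_def by blast
  qed
  then show ?thesis unfolding fields run_gates_rg r
    using ancilla_tgt[OF pos(4) e assms(2)] equiv_tgt[OF pos(4) feas_ok e assms(2)] by auto
qed

lemma opt_size_le:
  assumes "set gs \<subseteq> edge" "\<And>z. zero_anc z \<Longrightarrow> rg gs z = tgt z"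
  shows "gcm_opt_size I \<le> length gs"
  unfolding gcm_opt_size_def
  by (rule Least_le, rule exI[of _ "map num2 gs"]) (use size_okI[OF assms] in simp)

lemma opt_depth_le:
  assumes "\<And>L. L \<in> set Ls \<Longrightarrow> set L \<subseteq> edge \<and> par L" "\<And>z. zero_anc z \<Longrightarrow> rg (concat Ls) z = tgt z"
  shows "gcm_opt_depth I \<le> length Ls"
  unfolding gcm_opt_depth_def
  by (rule Least_le, rule exI[of _ "map (\<lambda>L. set (map num2 L)) Ls"], rule conjI, simp) (rule depth_okI[OF assms])

text \<open>The given circuit itself shows that the minimum is taken over a nonempty set.\<close>

lemma opt_size_witness: "\<exists>hs. length hs = gcm_opt_size I \<and> size_ok hs"
proof -
  have "\<exists>hs. length hs = length (map num2 (feas c0)) \<and> size_ok hs"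
    using size_okI[OF feas_ok] by (intro exI[of _ "map num2 (feas c0)"]) (rule conjI[OF refl])
  then show ?thesis unfolding gcm_opt_size_def by (rule LeastI)
qed

lemma opt_depth_witness: "\<exists>ls. length ls = gcm_opt_depth I \<and> depth_ok ls"
proof -
  \<comment> \<open>One gate per layer turns the given circuit into a layered one.\<close>
  let ?Ls = "map (\<lambda>g. [g]) (feas c0)"
  have c: "concat ?Ls = feas c0" by (induction "feas c0") (simp_all add: concat_map_singleton)
  have "depth_ok (map (\<lambda>L. set (map num2 L)) ?Ls)"
    by (rule depth_okI) (use feas_ok c in \<open>auto simp: par_def\<close>)
  then have "\<exists>ls. length ls = length (map (\<lambda>L. set (map num2 L)) ?Ls) \<and> depth_ok ls"
    by (intro exI[of _ "map (\<lambda>L. set (map num2 L)) ?Ls"]) (rule conjI[OF refl])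
  then show ?thesis unfolding gcm_opt_depth_def by (rule LeastI)
qed

lemma opt_size_ge:
  assumes B: "rank_exceeds B"
  shows "W * l * (B + 1) \<le> gcm_opt_size I"
proof -
  obtain hs where hs: "length hs = gcm_opt_size I" "size_ok hs" using opt_size_witness by blast
  obtain gs where gs: "hs = map num2 gs" "set gs \<subseteq> edge" using lists_of_edges hs(2) fields(4) by metis
  have "circ_equiv nd (rg (map num2 (feas c0))) (rg (map num2 gs))"
    using hs(2) unfolding fields run_gates_rg gs(1) by blast
  then have "W * l * (B + 1) \<le> length gs"
    using size_bound[OF B gs(2) pos(4)] equiv_basis[OF pos(4) feas_ok gs(2)] by blast
  then show ?thesis using hs(1) gs(1) by simp
qed

lemma layer_lists:
  assumes "set ls \<subseteq> layers (num2 ` edge)"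
  shows "\<exists>Ls. ls = map set (map (map num2) Ls) \<and> (\<forall>L\<in>set Ls. set L \<subseteq> edge \<and> par (map num2 L))"
  using assms
proof (induction ls)
  case Nil
  then show ?case by (intro exI[of _ "[]"]) simp
next
  case (Cons T ls)
  obtain Ls where Ls: "ls = map set (map (map num2) Ls)" "\<forall>L\<in>set Ls. set L \<subseteq> edge \<and> par (map num2 L)"
    using Cons by auto
  have T1: "T \<in> layers (num2 ` edge)" using Cons.prems by simp
  then have T2: "T \<subseteq> num2 ` edge" unfolding layers_def by simp
  note T = T1 T2
  \<comment> \<open>Layers are sets; a finite range of qubit numbers makes them finite, so they can
    be listed and pulled back to the abstract qubits.\<close>
  have "num2 ` edge \<subseteq> {..<nd + na} \<times> {..<nd + na}"
  proof
    fix g assume "g \<in> num2 ` edge"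
    then obtain p q where pq: "(p, q) \<in> edge" "g = (num p, num q)" by auto
    then show "g \<in> {..<nd + na} \<times> {..<nd + na}" using edge_qv[OF pos(4) pq(1)] num_less by auto
  qed
  then have "finite T" using T(2) finite_subset by (metis finite_SigmaI finite_lessThan)
  then obtain hs where hs: "set hs = T" "distinct hs" using finite_distinct_list by blast
  then obtain L where L: "hs = map num2 L" "set L \<subseteq> edge" using lists_of_edges T(2) by metis
  have "par hs" using layers_par[OF hs(2)] hs(1) T(1) by simp
  then show ?case using Ls L hs(1) by (intro exI[of _ "L # Ls"]) simp
qed

lemma opt_depth_ge:
  assumes B: "rank_exceeds B"
  shows "W * (B + 1) \<le> k * gcm_opt_depth I"
proof -
  obtain ls where ls: "length ls = gcm_opt_depth I" "depth_ok ls" using opt_depth_witness by blast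
  obtain Ls where Ls: "ls = map set (map (map num2) Ls)" "\<And>L. L \<in> set Ls \<Longrightarrow> set L \<subseteq> edge \<and> par (map num2 L)"
    using layer_lists ls(2) fields(4) by metis
  have "run_layers ls x = rg (concat (map (map num2) Ls)) x" for x
    unfolding Ls(1) by (rule run_layers_rg) (use Ls(2) num2_neq[OF pos(4)] in \<open>auto; blast\<close>)
  then have r: "run_layers ls = rg (map num2 (concat Ls))" by (simp add: map_concat fun_eq_iff)
  have e: "set (concat Ls) \<subseteq> edge" using Ls(2) by auto
  have eq: "circ_equiv nd (rg (map num2 (feas c0))) (rg (map num2 (concat Ls)))"
    using ls(2) unfolding fields run_gates_rg r by blast
  have "length (filter (\<lambda>g. fst g = Hq c) L) \<le> 1" if "L \<in> set Ls" for L c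
  proof -
    have "length (filter (\<lambda>g. fst g = Hq c) L) \<le> length (filter (\<lambda>g. fst g = num (Hq c)) (map num2 L))"
      by (induction L) auto
    also have "\<dots> \<le> 1" by (rule par_count) (use Ls(2) that in blast)
    finally show ?thesis .
  qed
  then have "W * (B + 1) \<le> k * length Ls"
    using depth_bound[OF B, of Ls] Ls(2) pos(4) equiv_basis[OF pos(4) feas_ok e eq] by blast
  then show ?thesis using ls(1) Ls(1) by simp
qed

text \<open>A positive optimum exceeds any multiple of the threshold 0, which is what void instances
  receive.\<close>

lemma opt_pos: "0 < gcm_opt_size I" "0 < gcm_opt_depth I"
proof -
  have no: "\<not> circ_equiv nd (rg (map num2 (feas c0))) (rg [])"
    using equiv_basis[OF pos(4) feas_ok, of "[]" 0 0 0] pos by (auto simp: bas_def)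
  obtain hs where "length hs = gcm_opt_size I" "size_ok hs" using opt_size_witness by blast
  then show "0 < gcm_opt_size I" using no unfolding fields run_gates_rg by (cases hs) auto
  obtain ls where "length ls = gcm_opt_depth I" "depth_ok ls" using opt_depth_witness by blast
  moreover have "run_layers [] = rg []" by (simp add: fun_eq_iff run_layers_def)
  ultimately show "0 < gcm_opt_depth I" using no unfolding fields run_gates_rg by (cases ls) auto
qed

lemma opt_le_coloring:
  assumes col: "\<And>R. R < M \<Longrightarrow> col R < k \<and> mem R (col R)"
    and fr: "\<And>R R'. R < M \<Longrightarrow> R' < M \<Longrightarrow> R \<noteq> R' \<Longrightarrow> col R = col R' \<Longrightarrow> free R' R"
  shows "gcm_opt_size I \<le> W * (3 * M + M * M) + 6 * W * k + 2 * W * k * l"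
    and "gcm_opt_depth I \<le> 6 * W + 2 * l + 3 * M + M * M"
proof -
  have ok: "\<And>L. L \<in> set (layersC col) \<Longrightarrow> set L \<subseteq> edge \<and> par L" using layersC_ok[OF col fr] by blast
  have r: "\<And>z. zero_anc z \<Longrightarrow> rg (concat (layersC col)) z = tgt z" using run_C pos(4) col by blast
  have "set (concat (layersC col)) \<subseteq> edge" using ok by auto
  then show "gcm_opt_size I \<le> W * (3 * M + M * M) + 6 * W * k + 2 * W * k * l"
    using opt_size_le[OF _ r] size_layersC le_trans by blast
  show "gcm_opt_depth I \<le> 6 * W + 2 * l + 3 * M + M * M"
    using opt_depth_le[OF ok r] length_layersC le_trans by blast
qed

end

section \<open>A counter language on Turing machines\<close>

text \<open>The elements of \<open>ds\<close> get the first codes. This is needed because start and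
  halting state, the blank and the two bits are fixed numbers in the machine model.\<close>

lemma enumeration_exists:
  assumes "finite A" "distinct ds" "set ds \<subseteq> A"
  shows "\<exists>e. inj_on e A \<and> e ` A \<subseteq> {..<card A} \<and> (\<forall>i<length ds. e (ds ! i) = i)"
proof -
  obtain L where L: "set L = A - set ds" "distinct L" using assms(1) finite_distinct_list[of "A - set ds"] by auto
  let ?xs = "ds @ L"
  have d: "distinct ?xs" and s: "set ?xs = A" using L assms by auto
  have b: "bij_betw ((!) ?xs) {..<length ?xs} A" using bij_betw_nth[OF d refl s[symmetric]] .
  have len: "length ?xs = card A" using d s distinct_card by metis
  let ?e = "inv_into {..<length ?xs} ((!) ?xs)"
  have "bij_betw ?e A {..<length ?xs}" using b by (rule bij_betw_inv_into)
  moreover have "?e (ds ! i) = i" if i: "i < length ds" for i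
  proof -
    have "ds ! i = ?xs ! i" using i by (simp add: nth_append)
    moreover have "?e (?xs ! i) = i" using b i by (intro inv_into_f_f) (auto simp: bij_betw_def)
    ultimately show ?thesis by simp
  qed
  ultimately show ?thesis using len unfolding bij_betw_def by (intro exI[of _ ?e]) auto
qed

definition astep where
  "astep \<delta> H c = (case c of (q, tp, h) \<Rightarrow>
     if q = H then c else (case \<delta> q (tp h) of (q', a', d) \<Rightarrow> (q', tp(h := a'), h + d)))"

lemma tm_of_abstract:
  fixes \<delta> :: "'q \<Rightarrow> 's \<Rightarrow> 'q \<times> 's \<times> int"
  assumes finQ: "finite Q" and finS: "finite S"
    and qs: "S0 \<in> Q" "H \<in> Q" "S0 \<noteq> H"
    and bs: "b0 \<in> S" "b1 \<in> S" "b2 \<in> S" "distinct [b0, b1, b2]"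
    and cl: "\<And>q a. q \<in> Q \<Longrightarrow> a \<in> S \<Longrightarrow> q \<noteq> H \<Longrightarrow> \<delta> q a \<in> Q \<times> S \<times> {-1, 0, 1}"
  shows "\<exists>M eq es. wf_tm M \<and> inj_on eq Q \<and> inj_on es S \<and> eq H = 1 \<and> es b0 = 0 \<and> es b1 = 1 \<and> es b2 = 2 \<and>
    (\<forall>t x. let c = (astep \<delta> H ^^ t) (S0, (\<lambda>i. if 0 \<le> i \<and> i < int (length x) then (if x ! nat i then b2 else b1) else b0), 0)
      in fst c \<in> Q \<and> (\<forall>i. fst (snd c) i \<in> S) \<and>
         tm_run M t (tm_init x) = (eq (fst c), es \<circ> fst (snd c), snd (snd c)))"
proof -
  obtain eq where eq: "inj_on eq Q" "eq ` Q \<subseteq> {..<card Q}" "eq S0 = 0" "eq H = 1"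
    using enumeration_exists[OF finQ, of "[S0, H]"] qs by (auto simp: less_Suc_eq all_conj_distrib)
  obtain es where es: "inj_on es S" "es ` S \<subseteq> {..<card S}" "es b0 = 0" "es b1 = 1" "es b2 = 2"
  proof -
    obtain e where e: "inj_on e S" "e ` S \<subseteq> {..<card S}" "\<forall>i<length [b0, b1, b2]. e ([b0, b1, b2] ! i) = i"
      using enumeration_exists[OF finS bs(4)] bs by auto
    have "e b0 = 0" "e b1 = 1" "e b2 = 2" using e(3)[rule_format, of 0] e(3)[rule_format, of 1] e(3)[rule_format, of 2] by simp_all
    then show ?thesis using that e by blast
  qed
  \<comment> \<open>The default \<open>(0, 0, 0)\<close> only keeps the machine well-formed; the
    halting state and pairs without a preimage never need a transition.\<close>
  define dn where "dn n a = (if n \<in> eq ` Q \<and> a \<in> es ` S \<and> n \<noteq> 1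
    then (case \<delta> (inv_into Q eq n) (inv_into S es a) of (q', a', d) \<Rightarrow> (eq q', es a', d)) else (0, 0, 0))" for n a
  define M where "M = TM (card Q) (card S) dn"
  have cQ: "card Q \<ge> 2" using card_mono[OF finQ, of "{S0, H}"] qs by auto
  have cS: "card S \<ge> 3" using card_mono[OF finS, of "{b0, b1, b2}"] bs by auto
  have wf: "wf_tm M" unfolding wf_tm_def
  proof (intro conjI allI impI)
    show "2 \<le> tm_states M" "3 \<le> tm_syms M" using cQ cS by (simp_all add: M_def)
    fix q a assume "q < tm_states M" "a < tm_syms M"
    show "case tm_delta M q a of (q', a', d) \<Rightarrow> q' < tm_states M \<and> a' < tm_syms M \<and> d \<in> {-1, 0, 1}"
    proof (cases "q \<in> eq ` Q \<and> a \<in> es ` S \<and> q \<noteq> 1")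
      case True
      then have "inv_into Q eq q \<in> Q" "inv_into S es a \<in> S" "inv_into Q eq q \<noteq> H"
        using eq(4) by (auto simp: inv_into_into f_inv_into_f)
      then have "\<delta> (inv_into Q eq q) (inv_into S es a) \<in> Q \<times> S \<times> {-1, 0, 1}" by (rule cl)
      then show ?thesis using True eq(2) es(2) by (auto simp: M_def dn_def split: prod.splits)
    next
      case False
      then show ?thesis using cQ cS by (auto simp: M_def dn_def)
    qed
  qed
  have sim: "tm_step M (eq q, es \<circ> tp, h) = (case astep \<delta> H (q, tp, h) of (q', tp', h') \<Rightarrow> (eq q', es \<circ> tp', h')) \<and>
      fst (astep \<delta> H (q, tp, h)) \<in> Q \<and> (\<forall>i. fst (snd (astep \<delta> H (q, tp, h))) i \<in> S)"
    if q: "q \<in> Q" and tp: "\<forall>i. tp i \<in> S" for q tp h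
  proof (cases "q = H")
    case True
    then show ?thesis using eq(4) qs tp by (simp add: tm_step_def astep_def)
  next
    case False
    have n1: "eq q \<noteq> 1" using False eq(1,4) q qs(2) by (metis inj_onD)
    obtain q' a' d where d: "\<delta> q (tp h) = (q', a', d)" by (cases "\<delta> q (tp h)") auto
    have m: "q' \<in> Q" "a' \<in> S" using cl[of q "tp h"] q tp False d by auto
    have "tm_delta M (eq q) (es (tp h)) = (eq q', es a', d)"
      using q tp n1 d eq(1) es(1) by (simp add: M_def dn_def)
    then show ?thesis using False n1 d m tp
      by (auto simp: tm_step_def astep_def fun_eq_iff)
  qed
  have init: "tm_init x = (eq S0, es \<circ> (\<lambda>i. if 0 \<le> i \<and> i < int (length x) then (if x ! nat i then b2 else b1) else b0), 0)" for x
    using eq(3) es(3-5) by (auto simp: tm_init_def bit_sym_def fun_eq_iff)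
  have run: "fst c \<in> Q \<and> (\<forall>i. fst (snd c) i \<in> S) \<and> tm_run M t (tm_init x) = (eq (fst c), es \<circ> fst (snd c), snd (snd c))"
    if "c = (astep \<delta> H ^^ t) (S0, (\<lambda>i. if 0 \<le> i \<and> i < int (length x) then (if x ! nat i then b2 else b1) else b0), 0)" for c t x
    using that
  proof (induction t arbitrary: c)
    case 0
    then show ?case using qs bs init by (simp add: tm_run_def comp_def)
  next
    case (Suc t)
    define c' where "c' = (astep \<delta> H ^^ t) (S0, (\<lambda>i. if 0 \<le> i \<and> i < int (length x) then (if x ! nat i then b2 else b1) else b0), 0)"
    obtain q tp h where c': "c' = (q, tp, h)" by (cases c') auto
    have IH: "q \<in> Q" "\<forall>i. tp i \<in> S" "tm_run M t (tm_init x) = (eq q, es \<circ> tp, h)" using Suc.IH[OF c'_def] c' by auto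
    have c: "c = astep \<delta> H (q, tp, h)" using Suc.prems c'_def c' by simp
    have "tm_run M (Suc t) (tm_init x) = tm_step M (eq q, es \<circ> tp, h)" using IH(3) by (simp add: tm_run_def)
    then show ?case using sim[OF IH(1,2), of h] c by (auto split: prod.splits)
  qed
  show ?thesis using wf eq es run by (intro exI[of _ M] exI[of _ eq] exI[of _ es]) (simp add: Let_def)
qed

section \<open>Syntax and semantics of the counter language\<close>

datatype test = TZ nat | TB nat | TT nat
datatype com = SKIP | INC nat | DEC nat | EMIT bool | SEQ com com | IF test com com | WH test com

fun tst :: "bool list \<Rightarrow> test \<Rightarrow> (nat \<Rightarrow> nat) \<Rightarrow> bool" where
  "tst x (TZ r) s \<longleftrightarrow> s r = 0"
| "tst x (TB r) s \<longleftrightarrow> length x \<le> s r"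
| "tst x (TT r) s \<longleftrightarrow> s r < length x \<and> x ! s r"

type_synonym cst = "com list \<times> (nat \<Rightarrow> nat) \<times> bool list"

text \<open>The control state is an explicit stack of commands. A fixed program reaches only
  finitely many stacks, so the stack fits into the finite control of a machine. Loops stop when
  their test holds, which makes \<open>WH (TZ r)\<close> a countdown.\<close>

fun cstep :: "bool list \<Rightarrow> cst \<Rightarrow> cst" where
  "cstep x ([], s, out) = ([], s, out)"
| "cstep x (SKIP # cs, s, out) = (cs, s, out)"
| "cstep x (INC r # cs, s, out) = (cs, s(r := Suc (s r)), out)"
| "cstep x (DEC r # cs, s, out) = (cs, s(r := s r - 1), out)"
| "cstep x (EMIT b # cs, s, out) = (cs, s, out @ [b])"
| "cstep x (SEQ a b # cs, s, out) = (a # b # cs, s, out)"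
| "cstep x (IF t a b # cs, s, out) = ((if tst x t s then a else b) # cs, s, out)"
| "cstep x (WH t a # cs, s, out) = (if tst x t s then cs else a # WH t a # cs, s, out)"

fun treg :: "test \<Rightarrow> nat" where "treg (TZ r) = r" | "treg (TB r) = r" | "treg (TT r) = r"

fun regs_below :: "nat \<Rightarrow> com \<Rightarrow> bool" where
  "regs_below C SKIP \<longleftrightarrow> True"
| "regs_below C (INC r) \<longleftrightarrow> r < C"
| "regs_below C (DEC r) \<longleftrightarrow> r < C"
| "regs_below C (EMIT b) \<longleftrightarrow> True"
| "regs_below C (SEQ a b) \<longleftrightarrow> regs_below C a \<and> regs_below C b"
| "regs_below C (IF t a b) \<longleftrightarrow> treg t < C \<and> regs_below C a \<and> regs_below C b"
| "regs_below C (WH t a) \<longleftrightarrow> treg t < C \<and> regs_below C a"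

text \<open>The continuation stacks that can occur while \<open>c\<close> is executed on top of \<open>cs\<close>.\<close>

fun kont :: "com \<Rightarrow> com list \<Rightarrow> com list set" where
  "kont (SEQ a b) cs = {SEQ a b # cs} \<union> kont a (b # cs) \<union> kont b cs"
| "kont (IF t a b) cs = {IF t a b # cs} \<union> kont a cs \<union> kont b cs"
| "kont (WH t a) cs = {WH t a # cs} \<union> kont a (WH t a # cs)"
| "kont c cs = {c # cs}"

fun succs :: "com list \<Rightarrow> com list set" where
  "succs [] = {}"
| "succs (SEQ a b # cs) = {a # b # cs}"
| "succs (IF t a b # cs) = {a # cs, b # cs}"
| "succs (WH t a # cs) = {cs, a # WH t a # cs}"
| "succs (c # cs) = {cs}"

lemma kont_self: "c # cs \<in> kont c cs"
  by (cases c) auto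

lemma kont_finite: "finite (kont c cs)"
  by (induction c arbitrary: cs) auto

lemma kont_succs: "ds \<in> kont c cs \<Longrightarrow> succs ds \<subseteq> kont c cs \<union> {cs}"
proof (induction c arbitrary: cs ds)
  case (SEQ a b)
  then show ?case using kont_self[of a "b # cs"] kont_self[of b cs] by fastforce
next
  case (IF t a b)
  then show ?case using kont_self[of a cs] kont_self[of b cs] by fastforce
next
  case (WH t a)
  then show ?case using kont_self[of a "WH t a # cs"] by fastforce
qed auto

lemma kont_regs: "ds \<in> kont c cs \<Longrightarrow> regs_below C c \<Longrightarrow> (\<forall>d\<in>set cs. regs_below C d) \<Longrightarrow> d \<in> set ds \<Longrightarrow> regs_below C d"
  by (induction c arbitrary: cs ds) fastforce+

section \<open>Simulation on a tape with an input track, an output track and marks\<close>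

type_synonym sym = "nat \<times> nat \<times> nat set"

datatype st = Start | Halt | Run "com list" | SInc nat "com list" | SDec nat "com list" | SEmit bool "com list"
  | STest test "com list" "com list" | Put nat "com list" | Back "com list" | Fin

text \<open>Mark 0 is the origin, mark 1 the end of the output, mark \<open>r + 2\<close> the value of register \<open>r\<close>.\<close>

fun tcond :: "test \<Rightarrow> sym \<Rightarrow> bool" where
  "tcond (TZ r) (a, b, m) \<longleftrightarrow> 0 \<in> m"
| "tcond (TB r) (a, b, m) \<longleftrightarrow> a = 0"
| "tcond (TT r) (a, b, m) \<longleftrightarrow> a = 2"

text \<open>Each command is one sweep: right to the relevant mark, a test or a change there, and
  back to mark 0. A mark moves by being lifted and put down in the adjacent cell.
  \<open>Start\<close> places all marks at the origin; \<open>Fin\<close> finally replaces the cells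
  by pure output bits, whose triples have the codes 1 and 2, and ends with a blank.\<close>

fun trans :: "nat \<Rightarrow> com \<Rightarrow> st \<Rightarrow> sym \<Rightarrow> st \<times> sym \<times> int" where
  "trans C c0 Start (a, b, m) = (Run [c0], (a, b, {..<C + 2}), 0)"
| "trans C c0 Halt y = (Halt, y, 0)"
| "trans C c0 (Run []) y = (Fin, y, 0)"
| "trans C c0 (Run (SKIP # cs)) y = (Run cs, y, 0)"
| "trans C c0 (Run (INC r # cs)) y = (SInc r cs, y, 0)"
| "trans C c0 (Run (DEC r # cs)) y = (if r + 2 \<in> snd (snd y) then (Run cs, y, 0) else (SDec r cs, y, 0))"
| "trans C c0 (Run (EMIT e # cs)) y = (SEmit e cs, y, 0)"
| "trans C c0 (Run (SEQ c d # cs)) y = (Run (c # d # cs), y, 0)"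
| "trans C c0 (Run (IF t c d # cs)) y = (STest t (c # cs) (d # cs), y, 0)"
| "trans C c0 (Run (WH t c # cs)) y = (STest t cs (c # WH t c # cs), y, 0)"
| "trans C c0 (SInc r cs) (a, b, m) = (if r + 2 \<in> m then (Put (r + 2) cs, (a, b, m - {r + 2}), 1) else (SInc r cs, (a, b, m), 1))"
| "trans C c0 (SDec r cs) (a, b, m) = (if r + 2 \<in> m then (Put (r + 2) cs, (a, b, m - {r + 2}), -1) else (SDec r cs, (a, b, m), 1))"
| "trans C c0 (SEmit e cs) (a, b, m) = (if 1 \<in> m then (Put 1 cs, (a, bit_sym e, m - {1}), 1) else (SEmit e cs, (a, b, m), 1))"
| "trans C c0 (STest t cs ds) y = (if treg t + 2 \<in> snd (snd y) then (Back (if tcond t y then cs else ds), y, 0) else (STest t cs ds, y, 1))"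
| "trans C c0 (Put k cs) (a, b, m) = (Back cs, (a, b, insert k m), 0)"
| "trans C c0 (Back cs) (a, b, m) = (if 0 \<in> m then (Run cs, (a, b, m), 0) else (Back cs, (a, b, m), -1))"
| "trans C c0 Fin (a, b, m) = (if b = 0 then (Halt, (0, 0, {}), 0) else (Fin, (b, 0, {}), 1))"

definition syms :: "nat \<Rightarrow> sym set" where "syms C = {..<3} \<times> {..<3} \<times> Pow {..<C + 2}"

definition stacks :: "com \<Rightarrow> com list set" where "stacks c0 = insert [] (kont c0 [])"

definition states :: "nat \<Rightarrow> com \<Rightarrow> st set" where
  "states C c0 = {Start, Halt, Fin} \<union> Run ` stacks c0 \<union> (\<lambda>(r, cs). SInc r cs) ` ({..<C} \<times> stacks c0) \<union>
     (\<lambda>(r, cs). SDec r cs) ` ({..<C} \<times> stacks c0) \<union> (\<lambda>(e, cs). SEmit e cs) ` (UNIV \<times> stacks c0) \<union>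
     (\<lambda>(t, cs, ds). STest t cs ds) ` ((TZ ` {..<C} \<union> TB ` {..<C} \<union> TT ` {..<C}) \<times> stacks c0 \<times> stacks c0) \<union>
     (\<lambda>(k, cs). Put k cs) ` ({..<C + 2} \<times> stacks c0) \<union> Back ` stacks c0"

lemma finite_states: "finite (states C c0)"
  by (simp add: states_def stacks_def kont_finite)

lemma states_simps [simp]:
  "Start \<in> states C c0" "Halt \<in> states C c0" "Fin \<in> states C c0"
  "Run cs \<in> states C c0 \<longleftrightarrow> cs \<in> stacks c0"
  "SInc r cs \<in> states C c0 \<longleftrightarrow> r < C \<and> cs \<in> stacks c0"
  "SDec r cs \<in> states C c0 \<longleftrightarrow> r < C \<and> cs \<in> stacks c0"
  "SEmit e cs \<in> states C c0 \<longleftrightarrow> cs \<in> stacks c0"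
  "Put k cs \<in> states C c0 \<longleftrightarrow> k < C + 2 \<and> cs \<in> stacks c0"
  "Back cs \<in> states C c0 \<longleftrightarrow> cs \<in> stacks c0"
  by (auto simp: states_def)

lemma states_STest [simp]: "STest t cs ds \<in> states C c0 \<longleftrightarrow> treg t < C \<and> cs \<in> stacks c0 \<and> ds \<in> stacks c0"
  by (cases t) (auto simp: states_def image_iff)

lemma finite_syms: "finite (syms C)"
  by (simp add: syms_def)

lemma trans_closed:
  assumes c0: "regs_below C c0" and q: "q \<in> states C c0" and y: "y \<in> syms C"
  shows "trans C c0 q y \<in> states C c0 \<times> syms C \<times> {-1, 0, 1}"
proof -
  obtain a b m where yy: "y = (a, b, m)" "a < 3" "b < 3" "m \<subseteq> {..<C + 2}" using y by (auto simp: syms_def)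
  have suc: "succs ds \<subseteq> stacks c0" if "ds \<in> stacks c0" for ds
    using that kont_succs[of ds c0 "[]"] unfolding stacks_def by auto
  have reg: "regs_below C d" if "ds \<in> stacks c0" "d \<in> set ds" for d ds
    using that kont_regs[of ds c0 "[]" C d] c0 unfolding stacks_def by auto
  have run: "trans C c0 (Run ds) y \<in> states C c0 \<times> syms C \<times> {-1, 0, 1}" if ds: "ds \<in> stacks c0" for ds
  proof (cases ds)
    case Nil
    then show ?thesis using y by simp
  next
    case (Cons c cs)
    have s: "succs (c # cs) \<subseteq> stacks c0" and r: "regs_below C c" using suc reg ds Cons by auto
    then show ?thesis unfolding Cons using y by (cases c) auto
  qed
  have "[c0] \<in> stacks c0" using kont_self[of c0 "[]"] by (simp add: stacks_def)
  then show ?thesis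
    using q yy run y by (cases q) (auto simp: syms_def bit_sym_def split: if_splits)
qed

fun pos :: "(nat \<Rightarrow> nat) \<Rightarrow> bool list \<Rightarrow> nat \<Rightarrow> nat" where
  "pos s out 0 = 0"
| "pos s out (Suc 0) = length out"
| "pos s out (Suc (Suc r)) = s r"

definition rep :: "nat \<Rightarrow> bool list \<Rightarrow> (nat \<Rightarrow> nat) \<Rightarrow> bool list \<Rightarrow> int \<Rightarrow> sym" where
  "rep C x s out z = (if z < 0 then (0, 0, {}) else
     (if nat z < length x then bit_sym (x ! nat z) else 0,
      if nat z < length out then bit_sym (out ! nat z) else 0,
      {k. k < C + 2 \<and> pos s out k = nat z}))"

abbreviation run_tm where "run_tm C c0 t \<equiv> astep (trans C c0) Halt ^^ t"

lemma astep_trans: "q \<noteq> Halt \<Longrightarrow> trans C c0 q (tp h) = (q', a', d) \<Longrightarrow>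
   astep (trans C c0) Halt (q, tp, h) = (q', tp(h := a'), h + d)"
  by (simp add: astep_def)

lemma run_tm_add: "run_tm C c0 (t + u) y = run_tm C c0 u (run_tm C c0 t y)"
  by (subst add.commute) (simp only: funpow_add comp_apply)

lemma run_tm_right:
  assumes "q \<noteq> Halt" "\<And>j. j < n \<Longrightarrow> trans C c0 q (tp (int j)) = (q, tp (int j), 1)"
  shows "run_tm C c0 n (q, tp, 0) = (q, tp, int n)"
  using assms(2)
proof (induction n)
  case (Suc n)
  then show ?case using astep_trans[OF assms(1), of C c0 tp "int n"] by (simp add: Suc.IH Suc.prems)
qed simp

lemma run_tm_left:
  assumes "q \<noteq> Halt" "\<And>j. 0 < j \<Longrightarrow> j \<le> n \<Longrightarrow> trans C c0 q (tp (int j)) = (q, tp (int j), -1)"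
  shows "run_tm C c0 n (q, tp, int n) = (q, tp, 0)"
  using assms(2)
proof (induction n)
  case (Suc n)
  have "astep (trans C c0) Halt (q, tp, int (Suc n)) = (q, tp, int n)"
    using astep_trans[OF assms(1), of C c0 tp "int (Suc n)"] Suc.prems[of "Suc n"] by simp
  then show ?case using Suc by (simp add: funpow_swap1)
qed simp

lemma run_back:
  "run_tm C c0 (Suc n) (Back cs, rep C x s out, int n) = (Run cs, rep C x s out, 0)"
proof -
  have "run_tm C c0 n (Back cs, rep C x s out, int n) = (Back cs, rep C x s out, 0)"
    by (rule run_tm_left) (auto simp: rep_def)
  moreover have "astep (trans C c0) Halt (Back cs, rep C x s out, 0) = (Run cs, rep C x s out, 0)"
  proof -
    have "0 \<in> snd (snd (rep C x s out 0))" by (simp add: rep_def)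
    then show ?thesis by (cases "rep C x s out 0") (simp add: astep_def fun_upd_idem)
  qed
  ultimately show ?thesis by simp
qed

lemma mark_iff: "z \<ge> 0 \<Longrightarrow> k < C + 2 \<Longrightarrow> k \<in> snd (snd (rep C x s out z)) \<longleftrightarrow> pos s out k = nat z"
  by (simp add: rep_def)

lemma pos_upd: "pos (s(r := v)) out k = (if k = r + 2 then v else pos s out k)"
  by (cases "(s, out, k)" rule: pos.cases) auto

lemma pos_out: "pos s (out @ [b]) k = (if k = 1 then Suc (length out) else pos s out k)"
  by (cases "(s, out, k)" rule: pos.cases) auto

lemma run_put:
  assumes k: "k < C + 2" and n: "pos s' out' k = n"
    and tp: "\<And>z. tp z = (fst (rep C x s' out' z), fst (snd (rep C x s' out' z)), snd (snd (rep C x s' out' z)) - {k})"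
  shows "run_tm C c0 (Suc (Suc n)) (Put k cs, tp, int n) = (Run cs, rep C x s' out', 0)"
proof -
  have "tp(int n := (fst (tp (int n)), fst (snd (tp (int n))), insert k (snd (snd (tp (int n)))))) = rep C x s' out'"
    using k n by (auto simp: tp fun_eq_iff rep_def prod_eq_iff)
  then have "astep (trans C c0) Halt (Put k cs, tp, int n) = (Back cs, rep C x s' out', int n)"
    by (cases "tp (int n)") (simp add: astep_def)
  then show ?thesis using run_back[of n C c0 cs x s' out'] by (simp only: funpow_Suc_right comp_apply)
qed

lemma seek_mark:
  assumes k: "k < C + 2" "pos s out k = n" and q: "q \<noteq> Halt"
    and sk: "\<And>a b m. k \<notin> m \<Longrightarrow> trans C c0 q (a, b, m) = (q, (a, b, m), 1)"
  shows "run_tm C c0 n (q, rep C x s out, 0) = (q, rep C x s out, int n)"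
proof (rule run_tm_right[OF q])
  fix j assume "j < n"
  then have "k \<notin> snd (snd (rep C x s out (int j)))" using mark_iff[of "int j" k C] k by simp
  then show "trans C c0 q (rep C x s out (int j)) = (q, rep C x s out (int j), 1)"
    using sk by (cases "rep C x s out (int j)") simp
qed

lemma sim_test:
  assumes r: "treg t < C"
  shows "\<exists>u \<le> 2 * s (treg t) + 2. run_tm C c0 u (STest t cs ds, rep C x s out, 0) =
    (Run (if tst x t s then cs else ds), rep C x s out, 0)"
proof -
  let ?n = "s (treg t)" and ?es = "if tst x t s then cs else ds"
  have p: "treg t + 2 < C + 2" "pos s out (treg t + 2) = ?n" using r by simp_all
  have 1: "run_tm C c0 ?n (STest t cs ds, rep C x s out, 0) = (STest t cs ds, rep C x s out, int ?n)"
    by (rule seek_mark[OF p]) auto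
  have m: "treg t + 2 \<in> snd (snd (rep C x s out (int ?n)))" using mark_iff[of "int ?n" "treg t + 2"] p by simp
  have "tcond t (rep C x s out (int ?n)) = tst x t s"
    by (cases t) (auto simp: rep_def bit_sym_def)
  then have 2: "run_tm C c0 1 (STest t cs ds, rep C x s out, int ?n) = (Back ?es, rep C x s out, int ?n)"
    using m by (simp add: astep_def)
  show ?thesis
    using 1 2 run_back[of ?n C c0 ?es x s out]
    by (intro exI[of _ "?n + (1 + Suc ?n)"]) (simp only: run_tm_add, simp)
qed

lemma sim_move:
  assumes r: "r < C"
  shows "run_tm C c0 (2 * s r + 4) (SInc r cs, rep C x s out, 0) = (Run cs, rep C x (s(r := Suc (s r))) out, 0)"
    and "s r > 0 \<Longrightarrow> run_tm C c0 (2 * s r + 2) (SDec r cs, rep C x s out, 0) = (Run cs, rep C x (s(r := s r - 1)) out, 0)"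
proof -
  let ?n = "s r" and ?k = "r + 2"
  define tp where "tp z = (fst (rep C x s out z), fst (snd (rep C x s out z)), snd (snd (rep C x s out z)) - {?k})" for z
  have p: "?k < C + 2" "pos s out ?k = ?n" using r by simp_all
  have m: "?k \<in> snd (snd (rep C x s out (int ?n)))" using mark_iff[of "int ?n" ?k] p by simp
  have tpe: "(rep C x s out)(int ?n := (fst (rep C x s out (int ?n)), fst (snd (rep C x s out (int ?n))), snd (snd (rep C x s out (int ?n))) - {?k})) = tp"
    by (auto simp: tp_def fun_eq_iff rep_def prod_eq_iff)
  have tpr: "tp z = (fst (rep C x (s(r := v)) out z), fst (snd (rep C x (s(r := v)) out z)), snd (snd (rep C x (s(r := v)) out z)) - {?k})" for v z
    by (auto simp: tp_def rep_def pos_upd)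
  have 1: "run_tm C c0 ?n (SInc r cs, rep C x s out, 0) = (SInc r cs, rep C x s out, int ?n)"
    by (rule seek_mark[OF p]) auto
  have 2: "run_tm C c0 1 (SInc r cs, rep C x s out, int ?n) = (Put ?k cs, tp, int (Suc ?n))"
    using m by (cases "rep C x s out (int ?n)") (simp add: astep_def tpe[symmetric])
  have 3: "run_tm C c0 (Suc (Suc (Suc ?n))) (Put ?k cs, tp, int (Suc ?n)) = (Run cs, rep C x (s(r := Suc ?n)) out, 0)"
    by (rule run_put[OF p(1) _ tpr]) simp
  have "2 * ?n + 4 = ?n + (1 + Suc (Suc (Suc ?n)))" by simp
  then show "run_tm C c0 (2 * ?n + 4) (SInc r cs, rep C x s out, 0) = (Run cs, rep C x (s(r := Suc ?n)) out, 0)"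
    using 1 2 3 by (simp only: run_tm_add)
  assume n0: "?n > 0"
  have 1: "run_tm C c0 ?n (SDec r cs, rep C x s out, 0) = (SDec r cs, rep C x s out, int ?n)"
    by (rule seek_mark[OF p]) auto
  have 2: "run_tm C c0 1 (SDec r cs, rep C x s out, int ?n) = (Put ?k cs, tp, int (?n - 1))"
    using m n0 by (cases "rep C x s out (int ?n)") (simp add: astep_def tpe[symmetric] of_nat_diff)
  have 3: "run_tm C c0 (Suc (Suc (?n - 1))) (Put ?k cs, tp, int (?n - 1)) = (Run cs, rep C x (s(r := ?n - 1)) out, 0)"
    by (rule run_put[OF p(1) _ tpr]) simp
  have "2 * ?n + 2 = ?n + (1 + Suc (Suc (?n - 1)))" using n0 by simp
  then show "run_tm C c0 (2 * ?n + 2) (SDec r cs, rep C x s out, 0) = (Run cs, rep C x (s(r := ?n - 1)) out, 0)"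
    using 1 2 3 by (simp only: run_tm_add)
qed

lemma sim_emit:
  "run_tm C c0 (2 * length out + 4) (SEmit e cs, rep C x s out, 0) = (Run cs, rep C x s (out @ [e]), 0)"
proof -
  let ?n = "length out"
  define tp where "tp z = (fst (rep C x s (out @ [e]) z), fst (snd (rep C x s (out @ [e]) z)), snd (snd (rep C x s (out @ [e]) z)) - {1})" for z
  have p: "1 < C + 2" "pos s out 1 = ?n" by simp_all
  have m: "1 \<in> snd (snd (rep C x s out (int ?n)))" using mark_iff[of "int ?n" 1] p by simp
  have tpe: "(rep C x s out)(int ?n := (fst (rep C x s out (int ?n)), bit_sym e, snd (snd (rep C x s out (int ?n))) - {1})) = tp"
    by (auto simp: tp_def fun_eq_iff rep_def prod_eq_iff pos_out nth_append)
  have 1: "run_tm C c0 ?n (SEmit e cs, rep C x s out, 0) = (SEmit e cs, rep C x s out, int ?n)"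
    by (rule seek_mark[OF p]) auto
  have 2: "run_tm C c0 1 (SEmit e cs, rep C x s out, int ?n) = (Put 1 cs, tp, int (Suc ?n))"
    using m by (cases "rep C x s out (int ?n)") (simp add: astep_def tpe[symmetric])
  have 3: "run_tm C c0 (Suc (Suc (Suc ?n))) (Put 1 cs, tp, int (Suc ?n)) = (Run cs, rep C x s (out @ [e]), 0)"
    by (rule run_put[OF p(1) _ tp_def]) simp
  have "2 * ?n + 4 = ?n + (1 + Suc (Suc (Suc ?n)))" by simp
  then show ?thesis using 1 2 3 by (simp only: run_tm_add)
qed

text \<open>The bound is the cost of a sweep to a mark at distance at most \<open>B\<close> and
  back, plus a constant for the change of state and the move of the mark.\<close>

lemma sim_step:
  assumes cs: "\<And>c. c \<in> set cs \<Longrightarrow> regs_below C c" and B: "\<And>r. s r \<le> B" "length out \<le> B"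
    and st: "cstep x (cs, s, out) = (cs', s', out')"
  shows "\<exists>u \<le> 2 * B + 5. run_tm C c0 u (Run cs, rep C x s out, 0) = (Run cs', rep C x s' out', 0)"
proof (cases "(x, cs, s, out)" rule: cstep.cases)
  case 1
  then show ?thesis using st by (intro exI[of _ 0]) simp
next
  case (2 x' cs1 s1 out1)
  then show ?thesis using st by (intro exI[of _ 1]) (simp add: astep_def)
next
  case (3 x' r cs1 s1 out1)
  have r: "r < C" using 3 cs[of "INC r"] by simp
  have "run_tm C c0 (1 + (2 * s r + 4)) (Run cs, rep C x s out, 0) = (Run cs', rep C x s' out', 0)"
    unfolding run_tm_add[where t=1] using 3 st sim_move(1)[OF r, where s=s and cs=cs1 and x=x and out=out] by (simp add: astep_def)
  then show ?thesis using B(1)[of r] by (intro exI[of _ "1 + (2 * s r + 4)"]) simp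
next
  case (4 x' r cs1 s1 out1)
  have r: "r < C" using 4 cs[of "DEC r"] by simp
  have m: "r + 2 \<in> snd (snd (rep C x s out 0)) \<longleftrightarrow> s r = 0" using mark_iff[of 0 "r + 2" C x s out] r by simp
  show ?thesis
  proof (cases "s r = 0")
    case True
    then have "s(r := s r - 1) = s" by auto
    then show ?thesis using 4 st True m by (intro exI[of _ 1]) (simp add: astep_def)
  next
    case False
    have "run_tm C c0 (1 + (2 * s r + 2)) (Run cs, rep C x s out, 0) = (Run cs', rep C x s' out', 0)"
      unfolding run_tm_add[where t=1] using 4 st False m r sim_move(2)[where r=r and C=C and s=s and cs=cs1 and x=x and out=out] by (simp add: astep_def)
    then show ?thesis using B(1)[of r] by (intro exI[of _ "1 + (2 * s r + 2)"]) simp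
  qed
next
  case (5 x' b cs1 s1 out1)
  have "run_tm C c0 (1 + (2 * length out + 4)) (Run cs, rep C x s out, 0) = (Run cs', rep C x s' out', 0)"
    unfolding run_tm_add[where t=1] using 5 st sim_emit[where out=out and C=C and e=b and cs=cs1 and x=x and s=s] by (simp add: astep_def)
  then show ?thesis using B(2) by (intro exI[of _ "1 + (2 * length out + 4)"]) simp
next
  case (6 x' a b cs1 s1 out1)
  then show ?thesis using st by (intro exI[of _ 1]) (simp add: astep_def)
next
  case (7 x' t a b cs1 s1 out1)
  have r: "treg t < C" using 7 cs[of "IF t a b"] by simp
  obtain u where u: "u \<le> 2 * s (treg t) + 2" "run_tm C c0 u (STest t (a # cs1) (b # cs1), rep C x s out, 0) =
    (Run (if tst x t s then a # cs1 else b # cs1), rep C x s out, 0)" using sim_test[OF r] by blast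
  have "run_tm C c0 (1 + u) (Run cs, rep C x s out, 0) = (Run cs', rep C x s' out', 0)"
    unfolding run_tm_add[where t=1] using 7 st u(2) by (auto simp: astep_def)
  then show ?thesis using u(1) B(1)[of "treg t"] by (intro exI[of _ "1 + u"]) simp
next
  case (8 x' t a cs1 s1 out1)
  have r: "treg t < C" using 8 cs[of "WH t a"] by simp
  obtain u where u: "u \<le> 2 * s (treg t) + 2" "run_tm C c0 u (STest t cs1 (a # WH t a # cs1), rep C x s out, 0) =
    (Run (if tst x t s then cs1 else a # WH t a # cs1), rep C x s out, 0)" using sim_test[OF r] by blast
  have "run_tm C c0 (1 + u) (Run cs, rep C x s out, 0) = (Run cs', rep C x s' out', 0)"
    unfolding run_tm_add[where t=1] using 8 st u(2) by (auto simp: astep_def)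
  then show ?thesis using u(1) B(1)[of "treg t"] by (intro exI[of _ "1 + u"]) simp
qed

lemma cstep_inv:
  assumes "cstep x (cs, s, out) = (cs', s', out')"
  shows "(\<forall>c\<in>set cs. regs_below C c) \<Longrightarrow> (\<forall>c\<in>set cs'. regs_below C c)"
    and "(\<forall>r. s r \<le> B) \<Longrightarrow> (\<forall>r. s' r \<le> Suc B)" and "length out \<le> B \<Longrightarrow> length out' \<le> Suc B"
proof -
  have "((\<forall>c\<in>set cs. regs_below C c) \<longrightarrow> (\<forall>c\<in>set cs'. regs_below C c)) \<and>
    ((\<forall>r. s r \<le> B) \<longrightarrow> (\<forall>r. s' r \<le> Suc B)) \<and> (length out \<le> B \<longrightarrow> length out' \<le> Suc B)"
    using assms by (cases "(x, cs, s, out)" rule: cstep.cases)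
      (auto simp: le_Suc_eq split: if_splits intro: le_SucI diff_le_self[THEN le_trans])
  then show "(\<forall>c\<in>set cs. regs_below C c) \<Longrightarrow> (\<forall>c\<in>set cs'. regs_below C c)"
    "(\<forall>r. s r \<le> B) \<Longrightarrow> (\<forall>r. s' r \<le> Suc B)" "length out \<le> B \<Longrightarrow> length out' \<le> Suc B" by blast+
qed

text \<open>A command raises registers and output length by at most one, so after \<open>t\<close>
  commands all marks are within distance \<open>t\<close> and the total time is quadratic.\<close>

lemma sim_steps:
  assumes c0: "regs_below C c0"
  shows "\<exists>u. u \<le> t * (2 * t + 5) \<and> (case (cstep x ^^ t) ([c0], \<lambda>_. 0, []) of (cs, s, out) \<Rightarrow>
     run_tm C c0 u (Run [c0], rep C x (\<lambda>_. 0) [], 0) = (Run cs, rep C x s out, 0) \<and>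
     (\<forall>c\<in>set cs. regs_below C c) \<and> (\<forall>r. s r \<le> t) \<and> length out \<le> t)"
proof (induction t)
  case 0
  then show ?case using c0 by simp
next
  case (Suc t)
  obtain cs s out where m: "(cstep x ^^ t) ([c0], \<lambda>_. 0, []) = (cs, s, out)" by (cases "(cstep x ^^ t) ([c0], \<lambda>_. 0, [])") auto
  then obtain u where u: "u \<le> t * (2 * t + 5)" "run_tm C c0 u (Run [c0], rep C x (\<lambda>_. 0) [], 0) = (Run cs, rep C x s out, 0)"
    "\<forall>c\<in>set cs. regs_below C c" "\<forall>r. s r \<le> t" "length out \<le> t" using Suc by auto
  obtain cs' s' out' where m': "cstep x (cs, s, out) = (cs', s', out')" by (cases "cstep x (cs, s, out)") auto
  obtain v where v: "v \<le> 2 * t + 5" "run_tm C c0 v (Run cs, rep C x s out, 0) = (Run cs', rep C x s' out', 0)"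
    using sim_step[OF _ _ u(5) m', of C c0] u(3,4) by blast
  have "u + v \<le> t * (2 * t + 5) + (2 * t + 5)" using u(1) v(1) by simp
  also have "\<dots> \<le> Suc t * (2 * Suc t + 5)" by (simp add: algebra_simps)
  finally have uv: "u + v \<le> Suc t * (2 * Suc t + 5)" .
  have "(cstep x ^^ Suc t) ([c0], \<lambda>_. 0, []) = (cs', s', out')" using m m' by simp
  moreover have "run_tm C c0 (u + v) (Run [c0], rep C x (\<lambda>_. 0) [], 0) = (Run cs', rep C x s' out', 0)"
    using u(2) v(2) by (simp only: run_tm_add)
  ultimately show ?case using uv cstep_inv[OF m'] u(3-5) by (intro exI[of _ "u + v"]) simp
qed

lemma run_fin:
  assumes "n \<le> length out"
  shows "run_tm C c0 n (Fin, rep C x s out, 0) =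
    (Fin, (\<lambda>z. if 0 \<le> z \<and> z < int n then (bit_sym (out ! nat z), 0, {}) else rep C x s out z), int n)"
  using assms
proof (induction n)
  case 0
  then show ?case by (auto simp: fun_eq_iff)
next
  case (Suc n)
  let ?tp = "\<lambda>n z. if 0 \<le> z \<and> z < int n then (bit_sym (out ! nat z), 0, {}) else rep C x s out z"
  have "?tp n (int n) = (if n < length x then bit_sym (x ! n) else 0, bit_sym (out ! n), {k. k < C + 2 \<and> pos s out k = n})"
    using Suc.prems by (simp add: rep_def)
  moreover have "bit_sym (out ! n) \<noteq> 0" by (simp add: bit_sym_def)
  ultimately have "trans C c0 Fin (?tp n (int n)) = (Fin, (bit_sym (out ! n), 0, {}), 1)" by simp
  then have "astep (trans C c0) Halt (Fin, ?tp n, int n) = (Fin, (?tp n)(int n := (bit_sym (out ! n), 0, {})), int n + 1)"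
    by (intro astep_trans) auto
  moreover have "(?tp n)(int n := (bit_sym (out ! n), 0, {})) = ?tp (Suc n)" by (auto simp: fun_eq_iff)
  ultimately show ?case using Suc by (simp add: add.commute)
qed

section \<open>Time bounds and polynomial bounds\<close>

definition runs where
  "runs x c s out t s' out' \<longleftrightarrow> (\<forall>cs. (cstep x ^^ t) (c # cs, s, out) = (cs, s', out'))"

definition pb :: "(nat \<Rightarrow> nat) \<Rightarrow> bool" where
  "pb p \<longleftrightarrow> (\<exists>c k. \<forall>n. p n \<le> c * (n + 2) ^ k)"

lemma regs_below_mono: "regs_below C c \<Longrightarrow> C \<le> C' \<Longrightarrow> regs_below C' c"
  by (induction c) auto

lemma regs_below_ex: "\<exists>C. regs_below C c"
proof (induction c)
  case (SEQ a b)
  then obtain C C' where "regs_below C a" "regs_below C' b" by blast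
  then show ?case using regs_below_mono[of C a "max C C'"] regs_below_mono[of C' b "max C C'"]
    by (intro exI[of _ "max C C'"]) simp
next
  case (IF t a b)
  then obtain C C' where "regs_below C a" "regs_below C' b" by blast
  then show ?case using regs_below_mono[of C a "max (Suc (treg t)) (max C C')"] regs_below_mono[of C' b "max (Suc (treg t)) (max C C')"]
    by (intro exI[of _ "max (Suc (treg t)) (max C C')"]) simp
next
  case (WH t a)
  then obtain C where "regs_below C a" by blast
  then show ?case using regs_below_mono[of C a "max (Suc (treg t)) C"]
    by (intro exI[of _ "max (Suc (treg t)) C"]) simp
next
  case (INC r)
  show ?case by (intro exI[of _ "Suc r"]) simp
next
  case (DEC r)
  show ?case by (intro exI[of _ "Suc r"]) simp
qed auto

lemma tape_output_eq:
  assumes "\<And>k. k < length out \<Longrightarrow> tape (int k) = bit_sym (out ! k)" "tape (int (length out)) = 0"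
  shows "tape_output tape = out"
proof -
  have "(LEAST k. tape (int k) \<notin> {1, 2}) = length out"
  proof (rule Least_equality)
    show "length out \<le> k" if "tape (int k) \<notin> {1, 2}" for k
      using that assms(1)[of k] by (rule_tac ccontr) (auto simp: bit_sym_def split: if_splits)
  qed (simp add: assms)
  then show ?thesis unfolding tape_output_def
    by (intro nth_equalityI) (simp_all add: assms bit_sym_def)
qed

theorem poly_time_com:
  assumes p: "pb p" and run: "\<And>x. \<exists>t s'. t \<le> p (length x) \<and> runs x c0 (\<lambda>_. 0) [] t s' (f x)"
  shows "poly_time_computable f"
proof -
  obtain C where C: "regs_below C c0" using regs_below_ex by blast
  obtain cc kk where ck: "\<And>n. p n \<le> cc * (n + 2) ^ kk" using p unfolding pb_def by blast
  obtain M eq es where M: "wf_tm M" "eq Halt = 1" "es (0, 0, {}) = 0" "es (1, 0, {}) = 1" "es (2, 0, {}) = 2"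
    and sim: "\<And>t x. let c = run_tm C c0 t (Start, (\<lambda>i. if 0 \<le> i \<and> i < int (length x) then (if x ! nat i then (2, 0, {}) else (1, 0, {})) else (0, 0, {})), 0)
      in fst c \<in> states C c0 \<and> (\<forall>i. fst (snd c) i \<in> syms C) \<and>
         tm_run M t (tm_init x) = (eq (fst c), es \<circ> fst (snd c), snd (snd c))"
    using tm_of_abstract[OF finite_states[of C c0] finite_syms[of C], of Start Halt "(0, 0, {})" "(1, 0, {})" "(2, 0, {})" "trans C c0"]
      trans_closed[OF C] by (auto simp: syms_def)
  define d where "d = 2 * (cc * 3 ^ kk) * (cc * 3 ^ kk) + 6 * (cc * 3 ^ kk) + 3"
  have "\<exists>t. t \<le> 4 * d * length x ^ (2 * kk) + 4 * d \<and> fst (tm_run M t (tm_init x)) = 1 \<and>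
      tape_output (fst (snd (tm_run M t (tm_init x)))) = f x" for x
  proof -
    obtain t s' where t: "t \<le> p (length x)" "runs x c0 (\<lambda>_. 0) [] t s' (f x)" using run by blast
    let ?out = "f x" and ?tp0 = "\<lambda>i. if 0 \<le> i \<and> i < int (length x) then (if x ! nat i then (2::nat, 0::nat, {}::nat set) else (1, 0, {})) else (0, 0, {})"
    have cs: "(cstep x ^^ t) ([c0], \<lambda>_. 0, []) = ([], s', ?out)" using t(2) unfolding runs_def by blast
    obtain u where u: "u \<le> t * (2 * t + 5)" "run_tm C c0 u (Run [c0], rep C x (\<lambda>_. 0) [], 0) = (Run [], rep C x s' ?out, 0)"
      "length ?out \<le> t" using sim_steps[OF C, of t x] unfolding cs by auto
    have i: "run_tm C c0 1 (Start, ?tp0, 0) = (Run [c0], rep C x (\<lambda>_. 0) [], 0)"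
    proof -
      obtain a b m where abm: "?tp0 0 = (a, b, m)" by (cases "?tp0 0") auto
      have "?tp0(0 := (a, b, {..<C + 2})) = rep C x (\<lambda>_. 0) []"
      proof
        fix z
        have p0: "pos (\<lambda>_. 0) [] k = 0" for k by (cases "(\<lambda>_::nat. 0::nat, [] :: bool list, k)" rule: pos.cases) auto
        show "(?tp0(0 := (a, b, {..<C + 2}))) z = rep C x (\<lambda>_. 0) [] z"
          using abm by (auto simp: rep_def p0 bit_sym_def split: if_splits)
      qed
      then show ?thesis using abm by (simp add: astep_def)
    qed
    let ?n = "length ?out"
    let ?tp1 = "\<lambda>z. if 0 \<le> z \<and> z < int ?n then (bit_sym (?out ! nat z), 0, {}) else rep C x s' ?out z"
    have j: "run_tm C c0 1 (Run [], rep C x s' ?out, 0) = (Fin, rep C x s' ?out, 0)" by (simp add: astep_def)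
    have k: "run_tm C c0 ?n (Fin, rep C x s' ?out, 0) = (Fin, ?tp1, int ?n)" by (rule run_fin) simp
    have l: "run_tm C c0 1 (Fin, ?tp1, int ?n) = (Halt, ?tp1(int ?n := (0, 0, {})), int ?n)"
      by (simp add: astep_def rep_def)
    \<comment> \<open>Initialisation, simulation, switch to \<open>Fin\<close>, one step for each
      output bit, and the final step to \<open>Halt\<close>.\<close>
    define T where "T = 1 + (u + (1 + (?n + 1)))"
    have "run_tm C c0 T (Start, ?tp0, 0) = (Halt, ?tp1(int ?n := (0, 0, {})), int ?n)"
      unfolding T_def run_tm_add using i u(2) j k l by (simp only:)
    then have fin: "tm_run M T (tm_init x) = (1, es \<circ> (?tp1(int ?n := (0, 0, {}))), int ?n)"
      using sim[of T x] M(2) by (simp add: Let_def)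
    have out: "tape_output (es \<circ> (?tp1(int ?n := (0, 0, {})))) = ?out"
      by (rule tape_output_eq) (use M in \<open>auto simp: bit_sym_def\<close>)
    have tb: "t \<le> cc * 3 ^ kk * (length x ^ kk + 1)"
    proof -
      have "(length x + 2) ^ kk \<le> 3 ^ kk * (length x ^ kk + 1)"
      proof (cases "length x = 0")
        case True
        have "(2::nat) ^ kk \<le> 3 ^ kk" by (rule power_mono) auto
        also have "\<dots> \<le> 3 ^ kk * (0 ^ kk + 1)" by simp
        finally show ?thesis unfolding True by (simp only: add_0)
      next
        case False
        then have "1 \<le> length x" by (cases x) auto
        then have "(length x + 2) ^ kk \<le> (3 * length x) ^ kk" by (intro power_mono) linarith+
        then show ?thesis by (simp add: power_mult_distrib)
      qed
      then have "cc * (length x + 2) ^ kk \<le> cc * (3 ^ kk * (length x ^ kk + 1))" by (rule mult_le_mono2)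
      then show ?thesis unfolding mult.assoc by (rule le_trans[OF le_trans[OF t(1) ck]])
    qed
    have "T \<le> 4 * d * length x ^ (2 * kk) + 4 * d"
    proof -
      define e where "e = cc * 3 ^ kk"
      define y where "y = length x ^ kk"
      have te: "t \<le> e * (y + 1)" using tb by (simp add: e_def y_def)
      have "T \<le> t * (2 * t + 5) + t + 3" using u(1,3) by (simp add: T_def)
      also have "\<dots> = 2 * t * t + 6 * t + 3" by (simp add: algebra_simps)
      also have "\<dots> \<le> 2 * (e * (y + 1)) * (e * (y + 1)) + 6 * (e * (y + 1)) + 3"
        using te by (intro add_mono mult_le_mono order_refl)
      also have "\<dots> \<le> 2 * (e * (y + 1)) * (e * (y + 1)) + 6 * (e * ((y + 1) * (y + 1))) + 3 * ((y + 1) * (y + 1))"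
        by (simp add: add_mono)
      also have "\<dots> = d * ((y + 1) * (y + 1))" by (simp add: d_def e_def algebra_simps)
      also have "\<dots> \<le> d * (4 * (y * y) + 4)"
      proof (rule mult_le_mono2)
        show "(y + 1) * (y + 1) \<le> 4 * (y * y) + 4" by (cases y) (auto simp: algebra_simps)
      qed
      finally have "T \<le> d * (4 * (y * y) + 4)" .
      moreover have "length x ^ (2 * kk) = y * y" by (simp add: y_def mult_2 power_add)
      ultimately show ?thesis by (simp add: algebra_simps)
    qed
    then show ?thesis using fin out by (intro exI[of _ T]) simp
  qed
  then have "\<forall>x. \<exists>t. t \<le> 4 * d * length x ^ (2 * kk) + 4 * d \<and> fst (tm_run M t (tm_init x)) = 1 \<and>
      tape_output (fst (snd (tm_run M t (tm_init x)))) = f x" by (rule allI)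
  with M(1) show ?thesis unfolding poly_time_computable_def
    by (rule_tac x=M in exI, rule_tac x="4 * d" in exI, rule_tac x="2 * kk" in exI, rule_tac conjI)
qed

section \<open>Polynomial-time computable functions and output programs\<close>

lemma pbI: "(\<And>n. p n \<le> c * (n + 2) ^ k) \<Longrightarrow> pb p"
  unfolding pb_def by blast

lemma pbE:
  assumes "pb p" obtains c k where "\<And>n. p n \<le> c * (n + 2) ^ k"
  using assms unfolding pb_def by blast

lemma pb_const: "pb (\<lambda>n. c)"
  by (rule pbI[of _ c 0]) simp

lemma pb_id: "pb (\<lambda>n. n)"
  by (rule pbI[of _ 1 1]) simp

lemma pb_mult:
  assumes "pb p" "pb q" shows "pb (\<lambda>n. p n * q n)"
proof -
  obtain c k where p: "\<And>n. p n \<le> c * (n + 2) ^ k" using pbE[OF assms(1)] by blast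
  obtain c' k' where q: "\<And>n. q n \<le> c' * (n + 2) ^ k'" using pbE[OF assms(2)] by blast
  show ?thesis
  proof (rule pbI[of _ "c * c'" "k + k'"])
    fix n
    have "p n * q n \<le> (c * (n + 2) ^ k) * (c' * (n + 2) ^ k')" by (rule mult_le_mono[OF p q])
    then show "p n * q n \<le> c * c' * (n + 2) ^ (k + k')" by (simp only: power_add mult_ac)
  qed
qed

lemma pb_add:
  assumes "pb p" "pb q" shows "pb (\<lambda>n. p n + q n)"
proof -
  obtain c k where p: "\<And>n. p n \<le> c * (n + 2) ^ k" using pbE[OF assms(1)] by blast
  obtain c' k' where q: "\<And>n. q n \<le> c' * (n + 2) ^ k'" using pbE[OF assms(2)] by blast
  show ?thesis
  proof (rule pbI[of _ "c + c'" "k + k'"])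
    fix n
    have "c * (n + 2) ^ k \<le> c * (n + 2) ^ (k + k')" by (rule mult_le_mono2, rule power_increasing) auto
    moreover have "c' * (n + 2) ^ k' \<le> c' * (n + 2) ^ (k + k')" by (rule mult_le_mono2, rule power_increasing) auto
    ultimately show "p n + q n \<le> (c + c') * (n + 2) ^ (k + k')"
      unfolding add_mult_distrib using p[of n] q[of n] by linarith
  qed
qed

lemma pb_comp:
  assumes "pb p" "pb q" shows "pb (\<lambda>n. p (q n))"
proof -
  obtain c k where p: "\<And>n. p n \<le> c * (n + 2) ^ k" using pbE[OF assms(1)] by blast
  obtain c' k' where q: "\<And>n. q n \<le> c' * (n + 2) ^ k'" using pbE[OF assms(2)] by blast
  show ?thesis
  proof (rule pbI[of _ "c * (c' + 2) ^ k" "k' * k"])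
    fix n
    have "2 * 1 \<le> 2 * (n + 2 :: nat) ^ k'" by (rule mult_le_mono2) simp
    then have "q n + 2 \<le> (c' + 2) * (n + 2) ^ k'" unfolding add_mult_distrib using q[of n] by linarith
    then have "(q n + 2) ^ k \<le> ((c' + 2) * (n + 2) ^ k') ^ k" by (rule power_mono) simp
    then have "c * (q n + 2) ^ k \<le> c * ((c' + 2) ^ k * (n + 2) ^ (k' * k))"
      unfolding power_mult_distrib power_mult by (rule mult_le_mono2)
    then show "p (q n) \<le> c * (c' + 2) ^ k * (n + 2) ^ (k' * k)"
      unfolding mult.assoc by (rule le_trans[OF p])
  qed
qed

lemmas pb_intros = pb_const pb_id pb_add pb_mult

text \<open>In \<open>runs\<close> the remaining stack is universally quantified, so bounded runs
  compose directly under \<open>SEQ\<close>, \<open>IF\<close> and \<open>WH\<close>.\<close>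

definition rl where
  "rl x c n s out s' out' \<longleftrightarrow> (\<exists>t\<le>n. runs x c s out t s' out')"

lemma rl_mono: "rl x c n s out s' out' \<Longrightarrow> n \<le> m \<Longrightarrow> rl x c m s out s' out'"
  unfolding rl_def using le_trans by blast

lemma rl_step:
  assumes "\<And>cs. cstep x (c # cs, s, out) = (cs, s', out')" "1 \<le> n"
  shows "rl x c n s out s' out'"
  unfolding rl_def runs_def using assms by (intro exI[of _ 1]) simp

lemma rl_basic:
  "1 \<le> n \<Longrightarrow> rl x SKIP n s out s out"
  "1 \<le> n \<Longrightarrow> rl x (INC r) n s out (s(r := Suc (s r))) out"
  "1 \<le> n \<Longrightarrow> rl x (DEC r) n s out (s(r := s r - 1)) out"
  "1 \<le> n \<Longrightarrow> rl x (EMIT e) n s out s (out @ [e])"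
  by (rule rl_step; simp)+

lemma rl_SEQ:
  assumes "rl x a n s out s1 out1" "rl x b m s1 out1 s2 out2" "n + m + 1 \<le> k"
  shows "rl x (SEQ a b) k s out s2 out2"
proof -
  obtain t u where t: "t \<le> n" "\<And>cs. (cstep x ^^ t) (a # cs, s, out) = (cs, s1, out1)"
    and u: "u \<le> m" "\<And>cs. (cstep x ^^ u) (b # cs, s1, out1) = (cs, s2, out2)"
    using assms(1,2) unfolding rl_def runs_def by blast
  have "(cstep x ^^ (u + (t + 1))) (SEQ a b # cs, s, out) = (cs, s2, out2)" for cs
    unfolding funpow_add comp_apply using t(2)[of "b # cs"] u(2) by simp
  then show ?thesis unfolding rl_def runs_def using t(1) u(1) assms(3) by (intro exI[of _ "u + (t + 1)"]) simp
qed

lemma rl_IF: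
  assumes "tst x t s \<Longrightarrow> rl x a n s out s' out'" "\<not> tst x t s \<Longrightarrow> rl x b n s out s' out'" "n + 1 \<le> k"
  shows "rl x (IF t a b) k s out s' out'"
proof -
  let ?c = "if tst x t s then a else b"
  have "rl x ?c n s out s' out'" using assms by simp
  then obtain u where u: "u \<le> n" "\<And>cs. (cstep x ^^ u) (?c # cs, s, out) = (cs, s', out')"
    unfolding rl_def runs_def by blast
  have "(cstep x ^^ (u + 1)) (IF t a b # cs, s, out) = (cs, s', out')" for cs
    unfolding funpow_add comp_apply using u(2) by simp
  then show ?thesis unfolding rl_def runs_def using u(1) assms(3) by (intro exI[of _ "u + 1"]) simp
qed

lemma rl_WH_stop: "tst x t s \<Longrightarrow> 1 \<le> k \<Longrightarrow> rl x (WH t a) k s out s out"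
  by (rule rl_step) auto

lemma rl_WH_go:
  assumes "\<not> tst x t s" "rl x a n s out s1 out1" "rl x (WH t a) m s1 out1 s2 out2" "n + m + 1 \<le> k"
  shows "rl x (WH t a) k s out s2 out2"
proof -
  obtain i j where i: "i \<le> n" "\<And>cs. (cstep x ^^ i) (a # cs, s, out) = (cs, s1, out1)"
    and j: "j \<le> m" "\<And>cs. (cstep x ^^ j) (WH t a # cs, s1, out1) = (cs, s2, out2)"
    using assms(2,3) unfolding rl_def runs_def by blast
  have "(cstep x ^^ (j + (i + 1))) (WH t a # cs, s, out) = (cs, s2, out2)" for cs
    unfolding funpow_add comp_apply using assms(1) i(2)[of "WH t a # cs"] j(2) by simp
  then show ?thesis unfolding rl_def runs_def using i(1) j(1) assms(4) by (intro exI[of _ "j + (i + 1)"]) simp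
qed

lemma rl_WH:
  assumes "\<And>i. i < n \<Longrightarrow> \<not> tst x t (S i)" "tst x t (S n)"
    and "\<And>i. i < n \<Longrightarrow> rl x a m (S i) (O' i) (S (Suc i)) (O' (Suc i))"
    and "S 0 = s" "O' 0 = out" "S n = s'" "O' n = out'" "n * (m + 1) + 1 \<le> k"
  shows "rl x (WH t a) k s out s' out'"
proof -
  have "i \<le> n \<Longrightarrow> rl x (WH t a) ((n - i) * (m + 1) + 1) (S i) (O' i) (S n) (O' n)" for i
  proof (induction "n - i" arbitrary: i)
    case 0
    then have "i = n" by simp
    then show ?case using assms(2) by (simp add: rl_WH_stop)
  next
    case (Suc d)
    then have i: "i < n" "d = n - Suc i" "n - i = Suc (n - Suc i)" by simp_all
    have "rl x (WH t a) ((n - Suc i) * (m + 1) + 1) (S (Suc i)) (O' (Suc i)) (S n) (O' n)"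
      using Suc(1)[OF i(2)] i(1) by simp
    then show ?case by (rule rl_WH_go[OF assms(1)[OF i(1)] assms(3)[OF i(1)]]) (simp add: i(3))
  qed
  from this[of 0] have "rl x (WH t a) (n * (m + 1) + 1) (S 0) (O' 0) (S n) (O' n)" by simp
  then show ?thesis using rl_mono assms(4-8) by metis
qed

definition "CLR r = WH (TZ r) (DEC r)"
definition "MOV a b = WH (TZ a) (SEQ (DEC a) (INC b))"
definition "SBM a b = WH (TZ a) (SEQ (DEC a) (DEC b))"
definition "CPY a b t = SEQ (WH (TZ a) (SEQ (DEC a) (SEQ (INC b) (INC t)))) (MOV t a)"

lemma rl_CLR:
  assumes "2 * s r + 1 \<le> k" "s' = s(r := 0)"
  shows "rl x (CLR r) k s out s' out"
  unfolding CLR_def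
proof (rule rl_WH[where n = "s r" and m = 1 and S = "\<lambda>i. s(r := s r - i)" and O' = "\<lambda>_. out"])
  fix i assume "i < s r"
  show "rl x (DEC r) 1 (s(r := s r - i)) out (s(r := s r - Suc i)) out"
    using rl_basic(3)[of 1 x r "s(r := s r - i)" out] by simp
qed (use assms in auto)

lemma rl_MOV:
  assumes "a \<noteq> b" "4 * s a + 1 \<le> k" "s' = s(a := 0, b := s b + s a)"
  shows "rl x (MOV a b) k s out s' out"
  unfolding MOV_def
proof (rule rl_WH[where n = "s a" and m = 3 and S = "\<lambda>i. s(a := s a - i, b := s b + i)" and O' = "\<lambda>_. out"])
  fix i assume i: "i < s a"
  show "rl x (SEQ (DEC a) (INC b)) 3 (s(a := s a - i, b := s b + i)) out (s(a := s a - Suc i, b := s b + Suc i)) out"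
    by (rule rl_SEQ[OF rl_basic(3)[of 1] rl_basic(2)[of 1, THEN back_subst[where P = "\<lambda>s'. rl _ _ _ _ _ s' _"]]])
      (use assms(1) i in \<open>auto simp: fun_eq_iff\<close>)
qed (use assms in auto)

lemma rl_SBM:
  assumes "a \<noteq> b" "4 * s a + 1 \<le> k" "s' = s(a := 0, b := s b - s a)"
  shows "rl x (SBM a b) k s out s' out"
  unfolding SBM_def
proof (rule rl_WH[where n = "s a" and m = 3 and S = "\<lambda>i. s(a := s a - i, b := s b - i)" and O' = "\<lambda>_. out"])
  fix i assume i: "i < s a"
  show "rl x (SEQ (DEC a) (DEC b)) 3 (s(a := s a - i, b := s b - i)) out (s(a := s a - Suc i, b := s b - Suc i)) out"
    by (rule rl_SEQ[OF rl_basic(3)[of 1] rl_basic(3)[of 1, THEN back_subst[where P = "\<lambda>s'. rl _ _ _ _ _ s' _"]]])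
      (use assms(1) i in \<open>auto simp: fun_eq_iff\<close>)
qed (use assms in auto)

text \<open>Reading a counter destroys it, so a second copy is collected in \<open>t\<close> and
  moved back. The value is added to \<open>b\<close> rather than assigned.\<close>

lemma rl_CPY:
  assumes "a \<noteq> b" "a \<noteq> t" "b \<noteq> t" "s t = 0" "10 * s a + 3 \<le> k" "s' = s(b := s b + s a)"
  shows "rl x (CPY a b t) k s out s' out"
  unfolding CPY_def
proof (rule rl_SEQ)
  let ?s1 = "s(a := 0, b := s b + s a, t := s a)"
  show "rl x (WH (TZ a) (SEQ (DEC a) (SEQ (INC b) (INC t)))) (6 * s a + 1) s out ?s1 out"
  proof (rule rl_WH[where n = "s a" and m = 5 and S = "\<lambda>i. s(a := s a - i, b := s b + i, t := i)" and O' = "\<lambda>_. out"])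
    fix i assume i: "i < s a"
    show "rl x (SEQ (DEC a) (SEQ (INC b) (INC t))) 5 (s(a := s a - i, b := s b + i, t := i)) out
        (s(a := s a - Suc i, b := s b + Suc i, t := Suc i)) out"
      by (rule rl_SEQ[OF rl_basic(3)[of 1] rl_SEQ[OF rl_basic(2)[of 1] rl_basic(2)[of 1, THEN back_subst[where P = "\<lambda>s'. rl _ _ _ _ _ s' _"]], where k = 3]])
        (use assms(1-3) i in \<open>auto simp: fun_eq_iff\<close>)
  qed (use assms in \<open>auto simp: fun_eq_iff\<close>)
  show "rl x (MOV t a) (4 * s a + 1) ?s1 out s' out"
    by (rule rl_MOV) (use assms in \<open>auto simp: fun_eq_iff\<close>)
qed (use assms in auto)

definition bnd :: "bool list \<Rightarrow> (nat \<Rightarrow> nat) \<Rightarrow> nat \<Rightarrow> bool" where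
  "bnd x \<sigma> B \<longleftrightarrow> length x \<le> B \<and> (\<forall>i. \<sigma> i \<le> B)"

definition clean :: "nat \<Rightarrow> (nat \<Rightarrow> nat) \<Rightarrow> bool" where
  "clean b s \<longleftrightarrow> (\<forall>r\<ge>b. s r = 0)"

text \<open>\<open>F\<close> reads the variables \<open>\<sigma>\<close> from registers \<open>\<rho> i < b\<close>, uses the registers from \<open>b\<close> on as
  scratch space and leaves its value in register \<open>b\<close>.\<close>

definition computes where
  "computes F \<rho> b c p \<longleftrightarrow> pb p \<and> (\<forall>x s out B. bnd x (\<lambda>i. s (\<rho> i)) B \<longrightarrow> clean b s \<longrightarrow>
     rl x c (p B) s out (s(b := F x (\<lambda>i. s (\<rho> i)))) out)"

text \<open>Registers are unary, so the values themselves must be polynomially bounded; this also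
  bounds the loops. A program is required for every placement \<open>\<rho>\<close> of the variables
  and every scratch base \<open>b\<close>, so that computations can be nested.\<close>

definition cf :: "(bool list \<Rightarrow> (nat \<Rightarrow> nat) \<Rightarrow> nat) \<Rightarrow> bool" where
  "cf F \<longleftrightarrow> (\<exists>q. pb q \<and> (\<forall>x \<sigma> B. bnd x \<sigma> B \<longrightarrow> F x \<sigma> \<le> q B)) \<and>
     (\<forall>\<rho> b. (\<forall>i. \<rho> i < b) \<longrightarrow> (\<exists>c p. computes F \<rho> b c p))"

definition emits where
  "emits P \<rho> b c p \<longleftrightarrow> pb p \<and> (\<forall>x s out B. bnd x (\<lambda>i. s (\<rho> i)) B \<longrightarrow> clean b s \<longrightarrow>
     rl x c (p B) s out s (out @ P x (\<lambda>i. s (\<rho> i))))"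

definition pe :: "(bool list \<Rightarrow> (nat \<Rightarrow> nat) \<Rightarrow> bool list) \<Rightarrow> bool" where
  "pe P \<longleftrightarrow> (\<forall>\<rho> b. (\<forall>i. \<rho> i < b) \<longrightarrow> (\<exists>c p. emits P \<rho> b c p))"

lemma cf_bound:
  assumes "cf F" obtains q where "pb q" "\<And>x \<sigma> B. bnd x \<sigma> B \<Longrightarrow> F x \<sigma> \<le> q B"
  using assms unfolding cf_def by blast

lemma cf_prog:
  assumes "cf F" "\<And>i. \<rho> i < b"
  obtains c p where "pb p" "\<And>x s out B s'. bnd x (\<lambda>i. s (\<rho> i)) B \<Longrightarrow> clean b s \<Longrightarrow>
     s' = s(b := F x (\<lambda>i. s (\<rho> i))) \<Longrightarrow> rl x c (p B) s out s' out"
proof -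
  obtain c p where "computes F \<rho> b c p" using assms unfolding cf_def by blast
  then show thesis unfolding computes_def by (intro that[of p c]) simp_all
qed

lemma pe_prog:
  assumes "pe P" "\<And>i. \<rho> i < b"
  obtains c p where "pb p" "\<And>x s out B. bnd x (\<lambda>i. s (\<rho> i)) B \<Longrightarrow> clean b s \<Longrightarrow>
     rl x c (p B) s out s (out @ P x (\<lambda>i. s (\<rho> i)))"
proof -
  obtain c p where "emits P \<rho> b c p" using assms unfolding pe_def by blast
  then show thesis unfolding emits_def by (intro that[of p c]) simp_all
qed

lemma cfI:
  assumes "pb q" "\<And>x \<sigma> B. bnd x \<sigma> B \<Longrightarrow> F x \<sigma> \<le> q B"
    and "\<And>\<rho> b. (\<And>i. \<rho> i < b) \<Longrightarrow> \<exists>c p. computes F \<rho> b c p"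
  shows "cf F"
  unfolding cf_def using assms(1,2) by (intro conjI exI[of _ q] allI impI assms(3)) simp_all

lemma computesI:
  assumes "pb p" "\<And>x s out B. bnd x (\<lambda>i. s (\<rho> i)) B \<Longrightarrow> clean b s \<Longrightarrow>
     rl x c (p B) s out (s(b := F x (\<lambda>i. s (\<rho> i)))) out"
  shows "\<exists>c p. computes F \<rho> b c p"
  unfolding computes_def by (rule exI[of _ c], rule exI[of _ p], intro conjI allI impI assms)

lemma peI:
  assumes "\<And>\<rho> b. (\<And>i. \<rho> i < b) \<Longrightarrow> \<exists>c p. emits P \<rho> b c p"
  shows "pe P"
  unfolding pe_def by (intro allI impI assms) simp

lemma emitsI:
  assumes "pb p" "\<And>x s out B. bnd x (\<lambda>i. s (\<rho> i)) B \<Longrightarrow> clean b s \<Longrightarrow>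
     rl x c (p B) s out s (out @ P x (\<lambda>i. s (\<rho> i)))"
  shows "\<exists>c p. emits P \<rho> b c p"
  unfolding emits_def by (rule exI[of _ c], rule exI[of _ p], intro conjI allI impI assms)

lemma clean_upd: "clean b s \<Longrightarrow> clean (Suc b) (s(b := v))"
  by (auto simp: clean_def)

lemma cf_const: "cf (\<lambda>x \<sigma>. n)"
proof (rule cfI[OF pb_const[of n]])
  fix \<rho> :: "nat \<Rightarrow> nat" and b assume "\<And>i. \<rho> i < b"
  have "\<exists>c. \<forall>x s out. s b = 0 \<longrightarrow> rl x c (2 * n + 1) s out (s(b := n)) out"
  proof (induction n)
    case 0
    then show ?case using rl_basic(1)[of 1] by (intro exI[of _ SKIP]) (auto simp: fun_upd_idem)
  next
    case (Suc n)
    then obtain c where c: "\<And>x s out. s b = 0 \<Longrightarrow> rl x c (2 * n + 1) s out (s(b := n)) out" by blast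
    have "rl x (SEQ c (INC b)) (2 * Suc n + 1) s out (s(b := Suc n)) out" if "s b = 0" for x s out
      using rl_SEQ[OF c[of s x out, OF that] rl_basic(2)[of 1 x b "s(b := n)" out], of "2 * Suc n + 1"] by simp
    then show ?case by blast
  qed
  then obtain c where c: "\<And>x s out. s b = 0 \<Longrightarrow> rl x c (2 * n + 1) s out (s(b := n)) out" by blast
  have m: "rl x c (2 * n + 1) s out (s(b := n)) out" if "bnd x (\<lambda>i. s (\<rho> i)) B" "clean b s" for x s out B
    using c that(2) by (simp add: clean_def)
  show "\<exists>c p. computes (\<lambda>x \<sigma>. n) \<rho> b c p"
    by (rule computesI[where \<rho> = \<rho> and b = b and F = "\<lambda>x \<sigma>. n", OF _ m]) (intro pb_intros | rule pb_id | fact)+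
qed simp

lemma cf_var: "cf (\<lambda>x \<sigma>. \<sigma> i)"
proof (rule cfI[OF pb_id])
  fix \<rho> :: "nat \<Rightarrow> nat" and b assume r: "\<And>i. \<rho> i < b"
  have m: "rl x (CPY (\<rho> i) b (Suc b)) (10 * B + 3) s out (s(b := s (\<rho> i))) out"
    if "bnd x (\<lambda>i. s (\<rho> i)) B" "clean b s" for x s out B
    by (rule rl_CPY) (use r[of i] that in \<open>auto simp: clean_def bnd_def\<close>)
  show "\<exists>c p. computes (\<lambda>x \<sigma>. \<sigma> i) \<rho> b c p"
    by (rule computesI[where \<rho> = \<rho> and b = b and F = "\<lambda>x \<sigma>. \<sigma> i", OF _ m]) (intro pb_intros | rule pb_id | fact)+
qed (simp add: bnd_def)

lemma cf_len: "cf (\<lambda>x \<sigma>. length x)"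
proof (rule cfI[OF pb_id])
  fix \<rho> :: "nat \<Rightarrow> nat" and b assume r: "\<And>i. \<rho> i < b"
  have m: "rl x (WH (TB b) (INC b)) (2 * B + 1) s out (s(b := length x)) out"
    if "bnd x (\<lambda>i. s (\<rho> i)) B" "clean b s" for x s out B
  proof (rule rl_WH[where n = "length x" and m = 1 and S = "\<lambda>i. s(b := i)" and O' = "\<lambda>_. out"])
    show "rl x (INC b) 1 (s(b := i)) out (s(b := Suc i)) out" for i
      using rl_basic(2)[of 1 x b "s(b := i)"] by simp
  qed (use that in \<open>auto simp: clean_def bnd_def\<close>)
  show "\<exists>c p. computes (\<lambda>x \<sigma>. length x) \<rho> b c p"
    by (rule computesI[where \<rho> = \<rho> and b = b and F = "\<lambda>x \<sigma>. length x", OF _ m]) (intro pb_intros | rule pb_id | fact)+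
qed (simp add: bnd_def)

definition inp :: "bool list \<Rightarrow> nat \<Rightarrow> nat" where
  "inp x i = (if i < length x then bit_sym (x ! i) else 0)"

lemma cf_inp: assumes F: "cf F" shows "cf (\<lambda>x \<sigma>. inp x (F x \<sigma>))"
proof (rule cfI[OF pb_const[of 2]])
  fix \<rho> :: "nat \<Rightarrow> nat" and b assume r: "\<And>i. \<rho> i < b"
  obtain c p where p: "pb p" and c: "\<And>x s out B s'. bnd x (\<lambda>i. s (\<rho> i)) B \<Longrightarrow> clean b s \<Longrightarrow>
     s' = s(b := F x (\<lambda>i. s (\<rho> i))) \<Longrightarrow> rl x c (p B) s out s' out" by (rule cf_prog[where \<rho> = \<rho> and b = b, OF F r]; rule that; assumption)
  obtain q where q: "pb q" "\<And>x \<sigma> B. bnd x \<sigma> B \<Longrightarrow> F x \<sigma> \<le> q B" using cf_bound[OF F] by blast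
  let ?d = "IF (TB b) (CLR b) (IF (TT b) (SEQ (CLR b) (SEQ (INC b) (INC b))) (SEQ (CLR b) (INC b)))"
  have m: "rl x (SEQ c ?d) (p B + (2 * q B + 10) + 1) s out (s(b := inp x (F x (\<lambda>i. s (\<rho> i))))) out"
    if h: "bnd x (\<lambda>i. s (\<rho> i)) B" "clean b s" for x s out B
  proof (rule rl_SEQ[OF c[OF h refl]])
    let ?v = "F x (\<lambda>i. s (\<rho> i))"
    have v: "?v \<le> q B" using q(2)[OF h(1)] .
    let ?s = "s(b := ?v)" and ?s' = "s(b := inp x ?v)"
    have k: "rl x (CLR b) (2 * q B + 1) ?s out (s(b := 0)) out" by (rule rl_CLR) (use v in auto)
    show "rl x ?d (2 * q B + 10) ?s out ?s' out"
    proof (rule rl_IF[where n = "2 * q B + 9"])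
      assume "tst x (TB b) ?s"
      then show "rl x (CLR b) (2 * q B + 9) ?s out ?s' out" using rl_mono[OF k] by (simp add: inp_def)
    next
      assume l: "\<not> tst x (TB b) ?s"
      have i1: "rl x (INC b) 1 (s(b := 0)) out (s(b := 1)) out" using rl_basic(2)[of 1 x b "s(b := 0)" out] by simp
      have i2: "rl x (INC b) 1 (s(b := 1)) out (s(b := 2)) out" using rl_basic(2)[of 1 x b "s(b := 1)" out] by (simp add: numeral_2_eq_2)
      show "rl x (IF (TT b) (SEQ (CLR b) (SEQ (INC b) (INC b))) (SEQ (CLR b) (INC b))) (2 * q B + 9) ?s out ?s' out"
      proof (rule rl_IF[where n = "2 * q B + 8"])
        assume "tst x (TT b) ?s"
        then have e: "?s' = s(b := 2)" by (simp add: inp_def bit_sym_def)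
        show "rl x (SEQ (CLR b) (SEQ (INC b) (INC b))) (2 * q B + 8) ?s out ?s' out" unfolding e
          by (rule rl_SEQ[OF k rl_SEQ[OF i1 i2, where k = 3]]) auto
      next
        assume "\<not> tst x (TT b) ?s"
        then have e: "?s' = s(b := 1)" using l by (simp add: inp_def bit_sym_def)
        show "rl x (SEQ (CLR b) (INC b)) (2 * q B + 8) ?s out ?s' out" unfolding e
          by (rule rl_SEQ[OF k i1]) auto
      qed simp
    qed simp
  qed simp
  show "\<exists>c p. computes (\<lambda>x \<sigma>. inp x (F x \<sigma>)) \<rho> b c p"
    by (rule computesI[where \<rho> = \<rho> and b = b and F = "\<lambda>x \<sigma>. inp x (F x \<sigma>)", OF _ m]) (intro pb_intros | rule pb_id | fact)+
qed (simp add: inp_def bit_sym_def)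

lemma cf_binary:
  assumes F: "cf F" and G: "cf G" and q: "pb q" "\<And>x \<sigma> B. bnd x \<sigma> B \<Longrightarrow> f (F x \<sigma>) (G x \<sigma>) \<le> q B"
    and op: "\<And>b. \<exists>c. \<forall>x s out. rl x c (4 * s (Suc b) + 1) s out (s(Suc b := 0, b := f (s b) (s (Suc b)))) out"
  shows "cf (\<lambda>x \<sigma>. f (F x \<sigma>) (G x \<sigma>))"
proof (rule cfI[OF q])
  fix \<rho> :: "nat \<Rightarrow> nat" and b assume r: "\<And>i. \<rho> i < b"
  then have r': "\<And>i. \<rho> i < Suc b" by (simp add: less_SucI)
  obtain c p where p: "pb p" and c: "\<And>x s out B s'. bnd x (\<lambda>i. s (\<rho> i)) B \<Longrightarrow> clean b s \<Longrightarrow>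
     s' = s(b := F x (\<lambda>i. s (\<rho> i))) \<Longrightarrow> rl x c (p B) s out s' out" by (rule cf_prog[where \<rho> = \<rho> and b = b, OF F r]; rule that; assumption)
  obtain c' p' where p': "pb p'" and c': "\<And>x s out B s'. bnd x (\<lambda>i. s (\<rho> i)) B \<Longrightarrow> clean (Suc b) s \<Longrightarrow>
     s' = s(Suc b := G x (\<lambda>i. s (\<rho> i))) \<Longrightarrow> rl x c' (p' B) s out s' out" by (rule cf_prog[where \<rho> = \<rho> and b = "Suc b", OF G r']; rule that; assumption)
  obtain g where g: "pb g" "\<And>x \<sigma> B. bnd x \<sigma> B \<Longrightarrow> G x \<sigma> \<le> g B" using cf_bound[OF G] by blast
  obtain d where d: "\<And>x s out. rl x d (4 * s (Suc b) + 1) s out (s(Suc b := 0, b := f (s b) (s (Suc b)))) out" using op by blast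
  have m: "rl x (SEQ c (SEQ c' d)) (p B + (p' B + (4 * g B + 1) + 1) + 1) s out (s(b := f (F x (\<lambda>i. s (\<rho> i))) (G x (\<lambda>i. s (\<rho> i))))) out"
    if h: "bnd x (\<lambda>i. s (\<rho> i)) B" "clean b s" for x s out B
  proof (rule rl_SEQ[OF c[OF h refl] rl_SEQ])
    let ?F = "F x (\<lambda>i. s (\<rho> i))" and ?G = "G x (\<lambda>i. s (\<rho> i))"
    have nb: "\<rho> i \<noteq> b" for i using r[of i] by simp
    show "rl x c' (p' B) (s(b := ?F)) out (s(b := ?F, Suc b := ?G)) out"
      by (rule c') (use h nb clean_upd in auto)
    have "4 * ?G + 1 \<le> 4 * g B + 1" using g(2)[OF h(1)] by simp
    then have "rl x d (4 * g B + 1) (s(b := ?F, Suc b := ?G)) out (s(b := ?F, Suc b := ?G, Suc b := 0, b := f ?F ?G)) out"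
      using rl_mono[OF d[of x "s(b := ?F, Suc b := ?G)" out]] by simp
    moreover have "s(b := ?F, Suc b := ?G, Suc b := 0, b := f ?F ?G) = s(b := f ?F ?G)"
      using h(2) by (auto simp: fun_eq_iff clean_def)
    ultimately show "rl x d (4 * g B + 1) (s(b := ?F, Suc b := ?G)) out (s(b := f ?F ?G)) out" by metis
  qed auto
  show "\<exists>c p. computes (\<lambda>x \<sigma>. f (F x \<sigma>) (G x \<sigma>)) \<rho> b c p"
    by (rule computesI[where \<rho> = \<rho> and b = b and F = "\<lambda>x \<sigma>. f (F x \<sigma>) (G x \<sigma>)", OF _ m]) (intro pb_intros | rule pb_id | fact)+
qed

lemma cf_add: assumes F: "cf F" and G: "cf G" shows "cf (\<lambda>x \<sigma>. F x \<sigma> + G x \<sigma>)"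
proof -
  obtain f where f: "pb f" "\<And>x \<sigma> B. bnd x \<sigma> B \<Longrightarrow> F x \<sigma> \<le> f B" using cf_bound[OF F] by blast
  obtain g where g: "pb g" "\<And>x \<sigma> B. bnd x \<sigma> B \<Longrightarrow> G x \<sigma> \<le> g B" using cf_bound[OF G] by blast
  show ?thesis
  proof (rule cf_binary[OF F G pb_add[OF f(1) g(1)]])
    show "\<exists>c. \<forall>x s out. rl x c (4 * s (Suc b) + 1) s out (s(Suc b := 0, b := s b + s (Suc b))) out" for b
      by (intro exI[of _ "MOV (Suc b) b"] allI rl_MOV) auto
  qed (simp add: f(2) g(2) add_mono)
qed

lemma cf_sub: assumes F: "cf F" and G: "cf G" shows "cf (\<lambda>x \<sigma>. F x \<sigma> - G x \<sigma>)"
proof -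
  obtain f where f: "pb f" "\<And>x \<sigma> B. bnd x \<sigma> B \<Longrightarrow> F x \<sigma> \<le> f B" using cf_bound[OF F] by blast
  show ?thesis
  proof (rule cf_binary[OF F G f(1)])
    show "\<exists>c. \<forall>x s out. rl x c (4 * s (Suc b) + 1) s out (s(Suc b := 0, b := s b - s (Suc b))) out" for b
      by (intro exI[of _ "SBM (Suc b) b"] allI rl_SBM) auto
  qed (use f(2) in \<open>simp add: le_diff_conv trans_le_add1\<close>)
qed

lemma cf_ren: assumes F: "cf F" shows "cf (\<lambda>x \<sigma>. F x (\<lambda>i. \<sigma> (g i)))"
proof -
  obtain q where q: "pb q" "\<And>x \<sigma> B. bnd x \<sigma> B \<Longrightarrow> F x \<sigma> \<le> q B" using cf_bound[OF F] by blast
  show ?thesis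
  proof (rule cfI[OF q(1)])
    show "F x (\<lambda>i. \<sigma> (g i)) \<le> q B" if "bnd x \<sigma> B" for x \<sigma> B
      using that by (intro q(2)) (simp add: bnd_def)
    fix \<rho> :: "nat \<Rightarrow> nat" and b assume r: "\<And>i. \<rho> i < b"
    obtain c p where "pb p" and c: "\<And>x s out B s'. bnd x (\<lambda>i. s (\<rho> (g i))) B \<Longrightarrow> clean b s \<Longrightarrow>
      s' = s(b := F x (\<lambda>i. s (\<rho> (g i)))) \<Longrightarrow> rl x c (p B) s out s' out"
      by (rule cf_prog[where \<rho> = "\<lambda>i. \<rho> (g i)" and b = b, OF F r]; rule that; assumption)
    have m: "rl x c (p B) s out (s(b := F x (\<lambda>i. s (\<rho> (g i))))) out" if "bnd x (\<lambda>i. s (\<rho> i)) B" "clean b s" for x s out B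
      by (rule c) (use that in \<open>auto simp: bnd_def\<close>)
    show "\<exists>c p. computes (\<lambda>x \<sigma>. F x (\<lambda>i. \<sigma> (g i))) \<rho> b c p"
      by (rule computesI[where \<rho> = \<rho> and b = b and F = "\<lambda>x \<sigma>. F x (\<lambda>i. \<sigma> (g i))", OF _ m]) fact
  qed
qed

lemma bnd_cons: "bnd x \<sigma> B \<Longrightarrow> v \<le> D \<Longrightarrow> bnd x (case_nat v \<sigma>) (B + D)"
  unfolding bnd_def by (auto split: nat.split simp: trans_le_add1 trans_le_add2)

text \<open>Variables are de Bruijn indices: the new value becomes variable 0 and the others are
  shifted by \<open>case_nat\<close>.\<close>

lemma cf_let: assumes F: "cf F" and H: "cf H" shows "cf (\<lambda>x \<sigma>. H x (case_nat (F x \<sigma>) \<sigma>))"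
proof -
  obtain f where f: "pb f" "\<And>x \<sigma> B. bnd x \<sigma> B \<Longrightarrow> F x \<sigma> \<le> f B" using cf_bound[OF F] by blast
  obtain h where h: "pb h" "\<And>x \<sigma> B. bnd x \<sigma> B \<Longrightarrow> H x \<sigma> \<le> h B" using cf_bound[OF H] by blast
  have hb: "H x (case_nat (F x \<sigma>) \<sigma>) \<le> h (B + f B)" if "bnd x \<sigma> B" for x \<sigma> B
    by (rule h(2)[OF bnd_cons[OF that f(2)[OF that]]])
  show ?thesis
  proof (rule cfI[OF _ hb])
    show "pb (\<lambda>B. h (B + f B))" by (rule pb_comp[OF h(1)]) (intro pb_intros | rule pb_id | fact)+
    fix \<rho> :: "nat \<Rightarrow> nat" and b assume r: "\<And>i. \<rho> i < b"
    define \<rho>' where "\<rho>' = case_nat b \<rho>"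
    have r': "\<rho>' i < Suc b" for i using r by (auto simp: \<rho>'_def less_SucI split: nat.split)
    obtain c p where p: "pb p" and c: "\<And>x s out B s'. bnd x (\<lambda>i. s (\<rho> i)) B \<Longrightarrow> clean b s \<Longrightarrow>
      s' = s(b := F x (\<lambda>i. s (\<rho> i))) \<Longrightarrow> rl x c (p B) s out s' out"
      by (rule cf_prog[where \<rho> = \<rho> and b = b, OF F r]; rule that; assumption)
    obtain c' p' where p': "pb p'" and c': "\<And>x s out B s'. bnd x (\<lambda>i. s (\<rho>' i)) B \<Longrightarrow> clean (Suc b) s \<Longrightarrow>
      s' = s(Suc b := H x (\<lambda>i. s (\<rho>' i))) \<Longrightarrow> rl x c' (p' B) s out s' out"
      by (rule cf_prog[where \<rho> = \<rho>' and b = "Suc b", OF H r']; rule that; assumption)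
    have pp': "pb (\<lambda>B. p' (B + f B))" by (rule pb_comp[OF p']) (intro pb_intros | rule pb_id | fact)+
    have ph: "pb (\<lambda>B. h (B + f B))" by (rule pb_comp[OF h(1)]) (intro pb_intros | rule pb_id | fact)+
    have m: "rl x (SEQ c (SEQ c' (SEQ (CLR b) (MOV (Suc b) b)))) (p B + (p' (B + f B) + ((2 * f B + 1) + (4 * h (B + f B) + 1) + 1) + 1) + 1)
        s out (s(b := H x (case_nat (F x (\<lambda>i. s (\<rho> i))) (\<lambda>i. s (\<rho> i))))) out"
      if hy: "bnd x (\<lambda>i. s (\<rho> i)) B" "clean b s" for x s out B
    proof -
      let ?\<sigma> = "\<lambda>i. s (\<rho> i)"
      define u where "u = F x ?\<sigma>"
      define v where "v = H x (case_nat u ?\<sigma>)"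
      let ?s1 = "s(b := u)" and ?s2 = "s(b := u, Suc b := v)" and ?s3 = "s(b := 0, Suc b := v)"
      have nb: "\<rho> i \<noteq> b" for i using r[of i] by simp
      have u: "u \<le> f B" unfolding u_def by (rule f(2)[OF hy(1)])
      have e: "(\<lambda>i. ?s1 (\<rho>' i)) = case_nat u ?\<sigma>" by (auto simp: \<rho>'_def fun_eq_iff nb split: nat.split)
      have v: "v \<le> h (B + f B)" unfolding v_def u_def by (rule hb[OF hy(1)])
      have 1: "rl x c (p B) s out ?s1 out" by (rule c[OF hy]) (simp add: u_def)
      have 2: "rl x c' (p' (B + f B)) ?s1 out ?s2 out"
        by (rule c') (unfold e v_def, use bnd_cons[OF hy(1) u] clean_upd[OF hy(2)] in auto)
      have 3: "rl x (CLR b) (2 * f B + 1) ?s2 out ?s3 out"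
        by (rule rl_CLR) (use u in \<open>auto simp: fun_eq_iff\<close>)
      have 4: "rl x (MOV (Suc b) b) (4 * h (B + f B) + 1) ?s3 out (s(b := v)) out"
        by (rule rl_MOV) (use v hy(2) in \<open>auto simp: fun_eq_iff clean_def\<close>)
      show ?thesis using rl_SEQ[OF 1 rl_SEQ[OF 2 rl_SEQ[OF 3 4 order_refl] order_refl] order_refl]
        unfolding u_def v_def .
    qed
    show "\<exists>c p. computes (\<lambda>x \<sigma>. H x (case_nat (F x \<sigma>) \<sigma>)) \<rho> b c p"
      by (rule computesI[where \<rho> = \<rho> and b = b and F = "\<lambda>x \<sigma>. H x (case_nat (F x \<sigma>) \<sigma>)", OF _ m])
        (intro pb_intros | rule pb_id | fact)+
  qed
qed

text \<open>The bounded sum is the loop from which products, quotients and bounded quantifiers are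
  obtained. Register \<open>b\<close> counts down, the next three hold the index, the accumulated
  sum and the current summand.\<close>

lemma cf_sum:
  assumes G: "cf G" and H: "cf (\<lambda>x \<tau>. H x (\<lambda>i. \<tau> (Suc i)) (\<tau> 0))"
  shows "cf (\<lambda>x \<sigma>. \<Sum>v<G x \<sigma>. H x \<sigma> v)"
proof -
  obtain g where g: "pb g" "\<And>x \<sigma> B. bnd x \<sigma> B \<Longrightarrow> G x \<sigma> \<le> g B" using cf_bound[OF G] by blast
  obtain h where h: "pb h" "\<And>x \<sigma> B. bnd x \<sigma> B \<Longrightarrow> H x (\<lambda>i. \<sigma> (Suc i)) (\<sigma> 0) \<le> h B" using cf_bound[OF H] by blast
  have hb: "H x \<sigma> v \<le> h (B + g B)" if "bnd x \<sigma> B" "v < G x \<sigma>" for x \<sigma> B v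
  proof -
    have "v \<le> g B" using that(2) g(2)[OF that(1)] by simp
    from h(2)[OF bnd_cons[OF that(1) this]] show ?thesis by simp
  qed
  have sb: "(\<Sum>v<n. H x \<sigma> v) \<le> g B * h (B + g B)" if hy: "bnd x \<sigma> B" "n \<le> G x \<sigma>" for x \<sigma> B n
  proof -
    have "(\<Sum>v<n. H x \<sigma> v) \<le> (\<Sum>v<n. h (B + g B))" by (rule sum_mono) (use hb[OF hy(1)] hy(2) in auto)
    also have "\<dots> = n * h (B + g B)" by simp
    also have "\<dots> \<le> g B * h (B + g B)" by (rule mult_le_mono1) (use hy(2) g(2)[OF hy(1)] in simp)
    finally show ?thesis .
  qed
  have ph: "pb (\<lambda>B. h (B + g B))" by (rule pb_comp[OF h(1)]) (intro pb_intros | rule pb_id | fact)+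
  show ?thesis
  proof (rule cfI[where q = "\<lambda>B. g B * h (B + g B)"])
    show "pb (\<lambda>B. g B * h (B + g B))" by (intro pb_intros | fact)+
    show "(\<Sum>v<G x \<sigma>. H x \<sigma> v) \<le> g B * h (B + g B)" if "bnd x \<sigma> B" for x \<sigma> B using sb[OF that order_refl] .
    fix \<rho> :: "nat \<Rightarrow> nat" and b assume r: "\<And>i. \<rho> i < b"
    define \<rho>' where "\<rho>' = case_nat (Suc b) \<rho>"
    have r': "\<rho>' i < Suc (Suc (Suc b))" for i using r[of "i - 1"] by (auto simp: \<rho>'_def less_SucI split: nat.split)
    obtain c p where p: "pb p" and c: "\<And>x s out B s'. bnd x (\<lambda>i. s (\<rho> i)) B \<Longrightarrow> clean b s \<Longrightarrow>
      s' = s(b := G x (\<lambda>i. s (\<rho> i))) \<Longrightarrow> rl x c (p B) s out s' out"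
      by (rule cf_prog[where \<rho> = \<rho> and b = b, OF G r]; rule that; assumption)
    obtain c' p' where p': "pb p'" and c': "\<And>x s out B s'. bnd x (\<lambda>i. s (\<rho>' i)) B \<Longrightarrow> clean (Suc (Suc (Suc b))) s \<Longrightarrow>
      s' = s(Suc (Suc (Suc b)) := H x (\<lambda>i. s (\<rho>' (Suc i))) (s (\<rho>' 0))) \<Longrightarrow> rl x c' (p' B) s out s' out"
      by (rule cf_prog[where \<rho> = \<rho>' and b = "Suc (Suc (Suc b))", OF H r']; rule that; assumption)
    have pp': "pb (\<lambda>B. p' (B + g B))" by (rule pb_comp[OF p']) (intro pb_intros | rule pb_id | fact)+
    let ?b1 = "Suc b" and ?b2 = "Suc (Suc b)" and ?b3 = "Suc (Suc (Suc b))"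
    let ?body = "SEQ c' (SEQ (MOV ?b3 ?b2) (SEQ (INC ?b1) (DEC b)))"
    let ?m = "\<lambda>B. p' (B + g B) + ((4 * h (B + g B) + 1) + (1 + 1 + 1) + 1) + 1"
    have m: "rl x (SEQ c (SEQ (WH (TZ b) ?body) (SEQ (CLR ?b1) (MOV ?b2 b))))
        (p B + ((g B * (?m B + 1) + 1) + ((2 * g B + 1) + (4 * (g B * h (B + g B)) + 1) + 1) + 1) + 1)
        s out (s(b := \<Sum>v<G x (\<lambda>i. s (\<rho> i)). H x (\<lambda>i. s (\<rho> i)) v)) out"
      if hy: "bnd x (\<lambda>i. s (\<rho> i)) B" "clean b s" for x s out B
    proof -
      define \<sigma> where "\<sigma> = (\<lambda>i. s (\<rho> i))"
      define n where "n = G x \<sigma>"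
      define A where "A v = (\<Sum>u<v. H x \<sigma> u)" for v
      define S where "S v = s(b := n - v, ?b1 := v, ?b2 := A v)" for v
      have hy1: "bnd x \<sigma> B" using hy(1) by (simp add: \<sigma>_def)
      have nb: "\<rho> i \<noteq> b" "\<rho> i \<noteq> ?b1" "\<rho> i \<noteq> ?b2" for i using r[of i] by simp_all
      have z: "s b = 0" "s ?b1 = 0" "s ?b2 = 0" "s ?b3 = 0" using hy(2) by (simp_all add: clean_def)
      have n: "n \<le> g B" unfolding n_def by (rule g(2)[OF hy1])
      have 1: "rl x c (p B) s out (S 0) out" by (rule c[OF hy]) (use z in \<open>auto simp: S_def A_def n_def \<sigma>_def fun_eq_iff\<close>)
      have 2: "rl x (WH (TZ b) ?body) (g B * (?m B + 1) + 1) (S 0) out (S n) out"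
      proof (rule rl_WH[where n = n and m = "?m B" and S = S and O' = "\<lambda>_. out"])
        show "n * (?m B + 1) + 1 \<le> g B * (?m B + 1) + 1" using n by (intro add_mono mult_le_mono1) auto
        show "tst x (TZ b) (S n)" by (simp add: S_def)
        show "\<not> tst x (TZ b) (S i)" if "i < n" for i using that by (simp add: S_def)
        fix i assume i: "i < n"
        have e0: "S i (\<rho>' 0) = i" by (simp add: S_def \<rho>'_def)
        have e1: "(\<lambda>j. S i (\<rho>' (Suc j))) = \<sigma>" by (simp add: S_def \<rho>'_def \<sigma>_def nb)
        have e: "(\<lambda>j. S i (\<rho>' j)) = case_nat i \<sigma>"
          using e0 e1 by (auto simp: fun_eq_iff split: nat.split)
        have a: "rl x c' (p' (B + g B)) (S i) out ((S i)(?b3 := H x \<sigma> i)) out"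
        proof (rule c')
          show "bnd x (\<lambda>j. S i (\<rho>' j)) (B + g B)" unfolding e by (rule bnd_cons[OF hy1]) (use i n in simp)
          show "clean ?b3 (S i)" using hy(2) by (auto simp: clean_def S_def)
        qed (simp add: e0 e1)
        have hh: "H x \<sigma> i \<le> h (B + g B)" by (rule hb[OF hy1]) (use i n_def in simp)
        have d: "rl x (MOV ?b3 ?b2) (4 * h (B + g B) + 1) ((S i)(?b3 := H x \<sigma> i)) out ((S i)(?b2 := A (Suc i))) out"
          by (rule rl_MOV) (use hh z in \<open>auto simp: fun_eq_iff S_def A_def\<close>)
        have e': "rl x (INC ?b1) 1 ((S i)(?b2 := A (Suc i))) out ((S i)(?b2 := A (Suc i), ?b1 := Suc i)) out"
          using rl_basic(2)[of 1 x ?b1 "(S i)(?b2 := A (Suc i))" out] by (simp add: S_def)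
        have f: "rl x (DEC b) 1 ((S i)(?b2 := A (Suc i), ?b1 := Suc i)) out (S (Suc i)) out"
        proof -
          have "((S i)(?b2 := A (Suc i), ?b1 := Suc i))(b := (n - i) - 1) = S (Suc i)"
            by (auto simp: S_def fun_eq_iff)
          then show ?thesis using rl_basic(3)[of 1 x b "(S i)(?b2 := A (Suc i), ?b1 := Suc i)" out] by (simp add: S_def)
        qed
        show "rl x ?body (?m B) (S i) out (S (Suc i)) out"
          by (rule rl_SEQ[OF a rl_SEQ[OF d rl_SEQ[OF e' f order_refl] order_refl] order_refl])
      qed simp_all
      have 3: "rl x (CLR ?b1) (2 * g B + 1) (S n) out (s(?b2 := A n)) out"
        by (rule rl_CLR) (use n z in \<open>auto simp: S_def fun_eq_iff\<close>)
      have 4: "rl x (MOV ?b2 b) (4 * (g B * h (B + g B)) + 1) (s(?b2 := A n)) out (s(b := A n)) out"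
        by (rule rl_MOV) (use sb[OF hy1, of n] z in \<open>auto simp: A_def n_def fun_eq_iff\<close>)
      show ?thesis using rl_SEQ[OF 1 rl_SEQ[OF 2 rl_SEQ[OF 3 4 order_refl] order_refl] order_refl]
        unfolding A_def n_def \<sigma>_def .
    qed
    show "\<exists>c p. computes (\<lambda>x \<sigma>. \<Sum>v<G x \<sigma>. H x \<sigma> v) \<rho> b c p"
      by (rule computesI[where \<rho> = \<rho> and b = b and F = "\<lambda>x \<sigma>. \<Sum>v<G x \<sigma>. H x \<sigma> v", OF _ m])
        (intro pb_intros | rule pb_id | fact)+
  qed
qed

text \<open>Simultaneous substitution as a chain of single bindings; each of them shifts the
  arguments that are still to be bound.\<close>

lemma cf_subst:
  assumes "cf H" "\<And>i. i < n \<Longrightarrow> cf (A i)"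
  shows "cf (\<lambda>x \<sigma>. H x (\<lambda>i. if i < n then A i x \<sigma> else \<sigma> (i - n)))"
  using assms(2)
proof (induction n arbitrary: A)
  case 0
  then show ?case using assms(1) by simp
next
  case (Suc n)
  have "cf (\<lambda>x \<tau>. H x (\<lambda>i. if i < n then A i x (\<lambda>i. \<tau> (Suc i)) else \<tau> (i - n)))"
    by (rule Suc.IH[of "\<lambda>i x \<tau>. A i x (\<lambda>i. \<tau> (Suc i))"]) (rule cf_ren[where g = Suc], rule Suc.prems, simp)
  from cf_let[OF Suc.prems[OF lessI] this]
  have "cf (\<lambda>x \<sigma>. H x (\<lambda>i. if i < n then A i x \<sigma> else case_nat (A n x \<sigma>) \<sigma> (i - n)))" unfolding nat.case .
  moreover have "(\<lambda>i. if i < n then A i x \<sigma> else case_nat (A n x \<sigma>) \<sigma> (i - n)) =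
     (\<lambda>i. if i < Suc n then A i x \<sigma> else \<sigma> (i - Suc n))" for x \<sigma>
    by (auto simp: fun_eq_iff less_Suc_eq split: nat.split) (metis Suc_diff_Suc diff_Suc_Suc linorder_neqE_nat nat.inject)
  ultimately show ?case by simp
qed

lemma cf_comp1: "cf (\<lambda>x \<sigma>. f x (\<sigma> 0)) \<Longrightarrow> cf A \<Longrightarrow> cf (\<lambda>x \<sigma>. f x (A x \<sigma>))"
  using cf_subst[of "\<lambda>x \<sigma>. f x (\<sigma> 0)" 1 "\<lambda>_. A"] by simp

lemma cf_comp2: "cf (\<lambda>x \<sigma>. f x (\<sigma> 0) (\<sigma> 1)) \<Longrightarrow> cf A \<Longrightarrow> cf B \<Longrightarrow> cf (\<lambda>x \<sigma>. f x (A x \<sigma>) (B x \<sigma>))"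
  using cf_subst[of "\<lambda>x \<sigma>. f x (\<sigma> 0) (\<sigma> 1)" 2 "\<lambda>i. if i = 0 then A else B"] by simp

lemma cf_comp4: "cf (\<lambda>x \<sigma>. f x (\<sigma> 0) (\<sigma> 1) (\<sigma> 2) (\<sigma> 3)) \<Longrightarrow> cf A \<Longrightarrow> cf B \<Longrightarrow> cf C \<Longrightarrow> cf D \<Longrightarrow>
    cf (\<lambda>x \<sigma>. f x (A x \<sigma>) (B x \<sigma>) (C x \<sigma>) (D x \<sigma>))"
  using cf_subst[of "\<lambda>x \<sigma>. f x (\<sigma> 0) (\<sigma> 1) (\<sigma> 2) (\<sigma> 3)" 4
    "\<lambda>i. if i = 0 then A else if i = 1 then B else if i = 2 then C else D"] by simp

lemma cf_mult: assumes "cf A" "cf B" shows "cf (\<lambda>x \<sigma>. A x \<sigma> * B x \<sigma>)"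
proof -
  have "cf (\<lambda>x \<sigma>. \<Sum>v<\<sigma> 0. \<sigma> 1)" by (rule cf_sum; rule cf_var)
  then have "cf (\<lambda>x \<sigma>. \<sigma> 0 * \<sigma> 1)" by simp
  from cf_comp2[OF this assms] show ?thesis .
qed

section \<open>Decidable predicates as functions with values 0 and 1\<close>

abbreviation cp where "cp P \<equiv> cf (\<lambda>x \<sigma>. of_bool (P x \<sigma>))"

lemma cp_le: assumes "cf A" "cf B" shows "cp (\<lambda>x \<sigma>. A x \<sigma> \<le> B x \<sigma>)"
proof -
  have "cf (\<lambda>x \<sigma>. 1 - (A x \<sigma> - B x \<sigma>))" by (intro cf_sub cf_const assms)
  moreover have "1 - (a - b) = of_bool (a \<le> b)" for a b :: nat by auto
  ultimately show ?thesis by simp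
qed

lemma cp_less: assumes "cf A" "cf B" shows "cp (\<lambda>x \<sigma>. A x \<sigma> < B x \<sigma>)"
  using cp_le[OF cf_add[OF assms(1) cf_const[of 1]] assms(2)] by (simp add: Suc_le_eq)

lemma cp_not: assumes "cp P" shows "cp (\<lambda>x \<sigma>. \<not> P x \<sigma>)"
proof -
  have "cf (\<lambda>x \<sigma>. 1 - of_bool (P x \<sigma>))" by (intro cf_sub cf_const assms)
  moreover have "(1::nat) - of_bool p = of_bool (\<not> p)" for p by auto
  ultimately show ?thesis by simp
qed

lemma cp_conj: assumes "cp P" "cp Q" shows "cp (\<lambda>x \<sigma>. P x \<sigma> \<and> Q x \<sigma>)"
  using cf_mult[OF assms] by (simp add: of_bool_conj)

lemma cp_disj: assumes "cp P" "cp Q" shows "cp (\<lambda>x \<sigma>. P x \<sigma> \<or> Q x \<sigma>)"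
  using cp_not[OF cp_conj[OF cp_not[OF assms(1)] cp_not[OF assms(2)]]] by simp

lemma cp_imp: assumes "cp P" "cp Q" shows "cp (\<lambda>x \<sigma>. P x \<sigma> \<longrightarrow> Q x \<sigma>)"
  using cp_disj[OF cp_not[OF assms(1)] assms(2)] unfolding imp_conv_disj .

lemma cp_eq: assumes "cf A" "cf B" shows "cp (\<lambda>x \<sigma>. A x \<sigma> = B x \<sigma>)"
proof -
  have e: "a \<le> b \<and> b \<le> a \<longleftrightarrow> a = b" for a b :: nat by auto
  show ?thesis using cp_conj[OF cp_le[OF assms] cp_le[OF assms(2,1)]] unfolding e .
qed

lemma cp_const: "cp (\<lambda>x \<sigma>. P)"
  by (rule cf_const)

lemma cp_ex:
  assumes G: "cf G" and P: "cf (\<lambda>x \<tau>. of_bool (P x (\<lambda>i. \<tau> (Suc i)) (\<tau> 0)))"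
  shows "cp (\<lambda>x \<sigma>. \<exists>v<G x \<sigma>. P x \<sigma> v)"
proof -
  have "cf (\<lambda>x \<sigma>. \<Sum>v<G x \<sigma>. of_bool (P x \<sigma> v))" by (rule cf_sum[OF G P])
  from cp_less[OF cf_const[of 0] this]
  have c: "cp (\<lambda>x \<sigma>. 0 < (\<Sum>v<G x \<sigma>. of_bool (P x \<sigma> v) :: nat))" .
  have "0 < (\<Sum>v<n. of_bool (Q v) :: nat) \<longleftrightarrow> (\<exists>v<n. Q v)" for n :: nat and Q
    unfolding neq0_conv[symmetric] by (subst sum_eq_0_iff) auto
  from c[unfolded this] show ?thesis .
qed

lemma cp_all:
  assumes G: "cf G" and P: "cf (\<lambda>x \<tau>. of_bool (P x (\<lambda>i. \<tau> (Suc i)) (\<tau> 0)))"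
  shows "cp (\<lambda>x \<sigma>. \<forall>v<G x \<sigma>. P x \<sigma> v)"
  using cp_not[OF cp_ex[OF G cp_not[OF P]]] by simp

lemma cp_ball: "finite J \<Longrightarrow> (\<And>j. j \<in> J \<Longrightarrow> cp (P j)) \<Longrightarrow> cp (\<lambda>x \<sigma>. \<forall>j\<in>J. P j x \<sigma>)"
  by (induction J rule: finite_induct) (simp_all add: cf_const cp_conj del: of_bool_conj)

lemma cp_bex:
  assumes "finite J" "\<And>j. j \<in> J \<Longrightarrow> cp (P j)" shows "cp (\<lambda>x \<sigma>. \<exists>j\<in>J. P j x \<sigma>)"
proof -
  have "cp (\<lambda>x \<sigma>. \<forall>j\<in>J. \<not> P j x \<sigma>)" by (rule cp_ball[OF assms(1)]) (rule cp_not[OF assms(2)])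
  from cp_not[OF this] show ?thesis by simp
qed

lemma cf_if: assumes "cp P" "cf A" "cf B" shows "cf (\<lambda>x \<sigma>. if P x \<sigma> then A x \<sigma> else B x \<sigma>)"
proof -
  have "cf (\<lambda>x \<sigma>. of_bool (P x \<sigma>) * A x \<sigma> + of_bool (\<not> P x \<sigma>) * B x \<sigma>)"
    by (intro cf_add cf_mult cp_not assms)
  moreover have "of_bool p * a + of_bool (\<not> p) * b = (if p then a else b)" for p and a b :: nat by simp
  ultimately show ?thesis by simp
qed

text \<open>For a positive divisor the quotient is the number of its positive multiples up to the
  dividend. The factor \<open>of_bool (0 < b)\<close> supplies the value 0 of division by
  zero.\<close>

lemma cf_div: assumes "cf A" "cf B" shows "cf (\<lambda>x \<sigma>. A x \<sigma> div B x \<sigma>)"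
proof -
  have "cf (\<lambda>x \<sigma>. of_bool (0 < \<sigma> 1) * (\<Sum>v<\<sigma> 0. of_bool ((v + 1) * \<sigma> 1 \<le> \<sigma> 0)))"
    by (intro cf_mult cp_less cf_const cf_var cf_sum cp_le cf_add)
  moreover have "of_bool (0 < b) * (\<Sum>v<a. of_bool ((v + 1) * b \<le> a)) = a div b" for a b :: nat
  proof (cases "b = 0")
    case False
    have "{v. v < a \<and> (v + 1) * b \<le> a} = {..<a div b}"
    proof (rule set_eqI)
      fix v
      have "(v + 1) * b \<le> a \<longleftrightarrow> v < a div b" using False less_eq_div_iff_mult_less_eq[of b "v + 1" a] by auto
      moreover have "v < a div b \<Longrightarrow> v < a" using div_le_dividend[of a b] by linarith
      ultimately show "v \<in> {v. v < a \<and> (v + 1) * b \<le> a} \<longleftrightarrow> v \<in> {..<a div b}" by auto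
    qed
    moreover have "(\<Sum>v<a. of_bool ((v + 1) * b \<le> a) :: nat) = card {v. v < a \<and> (v + 1) * b \<le> a}"
      by (simp add: of_bool_def sum.If_cases Collect_conj_eq lessThan_def)
    ultimately show ?thesis using False by simp
  qed simp
  ultimately have "cf (\<lambda>x \<sigma>. \<sigma> 0 div \<sigma> 1)" by simp
  from cf_comp2[OF this assms] show ?thesis .
qed

lemma cf_mod: assumes "cf A" "cf B" shows "cf (\<lambda>x \<sigma>. A x \<sigma> mod B x \<sigma>)"
  using cf_sub[OF assms(1) cf_mult[OF cf_div[OF assms] assms(2)]] by (simp add: modulo_nat_def)

lemma cf_power: "cf A \<Longrightarrow> cf (\<lambda>x \<sigma>. A x \<sigma> ^ k)"
  by (induction k) (simp_all add: cf_const[of 1, simplified] cf_mult)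

lemma cf_Suc: "cf A \<Longrightarrow> cf (\<lambda>x \<sigma>. Suc (A x \<sigma>))"
  using cf_add[of A "\<lambda>_ _. 1"] cf_const[of 1] by simp

section \<open>Programs that emit output\<close>

lemma pe_nil: "pe (\<lambda>x \<sigma>. [])"
proof (rule peI)
  fix \<rho> :: "nat \<Rightarrow> nat" and b assume r: "\<And>i. \<rho> i < b"
  have m: "rl x SKIP 1 s out s (out @ [])" for x s out using rl_basic(1)[of 1] by simp
  show "\<exists>c p. emits (\<lambda>x \<sigma>. []) \<rho> b c p"
    by (rule emitsI[where \<rho> = \<rho> and b = b and P = "\<lambda>x \<sigma>. []", OF _ m]) (rule pb_const)
qed

lemma pe_append: assumes P: "pe P" and Q: "pe Q" shows "pe (\<lambda>x \<sigma>. P x \<sigma> @ Q x \<sigma>)"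
proof (rule peI)
  fix \<rho> :: "nat \<Rightarrow> nat" and b assume r: "\<And>i. \<rho> i < b"
  obtain c p where p: "pb p" and c: "\<And>x s out B. bnd x (\<lambda>i. s (\<rho> i)) B \<Longrightarrow> clean b s \<Longrightarrow>
     rl x c (p B) s out s (out @ P x (\<lambda>i. s (\<rho> i)))"
    by (rule pe_prog[where \<rho> = \<rho> and b = b, OF P r]; rule that; assumption)
  obtain c' p' where p': "pb p'" and c': "\<And>x s out B. bnd x (\<lambda>i. s (\<rho> i)) B \<Longrightarrow> clean b s \<Longrightarrow>
     rl x c' (p' B) s out s (out @ Q x (\<lambda>i. s (\<rho> i)))"
    by (rule pe_prog[where \<rho> = \<rho> and b = b, OF Q r]; rule that; assumption)
  have m: "rl x (SEQ c c') (p B + p' B + 1) s out s (out @ (P x (\<lambda>i. s (\<rho> i)) @ Q x (\<lambda>i. s (\<rho> i))))"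
    if "bnd x (\<lambda>i. s (\<rho> i)) B" "clean b s" for x s out B
    unfolding append_assoc[symmetric] by (rule rl_SEQ[OF c[OF that] c'[OF that] order_refl])
  show "\<exists>c p. emits (\<lambda>x \<sigma>. P x \<sigma> @ Q x \<sigma>) \<rho> b c p"
    by (rule emitsI[where \<rho> = \<rho> and b = b and P = "\<lambda>x \<sigma>. P x \<sigma> @ Q x \<sigma>", OF _ m])
      (intro pb_intros | fact)+
qed

lemma pe_for:
  assumes G: "cf G" and P: "pe (\<lambda>x \<tau>. P x (\<lambda>i. \<tau> (Suc i)) (\<tau> 0))"
  shows "pe (\<lambda>x \<sigma>. concat (map (\<lambda>v. P x \<sigma> v) [0..<G x \<sigma>]))"
proof (rule peI)
  obtain g where g: "pb g" "\<And>x \<sigma> B. bnd x \<sigma> B \<Longrightarrow> G x \<sigma> \<le> g B" using cf_bound[OF G] by blast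
  fix \<rho> :: "nat \<Rightarrow> nat" and b assume r: "\<And>i. \<rho> i < b"
  define \<rho>' where "\<rho>' = case_nat (Suc b) \<rho>"
  have r': "\<rho>' i < Suc (Suc b)" for i using r[of "i - 1"] by (auto simp: \<rho>'_def less_SucI split: nat.split)
  obtain c p where p: "pb p" and c: "\<And>x s out B s'. bnd x (\<lambda>i. s (\<rho> i)) B \<Longrightarrow> clean b s \<Longrightarrow>
    s' = s(b := G x (\<lambda>i. s (\<rho> i))) \<Longrightarrow> rl x c (p B) s out s' out"
    by (rule cf_prog[where \<rho> = \<rho> and b = b, OF G r]; rule that; assumption)
  obtain c' p' where p': "pb p'" and c': "\<And>x s out B. bnd x (\<lambda>i. s (\<rho>' i)) B \<Longrightarrow> clean (Suc (Suc b)) s \<Longrightarrow>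
    rl x c' (p' B) s out s (out @ P x (\<lambda>i. s (\<rho>' (Suc i))) (s (\<rho>' 0)))"
    by (rule pe_prog[where \<rho> = \<rho>' and b = "Suc (Suc b)", OF P r']; rule that; assumption)
  have pp': "pb (\<lambda>B. p' (B + g B))" by (rule pb_comp[OF p']) (intro pb_intros | rule pb_id | fact)+
  let ?b1 = "Suc b" and ?b2 = "Suc (Suc b)"
  let ?body = "SEQ c' (SEQ (INC ?b1) (DEC b))"
  let ?m = "\<lambda>B. p' (B + g B) + (1 + 1 + 1) + 1"
  have m: "rl x (SEQ c (SEQ (WH (TZ b) ?body) (CLR ?b1)))
      (p B + ((g B * (?m B + 1) + 1) + (2 * g B + 1) + 1) + 1)
      s out s (out @ concat (map (P x (\<lambda>i. s (\<rho> i))) [0..<G x (\<lambda>i. s (\<rho> i))]))"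
    if hy: "bnd x (\<lambda>i. s (\<rho> i)) B" "clean b s" for x s out B
  proof -
    define \<sigma> where "\<sigma> = (\<lambda>i. s (\<rho> i))"
    define n where "n = G x \<sigma>"
    define A where "A v = out @ concat (map (P x \<sigma>) [0..<v])" for v
    define S where "S v = s(b := n - v, ?b1 := v)" for v
    have hy1: "bnd x \<sigma> B" using hy(1) by (simp add: \<sigma>_def)
    have nb: "\<rho> i \<noteq> b" "\<rho> i \<noteq> ?b1" for i using r[of i] by simp_all
    have z: "s b = 0" "s ?b1 = 0" using hy(2) by (simp_all add: clean_def)
    have n: "n \<le> g B" unfolding n_def by (rule g(2)[OF hy1])
    have 1: "rl x c (p B) s out (S 0) out" by (rule c[OF hy]) (use z in \<open>auto simp: S_def n_def \<sigma>_def fun_eq_iff\<close>)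
    have 2: "rl x (WH (TZ b) ?body) (g B * (?m B + 1) + 1) (S 0) out (S n) (A n)"
    proof (rule rl_WH[where n = n and m = "?m B" and S = S and O' = A])
      show "n * (?m B + 1) + 1 \<le> g B * (?m B + 1) + 1" using n by (intro add_mono mult_le_mono1) auto
      show "tst x (TZ b) (S n)" by (simp add: S_def)
      show "\<not> tst x (TZ b) (S i)" if "i < n" for i using that by (simp add: S_def)
      fix i assume i: "i < n"
      have e0: "S i (\<rho>' 0) = i" by (simp add: S_def \<rho>'_def)
      have e1: "(\<lambda>j. S i (\<rho>' (Suc j))) = \<sigma>" by (simp add: S_def \<rho>'_def \<sigma>_def nb)
      have e: "(\<lambda>j. S i (\<rho>' j)) = case_nat i \<sigma>"
        using e0 e1 by (auto simp: fun_eq_iff split: nat.split)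
      have "rl x c' (p' (B + g B)) (S i) (A i) (S i) (A i @ P x (\<lambda>j. S i (\<rho>' (Suc j))) (S i (\<rho>' 0)))"
      proof (rule c')
        show "bnd x (\<lambda>j. S i (\<rho>' j)) (B + g B)" unfolding e by (rule bnd_cons[OF hy1]) (use i n in simp)
        show "clean ?b2 (S i)" using hy(2) by (auto simp: clean_def S_def)
      qed
      then have a: "rl x c' (p' (B + g B)) (S i) (A i) (S i) (A (Suc i))" unfolding e0 e1 by (simp add: A_def)
      have e': "rl x (INC ?b1) 1 (S i) (A (Suc i)) ((S i)(?b1 := Suc i)) (A (Suc i))"
        using rl_basic(2)[of 1 x ?b1 "S i"] by (simp add: S_def)
      have f: "rl x (DEC b) 1 ((S i)(?b1 := Suc i)) (A (Suc i)) (S (Suc i)) (A (Suc i))"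
      proof -
        have "((S i)(?b1 := Suc i))(b := (n - i) - 1) = S (Suc i)"
          by (auto simp: S_def fun_eq_iff)
        then show ?thesis using rl_basic(3)[of 1 x b "(S i)(?b1 := Suc i)"] by (simp add: S_def)
      qed
      show "rl x ?body (?m B) (S i) (A i) (S (Suc i)) (A (Suc i))"
        by (rule rl_SEQ[OF a rl_SEQ[OF e' f order_refl] order_refl])
    qed (simp_all add: A_def)
    have 3: "rl x (CLR ?b1) (2 * g B + 1) (S n) (A n) s (A n)"
      by (rule rl_CLR) (use n z in \<open>auto simp: S_def fun_eq_iff\<close>)
    show ?thesis using rl_SEQ[OF 1 rl_SEQ[OF 2 3 order_refl] order_refl]
      unfolding A_def n_def \<sigma>_def .
  qed
  show "\<exists>c p. emits (\<lambda>x \<sigma>. concat (map (\<lambda>v. P x \<sigma> v) [0..<G x \<sigma>])) \<rho> b c p"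
    by (rule emitsI[where \<rho> = \<rho> and b = b and P = "\<lambda>x \<sigma>. concat (map (\<lambda>v. P x \<sigma> v) [0..<G x \<sigma>])", OF _ m])
      (intro pb_intros | rule pb_id | fact)+
qed

declare nat_bits.simps [simp del]

text \<open>The number sits in a unary counter but is emitted in binary: the loop emits the lowest
  bit twice and halves the counter. As the value is polynomially bounded, a crude linear bound on
  the number of rounds suffices.\<close>

lemma pe_nat: assumes F: "cf F" shows "pe (\<lambda>x \<sigma>. enc_nat (F x \<sigma>))"
proof (rule peI)
  obtain f where f: "pb f" "\<And>x \<sigma> B. bnd x \<sigma> B \<Longrightarrow> F x \<sigma> \<le> f B" using cf_bound[OF F] by blast
  fix \<rho> :: "nat \<Rightarrow> nat" and b assume r: "\<And>i. \<rho> i < b"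
  obtain c p where p: "pb p" and c: "\<And>x s out B s'. bnd x (\<lambda>i. s (\<rho> i)) B \<Longrightarrow> clean b s \<Longrightarrow>
    s' = s(b := F x (\<lambda>i. s (\<rho> i))) \<Longrightarrow> rl x c (p B) s out s' out"
    by (rule cf_prog[where \<rho> = \<rho> and b = b, OF F r]; rule that; assumption)
  have D: "cf (\<lambda>x \<sigma>. \<sigma> 0 div 2)" and M: "cf (\<lambda>x \<sigma>. \<sigma> 0 mod 2)" by (intro cf_div cf_mod cf_var cf_const)+
  let ?b1 = "Suc b" and ?b2 = "Suc (Suc b)"
  obtain cd pd where pd: "pb pd" and cd: "\<And>x s out B s'. bnd x (\<lambda>i. s b) B \<Longrightarrow> clean ?b1 s \<Longrightarrow>
    s' = s(?b1 := s b div 2) \<Longrightarrow> rl x cd (pd B) s out s' out"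
    by (rule cf_prog[where \<rho> = "\<lambda>_. b" and b = ?b1, OF D], rule lessI, rule that; assumption)
  obtain cm pm where pm: "pb pm" and cm: "\<And>x s out B s'. bnd x (\<lambda>i. s b) B \<Longrightarrow> clean ?b2 s \<Longrightarrow>
    s' = s(?b2 := s b mod 2) \<Longrightarrow> rl x cm (pm B) s out s' out"
    by (rule cf_prog[where \<rho> = "\<lambda>_. b" and b = ?b2, OF M], rule less_SucI[OF lessI], rule that; assumption)
  let ?em = "IF (TZ ?b2) (SEQ (EMIT False) (EMIT False)) (SEQ (DEC ?b2) (SEQ (EMIT True) (EMIT True)))"
  let ?body = "SEQ cd (SEQ cm (SEQ ?em (SEQ (CLR b) (MOV ?b1 b))))"
  let ?m = "\<lambda>B. pd B + (pm B + (6 + ((2 * B + 1) + (4 * B + 1) + 1) + 1) + 1) + 1"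
  let ?dbl = "\<lambda>n. concat (map (\<lambda>b. [b, b]) (nat_bits n))"
  have loop: "rl x (WH (TZ b) ?body) (n * (?m B + 1) + 1) s out (s(b := 0)) (out @ ?dbl n)"
    if "s b = n" "clean ?b1 s" "n \<le> B" "length x \<le> B" for x n s out B
    using that
  proof (induction n arbitrary: s out rule: less_induct)
    case (less n)
    show ?case
    proof (cases "n = 0")
      case True
      then have "?dbl n = []" by (subst nat_bits.simps) simp
      moreover have "s(b := 0) = s" using True less.prems(1) by auto
      ultimately show ?thesis using True less.prems(1) by (simp add: rl_WH_stop)
    next
      case False
      let ?s1 = "s(?b1 := n div 2)" and ?s2 = "s(?b1 := n div 2, ?b2 := n mod 2)"
      let ?s4 = "s(b := 0, ?b1 := n div 2)" and ?s5 = "s(b := n div 2)"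
      let ?o = "out @ [odd n, odd n]"
      have z: "s ?b1 = 0" "s ?b2 = 0" using less.prems(2) by (simp_all add: clean_def)
      have bn: "bnd x (\<lambda>i. n) B" using less.prems by (simp add: bnd_def)
      have 1: "rl x cd (pd B) s out ?s1 out" by (rule cd) (use bn less.prems in auto)
      have 2: "rl x cm (pm B) ?s1 out ?s2 out"
        by (rule cm) (use bn less.prems clean_upd[OF less.prems(2)] in auto)
      have 3: "rl x ?em 6 ?s2 out ?s1 ?o"
      proof (rule rl_IF)
        assume "tst x (TZ ?b2) ?s2"
        then have "even n" "?s2 = ?s1" using z by (auto simp: fun_eq_iff even_iff_mod_2_eq_zero)
        moreover have "rl x (SEQ (EMIT False) (EMIT False)) 5 ?s1 out ?s1 ((out @ [False]) @ [False])"
          by (rule rl_SEQ[OF rl_basic(4)[of 1] rl_basic(4)[of 1]]) auto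
        ultimately show "rl x (SEQ (EMIT False) (EMIT False)) 5 ?s2 out ?s1 ?o" by simp
      next
        assume "\<not> tst x (TZ ?b2) ?s2"
        then have o: "odd n" by (auto simp: odd_iff_mod_2_eq_one)
        have "?s2(?b2 := ?s2 ?b2 - 1) = ?s1" using z o by (auto simp: fun_eq_iff odd_iff_mod_2_eq_one)
        then have d: "rl x (DEC ?b2) 1 ?s2 out ?s1 out" using rl_basic(3)[of 1 x ?b2 ?s2 out] by simp
        have "rl x (SEQ (DEC ?b2) (SEQ (EMIT True) (EMIT True))) 5 ?s2 out ?s1 ((out @ [True]) @ [True])"
          by (rule rl_SEQ[OF d rl_SEQ[OF rl_basic(4)[of 1] rl_basic(4)[of 1], where k = 3]]) auto
        then show "rl x (SEQ (DEC ?b2) (SEQ (EMIT True) (EMIT True))) 5 ?s2 out ?s1 ?o" using o by simp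
      qed simp
      have 4: "rl x (CLR b) (2 * B + 1) ?s1 ?o ?s4 ?o"
        by (rule rl_CLR) (use less.prems in \<open>auto simp: fun_eq_iff\<close>)
      have 5: "rl x (MOV ?b1 b) (4 * B + 1) ?s4 ?o ?s5 ?o"
        by (rule rl_MOV) (use less.prems(3) z in \<open>auto simp: fun_eq_iff\<close>)
      have body: "rl x ?body (?m B) s out ?s5 ?o"
        by (rule rl_SEQ[OF 1 rl_SEQ[OF 2 rl_SEQ[OF 3 rl_SEQ[OF 4 5 order_refl] order_refl] order_refl] order_refl])
      have rest: "rl x (WH (TZ b) ?body) (n div 2 * (?m B + 1) + 1) ?s5 ?o (?s5(b := 0)) (?o @ ?dbl (n div 2))"
      proof (rule less.IH)
        show "clean ?b1 ?s5" using less.prems(2) by (simp add: clean_def)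
        show "n div 2 \<le> B" using less.prems(3) by (simp add: div_le_dividend le_trans[of "n div 2" n])
      qed (use False less.prems in auto)
      have "?dbl n = [odd n, odd n] @ ?dbl (n div 2)" using False by (subst nat_bits.simps) simp
      then have o: "?o @ ?dbl (n div 2) = out @ ?dbl n" by simp
      have s: "?s5(b := 0) = s(b := 0)" by simp
      have "Suc (n div 2) \<le> n" using False by simp
      then have "Suc (n div 2) * (?m B + 1) \<le> n * (?m B + 1)" by (rule mult_le_mono1)
      then have t: "?m B + (n div 2 * (?m B + 1) + 1) + 1 \<le> n * (?m B + 1) + 1" by simp
      have nt: "\<not> tst x (TZ b) s" using False less.prems(1) by simp
      show ?thesis using rl_WH_go[OF nt body rest t] unfolding o s .
    qed
  qed
  have m: "rl x (SEQ c (SEQ (WH (TZ b) ?body) (SEQ (EMIT True) (EMIT False))))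
      (p B + ((f B * (?m (B + f B) + 1) + 1) + (1 + 1 + 1) + 1) + 1) s out s (out @ enc_nat (F x (\<lambda>i. s (\<rho> i))))"
    if hy: "bnd x (\<lambda>i. s (\<rho> i)) B" "clean b s" for x s out B
  proof -
    define n where "n = F x (\<lambda>i. s (\<rho> i))"
    have n: "n \<le> f B" unfolding n_def by (rule f(2)[OF hy(1)])
    have 1: "rl x c (p B) s out (s(b := n)) out" by (rule c[OF hy]) (simp add: n_def)
    have "rl x (WH (TZ b) ?body) (n * (?m (B + f B) + 1) + 1) (s(b := n)) out ((s(b := n))(b := 0)) (out @ ?dbl n)"
      by (rule loop) (use n hy clean_upd in \<open>auto simp: bnd_def\<close>)
    moreover have "(s(b := n))(b := 0) = s" using hy(2) by (auto simp: clean_def)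
    ultimately have "rl x (WH (TZ b) ?body) (n * (?m (B + f B) + 1) + 1) (s(b := n)) out s (out @ ?dbl n)" by simp
    then have 2: "rl x (WH (TZ b) ?body) (f B * (?m (B + f B) + 1) + 1) (s(b := n)) out s (out @ ?dbl n)"
      by (rule rl_mono) (use n in \<open>intro add_mono mult_le_mono1, auto\<close>)
    have e1: "rl x (EMIT True) 1 s (out @ ?dbl n) s ((out @ ?dbl n) @ [True])" by (rule rl_basic(4)) simp
    have e2: "rl x (EMIT False) 1 s ((out @ ?dbl n) @ [True]) s (((out @ ?dbl n) @ [True]) @ [False])" by (rule rl_basic(4)) simp
    have "((out @ ?dbl n) @ [True]) @ [False] = out @ enc_nat n" by (simp add: enc_nat_def)
    then show ?thesis using rl_SEQ[OF 1 rl_SEQ[OF 2 rl_SEQ[OF e1 e2 order_refl] order_refl] order_refl]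
      unfolding n_def by simp
  qed
  have pp: "pb (\<lambda>B. pd (B + f B))" "pb (\<lambda>B. pm (B + f B))"
    by (rule pb_comp[OF pd] pb_comp[OF pm], (intro pb_intros | rule pb_id | fact)+)+
  show "\<exists>c p. emits (\<lambda>x \<sigma>. enc_nat (F x \<sigma>)) \<rho> b c p"
    by (rule emitsI[where \<rho> = \<rho> and b = b and P = "\<lambda>x \<sigma>. enc_nat (F x \<sigma>)", OF _ m])
      (intro pb_intros | rule pb_id | fact)+
qed

theorem poly_time_pe:
  assumes P: "pe P" shows "poly_time_computable (\<lambda>x. P x (\<lambda>_. 0))"
proof -
  obtain c p where p: "pb p" and c: "\<And>x s out B. bnd x (\<lambda>i. s (0::nat)) B \<Longrightarrow> clean 1 s \<Longrightarrow>
     rl x c (p B) s out s (out @ P x (\<lambda>i. s (0::nat)))"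
    by (rule pe_prog[where \<rho> = "\<lambda>_. 0" and b = 1, OF P], rule zero_less_one, rule that; assumption)
  show ?thesis
  proof (rule poly_time_com[OF p])
    fix x
    have "rl x c (p (length x)) (\<lambda>_. 0) [] (\<lambda>_. 0) ([] @ P x (\<lambda>_. 0))"
      by (rule c) (auto simp: bnd_def clean_def)
    then show "\<exists>t s'. t \<le> p (length x) \<and> runs x c (\<lambda>_. 0) [] t s' (P x (\<lambda>_. 0))"
      unfolding rl_def by auto
  qed
qed

section \<open>The tableau of a Turing machine\<close>

text \<open>A tableau cell holds a tape symbol \<open>a\<close> and possibly the head in state \<open>p\<close>, coded as \<open>a\<close> or
  \<open>a + (p + 1) * tm_syms M\<close>; the halting state 1 gives the quotient 2.\<close>

definition code :: "tm \<Rightarrow> config \<Rightarrow> int \<Rightarrow> nat" where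
  "code M cfg i = (case cfg of (p, tape, h) \<Rightarrow> tape i + tm_syms M * (if h = i then Suc p else 0))"

text \<open>The code of the state in which the head leaves this cell in direction \<open>e\<close>,
  or 0. A halted head does not leave.\<close>

definition arr :: "tm \<Rightarrow> int \<Rightarrow> nat \<Rightarrow> nat" where
  "arr M e c = (let p = c div tm_syms M in if p = 0 \<or> p = 2 then 0 else
     case tm_delta M (p - 1) (c mod tm_syms M) of (q', a', d) \<Rightarrow> if d = e then Suc q' else 0)"

text \<open>In a genuine configuration at most one neighbour sends the head, so the sum of the
  arrivals is simply the one that occurs.\<close>

definition nxt :: "tm \<Rightarrow> nat \<Rightarrow> nat \<Rightarrow> nat \<Rightarrow> nat" where
  "nxt M l m r = (let p = m div tm_syms M; a = m mod tm_syms M in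
     if p = 0 then a + tm_syms M * (arr M 1 l + arr M (-1) r) else if p = 2 then m
     else fst (snd (tm_delta M (p - 1) a)) + tm_syms M * arr M 0 m)"

definition wf_config :: "tm \<Rightarrow> config \<Rightarrow> bool" where
  "wf_config M cfg \<longleftrightarrow> fst cfg < tm_states M \<and> (\<forall>i. fst (snd cfg) i < tm_syms M)"

lemma code_div: "wf_config M (p, tape, h) \<Longrightarrow> code M (p, tape, h) i div tm_syms M = (if h = i then Suc p else 0)"
proof -
  assume w: "wf_config M (p, tape, h)"
  then have "tape i < tm_syms M" by (simp add: wf_config_def)
  then have "(tape i + tm_syms M * n) div tm_syms M = n" for n by (subst div_mult_self2) auto
  then show ?thesis by (simp only: code_def prod.case)
qed

lemma code_mod: "wf_config M (p, tape, h) \<Longrightarrow> code M (p, tape, h) i mod tm_syms M = tape i"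
  by (simp add: code_def wf_config_def)

lemma arr_code:
  assumes "wf_config M (p, tape, h)"
  shows "arr M e (code M (p, tape, h) i) =
    (if h = i \<and> p \<noteq> 1 \<and> snd (snd (tm_delta M p (tape h))) = e then Suc (fst (tm_delta M p (tape h))) else 0)"
  unfolding arr_def code_div[OF assms] code_mod[OF assms] Let_def by (auto split: prod.split)

lemma wf_delta:
  assumes "wf_tm M" "p < tm_states M" "a < tm_syms M" "tm_delta M p a = (q', a', d)"
  shows "q' < tm_states M" "a' < tm_syms M" "d = -1 \<or> d = 0 \<or> d = 1"
  using assms unfolding wf_tm_def by fastforce+

lemma code_step:
  assumes M: "wf_tm M" and c: "wf_config M cfg"
  shows "code M (tm_step M cfg) i = nxt M (code M cfg (i - 1)) (code M cfg i) (code M cfg (i + 1))"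
proof -
  obtain p tape h where cfg: "cfg = (p, tape, h)" by (cases cfg) auto
  have w: "wf_config M (p, tape, h)" using c cfg by simp
  obtain q' a' d where dl: "tm_delta M p (tape h) = (q', a', d)" by (cases "tm_delta M p (tape h)") auto
  have "p < tm_states M" "tape h < tm_syms M" using w by (simp_all add: wf_config_def)
  then have d: "d = -1 \<or> d = 0 \<or> d = 1" using wf_delta[OF M _ _ dl] by blast
  show ?thesis
    unfolding cfg nxt_def code_div[OF w] code_mod[OF w] arr_code[OF w] Let_def
    using d dl by (auto simp: tm_step_def code_def)
qed

lemma wf_step: "wf_tm M \<Longrightarrow> wf_config M cfg \<Longrightarrow> wf_config M (tm_step M cfg)"
proof -
  assume M: "wf_tm M" and c: "wf_config M cfg"
  obtain p tape h where cfg: "cfg = (p, tape, h)" by (cases cfg) auto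
  obtain q' a' d where dl: "tm_delta M p (tape h) = (q', a', d)" by (cases "tm_delta M p (tape h)") auto
  have "p < tm_states M" "tape h < tm_syms M" using c cfg by (simp_all add: wf_config_def)
  from wf_delta[OF M this dl] show ?thesis using c unfolding cfg by (simp add: tm_step_def dl wf_config_def)
qed

lemma wf_run: "wf_tm M \<Longrightarrow> wf_config M cfg \<Longrightarrow> wf_config M (tm_run M t cfg)"
  unfolding tm_run_def by (induction t) (simp_all add: wf_step)

lemma head_run:
  assumes M: "wf_tm M" and c: "wf_config M cfg" and h: "snd (snd cfg) = 0"
  shows "\<bar>snd (snd (tm_run M t cfg))\<bar> \<le> int t"
proof (induction t)
  case 0
  then show ?case using h by (simp add: tm_run_def)
next
  case (Suc t)
  obtain p tape h where cfg: "tm_run M t cfg = (p, tape, h)" by (cases "tm_run M t cfg") auto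
  obtain q' a' d where dl: "tm_delta M p (tape h) = (q', a', d)" by (cases "tm_delta M p (tape h)") auto
  have "p < tm_states M" "tape h < tm_syms M" using wf_run[OF M c, of t] cfg by (simp_all add: wf_config_def)
  from wf_delta(3)[OF M this dl] have "\<bar>snd (snd (tm_step M (tm_run M t cfg)))\<bar> \<le> int (Suc t)"
    using Suc cfg by (auto simp: tm_step_def dl)
  then show ?case by (simp add: tm_run_def)
qed

text \<open>Rows cover the positions from \<open>- (T + 1)\<close> to \<open>T + 1\<close>. Within
  \<open>T\<close> steps the head does not reach the two border columns.\<close>

definition wid :: "nat \<Rightarrow> nat" where "wid T = 2 * T + 3"

definition cv :: "tm \<Rightarrow> config \<Rightarrow> nat \<Rightarrow> nat \<Rightarrow> nat" where
  "cv M cfg T v = code M (tm_run M (v div wid T) cfg) (int (v mod wid T) - int (T + 1))"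

lemma cv_row: "z < wid T \<Longrightarrow> cv M cfg T (t * wid T + z) = code M (tm_run M t cfg) (int z - int (T + 1))"
  by (simp add: cv_def wid_def)

lemma arr_far:
  assumes M: "wf_tm M" and c: "wf_config M cfg" and h: "snd (snd cfg) = 0" and i: "int t < \<bar>i\<bar>"
  shows "arr M e (code M (tm_run M t cfg) i) = 0"
proof -
  obtain p tape h where cfg: "tm_run M t cfg = (p, tape, h)" by (cases "tm_run M t cfg") auto
  have w: "wf_config M (p, tape, h)" using wf_run[OF M c, of t] cfg by simp
  show ?thesis unfolding cfg arr_code[OF w] using head_run[OF M c h, of t] cfg i by auto
qed

lemma nxt_cong: "arr M 1 l = arr M 1 l' \<Longrightarrow> arr M (-1) r = arr M (-1) r' \<Longrightarrow> nxt M l m r = nxt M l' m r'"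
  by (simp only: nxt_def)

text \<open>Left and right neighbours are taken in the flattened tableau; at the ends of a row, where
  this crosses into another row, no head can be nearby.\<close>

lemma cv_step:
  assumes M: "wf_tm M" and c: "wf_config M cfg" and h: "snd (snd cfg) = 0" and v: "v + wid T < (T + 1) * wid T"
  shows "cv M cfg T (v + wid T) = nxt M (cv M cfg T (v - 1)) (cv M cfg T v) (cv M cfg T (v + 1))"
proof -
  define t z where "t = v div wid T" and "z = v mod wid T"
  have vz: "v = t * wid T + z" by (simp only: t_def z_def div_mult_mod_eq)
  have z: "z < wid T" by (simp add: z_def wid_def)
  have "t * wid T < T * wid T" using v unfolding vz add_mult_distrib by linarith
  then have t: "t < T" by (simp only: mult_less_cancel2)
  let ?cf = "tm_run M t cfg" and ?i = "int z - int (T + 1)"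
  have "cv M cfg T (v + wid T) = code M (tm_run M (Suc t) cfg) ?i"
    using cv_row[OF z, of M cfg "Suc t"] by (simp add: vz algebra_simps)
  also have "\<dots> = nxt M (code M ?cf (?i - 1)) (code M ?cf ?i) (code M ?cf (?i + 1))"
    using code_step[OF M wf_run[OF M c], of t ?i] by (simp add: tm_run_def)
  also have "\<dots> = nxt M (cv M cfg T (v - 1)) (cv M cfg T v) (cv M cfg T (v + 1))"
  proof -
    have m: "cv M cfg T v = code M ?cf ?i" unfolding vz by (rule cv_row[OF z])
    have l: "arr M 1 (code M ?cf (?i - 1)) = arr M 1 (cv M cfg T (v - 1))"
    proof (cases z)
      case 0
      have 1: "arr M 1 (code M ?cf (?i - 1)) = 0" by (rule arr_far[OF M c h]) (use 0 t in simp)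
      show ?thesis
      proof (cases t)
        \<comment> \<open>Here \<open>v\<close> is 0 and the truncated \<open>v - 1\<close> is the
          same border cell, which holds no head either.\<close>
        case t0: 0
        have "cv M cfg T (v - 1) = code M ?cf (- int (T + 1))" using cv_row[of 0 T M cfg 0] 0 t0 by (simp add: vz wid_def)
        then show ?thesis using 1 arr_far[OF M c h, of t "- int (T + 1)"] t by simp
      next
        case (Suc t')
        have "v - 1 = t' * wid T + (wid T - 1)" using 0 Suc by (simp add: vz wid_def)
        then have "cv M cfg T (v - 1) = code M (tm_run M t' cfg) (int (wid T - 1) - int (T + 1))"
          using cv_row[of "wid T - 1" T] by (simp add: wid_def)
        then show ?thesis using 1 arr_far[OF M c h, of t' "int (wid T - 1) - int (T + 1)"] t Suc by (simp add: wid_def)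
      qed
    next
      case (Suc z')
      have "cv M cfg T (v - 1) = code M ?cf (int z' - int (T + 1))" using cv_row[of z' T] z Suc by (simp add: vz)
      moreover have "?i - 1 = int z' - int (T + 1)" using Suc by simp
      ultimately show ?thesis by (simp only:)
    qed
    have r: "arr M (-1) (code M ?cf (?i + 1)) = arr M (-1) (cv M cfg T (v + 1))"
    proof (cases "Suc z < wid T")
      case True
      have "cv M cfg T (v + 1) = code M ?cf (int (Suc z) - int (T + 1))" using cv_row[OF True, of M cfg t] by (simp add: vz)
      moreover have "?i + 1 = int (Suc z) - int (T + 1)" by simp
      ultimately show ?thesis by simp
    next
      case False
      then have zz: "z = 2 * T + 2" using z by (simp add: wid_def)
      have 1: "arr M (-1) (code M ?cf (?i + 1)) = 0" by (rule arr_far[OF M c h]) (use zz t in simp)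
      have "v + 1 = Suc t * wid T + 0" using zz by (simp add: vz wid_def)
      then have "cv M cfg T (v + 1) = code M (tm_run M (Suc t) cfg) (int 0 - int (T + 1))"
        using cv_row[of 0 T M cfg "Suc t"] by (simp only: wid_def)
      then show ?thesis using 1 arr_far[OF M c h, of "Suc t" "int 0 - int (T + 1)"] t by simp
    qed
    show ?thesis unfolding m by (rule nxt_cong[OF l r])
  qed
  finally show ?thesis .
qed

lemma cv_unique:
  assumes M: "wf_tm M" and c: "wf_config M cfg" and h: "snd (snd cfg) = 0"
    and A0: "\<And>v. v < wid T \<Longrightarrow> A v = cv M cfg T v"
    and A1: "\<And>v. v + wid T < (T + 1) * wid T \<Longrightarrow> A (v + wid T) = nxt M (A (v - 1)) (A v) (A (v + 1))"
  shows "v < (T + 1) * wid T \<Longrightarrow> A v = cv M cfg T v"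
proof (induction v rule: less_induct)
  case (less v)
  show ?case
  proof (cases "v < wid T")
    case False
    define u where "u = v - wid T"
    have v: "v = u + wid T" using False by (simp add: u_def)
    have w: "wid T \<ge> 3" by (simp add: wid_def)
    have "A (u - 1) = cv M cfg T (u - 1)" "A u = cv M cfg T u" "A (u + 1) = cv M cfg T (u + 1)"
      by (rule less.IH; use v w less.prems in linarith)+
    then show ?thesis using A1[of u] cv_step[OF M c h, of u T] less.prems v by simp
  qed (rule A0)
qed

lemma code_less: "wf_config M cfg \<Longrightarrow> code M cfg i < tm_syms M * (tm_states M + 1)"
proof -
  assume w: "wf_config M cfg"
  obtain p tape h where cfg: "cfg = (p, tape, h)" by (cases cfg) auto
  let ?s = "if h = i then Suc p else 0"
  have "code M cfg i < tm_syms M * (?s + 1)" using w by (simp add: cfg code_def wf_config_def)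
  also have "\<dots> \<le> tm_syms M * (tm_states M + 1)" using w by (intro mult_le_mono2) (simp add: cfg wf_config_def)
  finally show ?thesis .
qed

text \<open>Column \<open>T + 1\<close> is the origin. From there the row spells out
  \<open>pair_enc\<close>: the doubled input, the separator with symbols 2 and 1, and a guessed
  witness, of which only the alphabet and the maximal length \<open>w\<close> are
  prescribed.\<close>

definition init_ok :: "tm \<Rightarrow> nat \<Rightarrow> nat \<Rightarrow> bool list \<Rightarrow> nat \<Rightarrow> nat \<Rightarrow> bool" where
  "init_ok M T w x v a \<longleftrightarrow> (if v = T + 1 then a div tm_syms M = 1 else a div tm_syms M = 0) \<and>
     (v < T + 1 \<longrightarrow> a mod tm_syms M = 0) \<and>
     (T + 1 \<le> v \<and> v < T + 1 + 2 * length x \<longrightarrow> a mod tm_syms M = inp x ((v - (T + 1)) div 2)) \<and>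
     (v = T + 1 + 2 * length x \<longrightarrow> a mod tm_syms M = 2) \<and>
     (v = T + 2 + 2 * length x \<longrightarrow> a mod tm_syms M = 1) \<and>
     (T + 3 + 2 * length x \<le> v \<longrightarrow> a mod tm_syms M \<le> 2) \<and>
     (T + 3 + 2 * length x + w \<le> v \<longrightarrow> a mod tm_syms M = 0)"

text \<open>Constraints are tested for all quadruples of cells, and the equations between the cell
  numbers pick out the relevant ones. The four cases concern the initial row, the witness (no symbol
  after a blank), the transition, and acceptance, which is the bit True at the origin of the last
  row.\<close>

definition bad :: "tm \<Rightarrow> nat \<Rightarrow> nat \<Rightarrow> bool list \<Rightarrow> nat \<Rightarrow> nat \<Rightarrow> nat \<Rightarrow> nat \<Rightarrow> nat \<Rightarrow> nat \<Rightarrow> nat \<Rightarrow> nat \<Rightarrow> bool" where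
  "bad M T w x v1 v2 v3 v4 a1 a2 a3 a4 \<longleftrightarrow>
     (v1 < wid T \<and> \<not> init_ok M T w x v1 a1) \<or>
     (T + 3 + 2 * length x \<le> v1 \<and> v2 = v1 + 1 \<and> v2 < wid T \<and> a1 = 0 \<and> a2 \<noteq> 0) \<or>
     (v2 = v1 + wid T \<and> v3 = v1 - 1 \<and> v4 = v1 + 1 \<and> a2 \<noteq> nxt M a3 a1 a4) \<or>
     (v1 = T * wid T + (T + 1) \<and> a1 mod tm_syms M \<noteq> 2)"

lemma inp_Cons: "inp (b # y) i = (case i of 0 \<Rightarrow> bit_sym b | Suc j \<Rightarrow> inp y j)"
  by (simp add: inp_def split: nat.split)

lemma inp_pair_enc:
  "inp (pair_enc x w) i = (if i < 2 * length x then inp x (i div 2) else if i = 2 * length x then 2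
     else if i = 2 * length x + 1 then 1 else inp w (i - (2 * length x + 2)))"
proof (induction x arbitrary: i)
  case Nil
  then show ?case by (auto simp: pair_enc_def inp_Cons bit_sym_def split: nat.split)
next
  case (Cons b x)
  have e: "pair_enc (b # x) w = b # b # pair_enc x w" by (simp add: pair_enc_def)
  consider "i = 0" | "i = 1" | j where "i = Suc (Suc j)" by (cases i; cases "i - 1") auto
  then show ?case
  proof cases
    case 3
    then show ?thesis using Cons[of j] by (simp add: e inp_Cons)
  qed (simp_all add: e inp_Cons)
qed

lemma wf_init: "wf_tm M \<Longrightarrow> wf_config M (tm_init y)"
  by (auto simp: wf_tm_def wf_config_def tm_init_def bit_sym_def)

lemma cv_init:
  assumes "v < wid T"
  shows "cv M (tm_init y) T v = (if v < T + 1 then 0 else inp y (v - (T + 1))) + tm_syms M * (if v = T + 1 then 1 else 0)"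
proof -
  have "cv M (tm_init y) T v = code M (tm_init y) (int v - int (T + 1))"
    using cv_row[OF assms, of M "tm_init y" 0] by (simp add: tm_run_def)
  moreover have "nat (int v - int (T + 1)) = v - (T + 1)" by linarith
  ultimately show ?thesis by (auto simp: code_def tm_init_def inp_def)
qed

lemma inp_le: "inp y i \<le> 2" by (simp add: inp_def bit_sym_def)

lemma init_ok_iff:
  assumes S: "3 \<le> tm_syms M" and T: "2 * length x + 2 + b \<le> T" and w: "length w \<le> b" and v: "v < wid T"
  shows "init_ok M T b x v (cv M (tm_init (pair_enc x w)) T v)"
proof -
  let ?a = "if v < T + 1 then 0 else inp (pair_enc x w) (v - (T + 1))"
  have a: "?a < tm_syms M" using inp_le[of "pair_enc x w" "v - (T + 1)"] S by simp
  have d: "cv M (tm_init (pair_enc x w)) T v div tm_syms M = (if v = T + 1 then 1 else 0)"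
    and m: "cv M (tm_init (pair_enc x w)) T v mod tm_syms M = ?a"
    unfolding cv_init[OF v] using a S by auto
  show ?thesis unfolding init_ok_def d m inp_pair_enc using inp_le w
    by (auto simp: inp_def[of w] bit_sym_def)
qed

text \<open>The first row of a correct assignment determines the witness and, by
  \<open>cv_unique\<close>, all further rows. The assumption on \<open>T\<close> makes the whole
  encoded pair fit into the row.\<close>

lemma tableau_iff:
  assumes M: "wf_tm M" and T: "2 * length x + 2 + b \<le> T"
  shows "(\<exists>A. (\<forall>v<(T + 1) * wid T. A v < tm_syms M * (tm_states M + 1)) \<and>
      (\<forall>v1<(T + 1) * wid T. \<forall>v2<(T + 1) * wid T. \<forall>v3<(T + 1) * wid T. \<forall>v4<(T + 1) * wid T.
         \<not> bad M T b x v1 v2 v3 v4 (A v1) (A v2) (A v3) (A v4))) \<longleftrightarrow>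
    (\<exists>w. length w \<le> b \<and> fst (snd (tm_run M T (tm_init (pair_enc x w)))) 0 = 2)"
    (is "(\<exists>A. ?P A) \<longleftrightarrow> ?R")
proof
  have S: "3 \<le> tm_syms M" using M by (simp add: wf_tm_def)
  have mid: "T * wid T + (T + 1) < (T + 1) * wid T" by (simp add: wid_def)
  have row: "wid T \<le> (T + 1) * wid T" by simp
  let ?L = "T + 3 + 2 * length x"
  have cmid: "cv M (tm_init y) T (T * wid T + (T + 1)) mod tm_syms M = fst (snd (tm_run M T (tm_init y))) 0" for y
  proof -
    have w: "wf_config M (tm_run M T (tm_init y))" by (rule wf_run[OF M wf_init[OF M]])
    obtain p tape h where e: "tm_run M T (tm_init y) = (p, tape, h)" by (cases "tm_run M T (tm_init y)") auto
    have "T + 1 < wid T" by (simp add: wid_def)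
    then have "cv M (tm_init y) T (T * wid T + (T + 1)) = code M (p, tape, h) 0"
      using cv_row[of "T + 1" T M "tm_init y" T] e by simp
    then show ?thesis using code_mod[of M p tape h 0] w e by simp
  qed
  {
    assume ?R
    then obtain w where w: "length w \<le> b" "fst (snd (tm_run M T (tm_init (pair_enc x w)))) 0 = 2" by blast
    let ?cfg = "tm_init (pair_enc x w)"
    let ?A = "cv M ?cfg T"
    have h: "snd (snd ?cfg) = 0" by (simp add: tm_init_def)
    show "\<exists>A. ?P A"
    proof (intro exI[of _ ?A] conjI allI impI)
      show "?A v < tm_syms M * (tm_states M + 1)" for v
        unfolding cv_def by (rule code_less[OF wf_run[OF M wf_init[OF M]]])
      fix v1 v2 v3 v4 assume v: "v1 < (T + 1) * wid T" "v2 < (T + 1) * wid T"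
      have 1: "\<not> (v1 < wid T \<and> \<not> init_ok M T b x v1 (?A v1))" using init_ok_iff[OF S T w(1)] by blast
      have 2: "\<not> (?L \<le> v1 \<and> v2 = v1 + 1 \<and> v2 < wid T \<and> ?A v1 = 0 \<and> ?A v2 \<noteq> 0)"
      proof (intro notI, elim conjE)
        assume h: "?L \<le> v1" "v2 = v1 + 1" "v2 < wid T" "?A v1 = 0" "?A v2 \<noteq> 0"
        define j where "j = v1 - ?L"
        have "v1 - (T + 1) = 2 * length x + 2 + j" "v2 - (T + 1) = 2 * length x + 2 + Suc j"
          using h(1,2) by (auto simp: j_def)
        then have "?A v1 = inp w j" "?A v2 = inp w (Suc j)"
          using cv_init[of v1 T M "pair_enc x w"] cv_init[of v2 T M "pair_enc x w"] h(1-3)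
          by (auto simp: inp_pair_enc)
        then show False using h(4,5) by (auto simp: inp_def bit_sym_def split: if_splits)
      qed
      have 3: "\<not> (v2 = v1 + wid T \<and> v3 = v1 - 1 \<and> v4 = v1 + 1 \<and> ?A v2 \<noteq> nxt M (?A v3) (?A v1) (?A v4))"
        using cv_step[OF M wf_init[OF M] h, of v1 T] v(2) by blast
      have 4: "\<not> (v1 = T * wid T + (T + 1) \<and> ?A v1 mod tm_syms M \<noteq> 2)" using cmid w(2) by metis
      show "\<not> bad M T b x v1 v2 v3 v4 (?A v1) (?A v2) (?A v3) (?A v4)"
        unfolding bad_def using 1 2 3 4 by blast
    qed
  next
    assume "\<exists>A. ?P A"
    then obtain A where A: "?P A" by blast
    have nb: "\<not> bad M T b x v1 v2 v3 v4 (A v1) (A v2) (A v3) (A v4)"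
      if "v1 < (T + 1) * wid T" "v2 < (T + 1) * wid T" "v3 < (T + 1) * wid T" "v4 < (T + 1) * wid T" for v1 v2 v3 v4
      using A that by simp
    have io: "init_ok M T b x v (A v)" if "v < wid T" for v
      using nb[of v v v v] that row unfolding bad_def by (meson less_le_trans)
    have mono: "A (v + 1) = 0" if "?L \<le> v" "v + 1 < wid T" "A v = 0" for v
    proof -
      have "v + 1 < (T + 1) * wid T" "v < (T + 1) * wid T" using that(2) row by linarith+
      then show ?thesis using nb[of v "v + 1" v v] that unfolding bad_def by blast
    qed
    have st: "A (v + wid T) = nxt M (A (v - 1)) (A v) (A (v + 1))" if "v + wid T < (T + 1) * wid T" for v
    proof -
      have "wid T \<ge> 3" by (simp add: wid_def)
      then have "v < (T + 1) * wid T" "v - 1 < (T + 1) * wid T" "v + 1 < (T + 1) * wid T" using that by linarith+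
      then show ?thesis using nb[of v "v + wid T" "v - 1" "v + 1"] that unfolding bad_def by blast
    qed
    have ac: "A (T * wid T + (T + 1)) mod tm_syms M = 2"
      using nb[OF mid mid mid mid] unfolding bad_def by blast
    have dm: "A v = a + tm_syms M * s" if "A v mod tm_syms M = a" "A v div tm_syms M = s" for v a s
      using that mod_mult_div_eq[of "A v" "tm_syms M"] by (simp add: mult.commute)
    have reg: "A v \<le> 2" "?L + b \<le> v \<Longrightarrow> A v = 0" if "?L \<le> v" "v < wid T" for v
    proof -
      have "v \<noteq> T + 1" using that(1) by simp
      then have "A v div tm_syms M = 0" using io[OF that(2)] by (simp add: init_ok_def)
      from dm[OF refl this] have e: "A v = A v mod tm_syms M" by simp
      have "A v mod tm_syms M \<le> 2" using io[OF that(2)] that(1) by (simp add: init_ok_def)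
      then show "A v \<le> 2" using e by simp
      show "A v = 0" if "?L + b \<le> v" using io[OF \<open>v < wid T\<close>] that e by (simp add: init_ok_def)
    qed
    have Lb: "?L + b < wid T" using T by (simp add: wid_def)
    \<comment> \<open>The witness ends at the first blank; the second constraint forces only blanks
      behind it, so the row is that of a genuine input.\<close>
    define m where "m = (LEAST j. A (?L + j) = 0)"
    have A0: "A (?L + b) = 0" using reg(2)[of "?L + b"] Lb by simp
    then have m0: "A (?L + m) = 0" and mb: "m \<le> b" unfolding m_def by (rule LeastI, rule Least_le)
    have m1: "A (?L + j) \<noteq> 0" if "j < m" for j using that not_less_Least unfolding m_def by blast
    have m2: "A (?L + (m + j)) = 0" if "?L + (m + j) < wid T" for j
      using that
    proof (induction j)
      case (Suc j)
      then show ?case using mono[of "?L + (m + j)"] by (simp add: add_ac)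
    qed (use m0 in simp)
    define w where "w = map (\<lambda>j. A (?L + j) = 2) [0..<m]"
    have w: "inp w j = A (?L + j)" if "?L + j < wid T" for j
    proof (cases "j < m")
      case True
      then have "A (?L + j) = 1 \<or> A (?L + j) = 2" using m1[OF True] reg(1)[of "?L + j"] that by linarith
      then show ?thesis using True by (auto simp: w_def inp_def bit_sym_def)
    next
      case False
      then show ?thesis using m2[of "j - m"] that by (simp add: w_def inp_def)
    qed
    let ?cfg = "tm_init (pair_enc x w)"
    have h: "snd (snd ?cfg) = 0" by (simp add: tm_init_def)
    have row0: "A v = cv M ?cfg T v" if v: "v < wid T" for v
    proof -
      have i: "init_ok M T b x v (A v)" by (rule io[OF v])
      have d: "A v div tm_syms M = (if v = T + 1 then 1 else 0)" using i unfolding init_ok_def by (auto split: if_splits)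
      have "A v mod tm_syms M = (if v < T + 1 then 0 else inp (pair_enc x w) (v - (T + 1)))"
      proof -
        consider "v < T + 1" | "T + 1 \<le> v" "v < T + 1 + 2 * length x" | "v = T + 1 + 2 * length x"
          | "v = T + 2 + 2 * length x" | "?L \<le> v" by linarith
        then show ?thesis
        proof cases
          case 5
          define j where "j = v - ?L"
          have vj: "v = ?L + j" using 5 by (simp add: j_def)
          then have "inp (pair_enc x w) (v - (T + 1)) = inp w j" by (simp add: inp_pair_enc)
          moreover have "inp w j = A v" using w[of j] v vj by simp
          moreover have "A v mod tm_syms M = A v" using reg(1)[OF 5 v] S by simp
          ultimately show ?thesis using 5 by simp
        qed (use i in \<open>auto simp: init_ok_def inp_pair_enc\<close>)
      qed
      from dm[OF this d] show ?thesis unfolding cv_init[OF v] .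
    qed
    have "A v = cv M ?cfg T v" if "v < (T + 1) * wid T" for v
      by (rule cv_unique[OF M wf_init[OF M] h row0 st that])
    from this[OF mid] ac have "fst (snd (tm_run M T ?cfg)) 0 = 2" using cmid by simp
    moreover have "length w \<le> b" using mb by (simp add: w_def)
    ultimately show ?R by blast
  }
qed

lemma tape_output_single: "tape_output tape = [e] \<Longrightarrow> tape 0 = 2 \<longleftrightarrow> e"
proof -
  assume h: "tape_output tape = [e]"
  let ?n = "LEAST k. tape (int k) \<notin> {1, 2}"
  have "length (tape_output tape) = ?n" by (simp add: tape_output_def)
  then have "?n = 1" using h by simp
  then have "tape_output tape = [tape 0 = 2]" unfolding tape_output_def by simp
  then show ?thesis using h by simp
qed

text \<open>Halted configurations are fixed, so a single time \<open>T\<close> can be used for all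
  witnesses.\<close>

lemma run_halted: "fst (tm_run M t cfg) = 1 \<Longrightarrow> t \<le> T \<Longrightarrow> tm_run M T cfg = tm_run M t cfg"
proof -
  assume h: "fst (tm_run M t cfg) = 1" and t: "t \<le> T"
  have "tm_run M (t + d) cfg = tm_run M t cfg" for d
  proof (induction d)
    case (Suc d)
    have "tm_step M (tm_run M t cfg) = tm_run M t cfg" using h by (cases "tm_run M t cfg") (simp add: tm_step_def)
    then show ?case using Suc by (simp add: tm_run_def)
  qed simp
  from this[of "T - t"] t show ?thesis by simp
qed

lemma cp_if: "cp P \<Longrightarrow> cp Q \<Longrightarrow> cp R \<Longrightarrow> cp (\<lambda>x \<sigma>. if P x \<sigma> then Q x \<sigma> else R x \<sigma>)"
proof -
  assume "cp P" "cp Q" "cp R"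
  then have "cf (\<lambda>x \<sigma>. if P x \<sigma> then of_bool (Q x \<sigma>) else of_bool (R x \<sigma>))" by (rule cf_if)
  then show ?thesis unfolding if_distrib[of of_bool] .
qed

lemma cp_bad:
  assumes T: "cf (\<lambda>x \<sigma>. T x)" and w: "cf (\<lambda>x \<sigma>. w x)"
  shows "cp (\<lambda>x \<sigma>. bad M (T x) (w x) x (\<sigma> 0) (\<sigma> 1) (\<sigma> 2) (\<sigma> 3) a1 a2 a3 a4)"
  unfolding bad_def init_ok_def wid_def
  by (intro cp_if cf_inp cp_not cp_conj cp_disj cp_imp cp_le cp_less cp_eq cf_add cf_sub cf_mult cf_div cf_var cf_len cf_const T w)

theorem NP_constraints:
  assumes "in_NP L"
  obtains q Nf and B :: "bool list \<Rightarrow> nat \<Rightarrow> nat \<Rightarrow> nat \<Rightarrow> nat \<Rightarrow> nat \<Rightarrow> nat \<Rightarrow> nat \<Rightarrow> nat \<Rightarrow> bool"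
  where "0 < q" "cf (\<lambda>x \<sigma>. Nf x)" "\<And>x. 0 < Nf x"
    "\<And>a1 a2 a3 a4. cp (\<lambda>x \<sigma>. B x (\<sigma> 0) (\<sigma> 1) (\<sigma> 2) (\<sigma> 3) a1 a2 a3 a4)"
    "\<And>x. L x \<longleftrightarrow> (\<exists>A. (\<forall>v<Nf x. A v < q) \<and>
      (\<forall>v1<Nf x. \<forall>v2<Nf x. \<forall>v3<Nf x. \<forall>v4<Nf x. \<not> B x v1 v2 v3 v4 (A v1) (A v2) (A v3) (A v4)))"
proof -
  obtain V c k where V: "poly_time_decidable V" and
    L: "\<And>x. L x \<longleftrightarrow> (\<exists>w. length w \<le> c * length x ^ k + c \<and> V (pair_enc x w))"
    using assms unfolding in_NP_def by blast
  obtain M c' k' where M: "wf_tm M" and run: "\<And>y. \<exists>t. t \<le> c' * length y ^ k' + c' \<and>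
        fst (tm_run M t (tm_init y)) = 1 \<and> tape_output (fst (snd (tm_run M t (tm_init y)))) = [V y]"
    using V unfolding poly_time_decidable_def poly_time_computable_def by blast
  define b where "b x = c * length (x :: bool list) ^ k + c" for x
  \<comment> \<open>The running time of the verifier on the longest admissible pair, plus the length
    of that pair, so that the tableau is also wide enough.\<close>
  define T where "T x = c' * (2 * length x + 2 + b x) ^ k' + c' + (2 * length x + 2 + b x)" for x
  have cb: "cf (\<lambda>x \<sigma>. b x)" unfolding b_def by (intro cf_add cf_mult cf_power cf_const cf_len)
  have cT: "cf (\<lambda>x \<sigma>. T x)" unfolding T_def by (intro cf_add cf_mult cf_power cf_const cf_len cb)
  have acc: "fst (snd (tm_run M (T x) (tm_init (pair_enc x w)))) 0 = 2 \<longleftrightarrow> V (pair_enc x w)"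
    if "length w \<le> b x" for x w
  proof -
    obtain t where t: "t \<le> c' * length (pair_enc x w) ^ k' + c'" "fst (tm_run M t (tm_init (pair_enc x w))) = 1"
      "tape_output (fst (snd (tm_run M t (tm_init (pair_enc x w))))) = [V (pair_enc x w)]" using run by blast
    have "length (pair_enc x w) = 2 * length x + 2 + length w" unfolding pair_enc_def by (induction x) auto
    then have "length (pair_enc x w) ^ k' \<le> (2 * length x + 2 + b x) ^ k'" using that by (intro power_mono) auto
    then have "c' * length (pair_enc x w) ^ k' \<le> c' * (2 * length x + 2 + b x) ^ k'" by (rule mult_le_mono2)
    then have "t \<le> T x" unfolding T_def using t(1) by linarith
    from run_halted[OF t(2) this] tape_output_single[OF t(3)] show ?thesis by simp
  qed
  show thesis
  proof (rule that[of "tm_syms M * (tm_states M + 1)" "\<lambda>x. (T x + 1) * wid (T x)" "\<lambda>x. bad M (T x) (b x) x"])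
    show "0 < tm_syms M * (tm_states M + 1)" using M by (simp add: wf_tm_def)
    show "cf (\<lambda>x \<sigma>. (T x + 1) * wid (T x))" unfolding wid_def by (intro cf_add cf_mult cf_const cT)
    show "0 < (T x + 1) * wid (T x)" for x by (simp add: wid_def)
    show "cp (\<lambda>x \<sigma>. bad M (T x) (b x) x (\<sigma> 0) (\<sigma> 1) (\<sigma> 2) (\<sigma> 3) a1 a2 a3 a4)" for a1 a2 a3 a4
      by (rule cp_bad[OF cT cb])
    fix x
    have "2 * length x + 2 + b x \<le> T x" by (simp add: T_def)
    note iff = tableau_iff[OF M this]
    show "L x \<longleftrightarrow> (\<exists>A. (\<forall>v<(T x + 1) * wid (T x). A v < tm_syms M * (tm_states M + 1)) \<and>
      (\<forall>v1<(T x + 1) * wid (T x). \<forall>v2<(T x + 1) * wid (T x). \<forall>v3<(T x + 1) * wid (T x). \<forall>v4<(T x + 1) * wid (T x).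
         \<not> bad M (T x) (b x) x v1 v2 v3 v4 (A v1) (A v2) (A v3) (A v4)))"
      unfolding iff L b_def[symmetric] using acc by blast
  qed
qed

section \<open>The reduction\<close>

lemma cp_all_const: "(\<And>j. j < n \<Longrightarrow> cp (P j)) \<Longrightarrow> cp (\<lambda>x \<sigma>. \<forall>j<n. P j x \<sigma>)" for n :: nat
  using cp_ball[of "{..<n}" P] by (simp add: Ball_def)

lemma cp_ex_const: "(\<And>j. j < n \<Longrightarrow> cp (P j)) \<Longrightarrow> cp (\<lambda>x \<sigma>. \<exists>j<n. P j x \<sigma>)" for n :: nat
  using cp_bex[of "{..<n}" P] by (simp add: Bex_def)

text \<open>The encoding of a list starts with its length, so the length must be computable in
  advance, separately from the emission of the pairs.\<close>

definition pl :: "(bool list \<Rightarrow> (nat \<Rightarrow> nat) \<Rightarrow> (nat \<times> nat) list) \<Rightarrow> bool" where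
  "pl P \<longleftrightarrow> cf (\<lambda>x \<sigma>. length (P x \<sigma>)) \<and>
     pe (\<lambda>x \<sigma>. concat (map (\<lambda>(a, b). enc_nat a @ enc_nat b) (P x \<sigma>)))"

lemma pl_nil: "pl (\<lambda>x \<sigma>. [])"
  unfolding pl_def by (simp add: cf_const pe_nil)

lemma pl_pair: assumes "cf A" "cf B" shows "pl (\<lambda>x \<sigma>. [(A x \<sigma>, B x \<sigma>)])"
proof -
  have "pe (\<lambda>x \<sigma>. enc_nat (A x \<sigma>) @ enc_nat (B x \<sigma>))" by (intro pe_append pe_nat assms)
  then show ?thesis unfolding pl_def by (simp add: cf_const[of 1, simplified])
qed

lemma pl_append: assumes "pl P" "pl Q" shows "pl (\<lambda>x \<sigma>. P x \<sigma> @ Q x \<sigma>)"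
proof -
  have "cf (\<lambda>x \<sigma>. length (P x \<sigma>) + length (Q x \<sigma>))" using assms unfolding pl_def by (intro cf_add) simp_all
  moreover have "pe (\<lambda>x \<sigma>. concat (map (\<lambda>(a, b). enc_nat a @ enc_nat b) (P x \<sigma>)) @
      concat (map (\<lambda>(a, b). enc_nat a @ enc_nat b) (Q x \<sigma>)))"
    using assms unfolding pl_def by (intro pe_append) simp_all
  ultimately show ?thesis unfolding pl_def by simp
qed

lemma length_concat_upt: "length (concat (map f [0..<n])) = (\<Sum>v<n. length (f v))" for n :: nat
  by (induction n) simp_all

lemma pl_for:
  assumes G: "cf G" and P: "pl (\<lambda>x \<tau>. P x (\<lambda>i. \<tau> (Suc i)) (\<tau> 0))"
  shows "pl (\<lambda>x \<sigma>. concat (map (\<lambda>v. P x \<sigma> v) [0..<G x \<sigma>]))"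
proof -
  let ?e = "\<lambda>ps. concat (map (\<lambda>(a, b). enc_nat a @ enc_nat b) ps)"
  have e: "?e (concat (map f vs)) = concat (map (\<lambda>v. ?e (f v)) vs)" for f :: "nat \<Rightarrow> (nat \<times> nat) list" and vs
    by (induction vs) simp_all
  have "cf (\<lambda>x \<sigma>. \<Sum>v<G x \<sigma>. length (P x \<sigma> v))"
    by (rule cf_sum[OF G]) (use P in \<open>simp add: pl_def\<close>)
  moreover have "pe (\<lambda>x \<sigma>. concat (map (\<lambda>v. ?e (P x \<sigma> v)) [0..<G x \<sigma>]))"
    by (rule pe_for[OF G]) (use P in \<open>simp add: pl_def\<close>)
  ultimately show ?thesis unfolding pl_def e length_concat_upt by blast
qed

text \<open>A conditional is a loop that is executed at most once; the dummy index of the loop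
  explains the shift of the variables.\<close>

lemma pl_if:
  assumes "cp C" "pl (\<lambda>x \<tau>. P x (\<lambda>i. \<tau> (Suc i)))" shows "pl (\<lambda>x \<sigma>. if C x \<sigma> then P x \<sigma> else [])"
proof -
  have "pl (\<lambda>x \<sigma>. concat (map (\<lambda>v. P x \<sigma>) [0..<of_bool (C x \<sigma>)]))" by (rule pl_for[OF assms])
  moreover have "concat (map (\<lambda>v. p) [0..<of_bool c]) = (if c then p else [])" for p :: "(nat \<times> nat) list" and c by simp
  ultimately show ?thesis by simp
qed

lemma pe_enc_pairs: "pl P \<Longrightarrow> pe (\<lambda>x \<sigma>. enc_pairs (P x \<sigma>))"
  unfolding pl_def enc_pairs_def by (intro pe_append pe_nat) simp_all

text \<open>The least \<open>c\<close> below \<open>k\<close> with the property equals the number of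
  \<open>v < k\<close> such that no \<open>c \<le> v\<close> has it. This turns a search into a
  sum.\<close>

lemma cf_first:
  assumes P: "cf (\<lambda>x \<sigma>. of_bool (P x (\<sigma> 0) (\<sigma> 1)))"
  shows "cf (\<lambda>x \<sigma>. \<Sum>v<k. of_bool (\<forall>c<Suc v. \<not> P x (\<sigma> 0) c))"
proof (rule cf_sum[OF cf_const])
  have "cp (\<lambda>x \<tau>. P x (\<tau> 2) (\<tau> 0))" using cf_ren[OF P, of "\<lambda>i. if i = 0 then 2 else 0"] by simp
  then have "cp (\<lambda>x \<tau>. P x (\<tau> (Suc (Suc 0))) (\<tau> 0))" by (simp add: numeral_2_eq_2)
  then show "cp (\<lambda>x \<tau>. \<forall>c<Suc (\<tau> 0). \<not> P x (\<tau> (Suc 0)) c)" by (intro cp_all cf_Suc cf_var cp_not)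
qed

lemma first_works:
  fixes k :: nat
  assumes "c < k" "P c"
  shows "(\<Sum>v<k. of_bool (\<forall>c<Suc v. \<not> P c)) < k \<and> P (\<Sum>v<k. of_bool (\<forall>c<Suc v. \<not> P c))"
proof -
  define m where "m = (LEAST c. P c)"
  have m: "P m" "m \<le> c" unfolding m_def using assms by (auto intro: LeastI Least_le)
  have "(\<forall>c<Suc v. \<not> P c) \<longleftrightarrow> v < m" for v
    using m(1) not_less_Least[of _ P] unfolding m_def[symmetric] by (metis less_Suc_eq_le le_less_trans not_less)
  then have "(\<Sum>v<k. of_bool (\<forall>c<Suc v. \<not> P c) :: nat) = (\<Sum>v<k. of_bool (v < m))" by simp
  also have "\<dots> = card ({..<k} \<inter> {v. v < m})" by (simp add: of_bool_def sum.If_cases)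
  also have "{..<k} \<inter> {v. v < m} = {..<m}" using m(2) assms(1) by auto
  finally have "(\<Sum>v<k. of_bool (\<forall>c<Suc v. \<not> P c) :: nat) = m" by simp
  then show ?thesis using m assms(1) by simp
qed

context net
begin

text \<open>Built only from loops, conditionals and appended singletons, the shape for which
  \<open>pl_intros\<close> synthesises a program.\<close>

definition edge_list :: "(qb \<times> qb) list" where
  "edge_list = concat (map (\<lambda>i.
     concat (map (\<lambda>R.
       concat (map (\<lambda>c. if mem R c then [(Dq i R, Gq i c)] @ [(Pq i c (l - 1), Bq i R)] else []) [0..<k]) @
       concat (map (\<lambda>R'. if free R' R then [(Dq i R', Bq i R)] else []) [0..<M])) [0..<M]) @
     concat (map (\<lambda>c. [(Gq i c, Hq c)] @ [(Hq c, Pq i c 0)] @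
       concat (map (\<lambda>j. [(Pq i c j, Pq i c (Suc j))]) [0..<l - 1])) [0..<k])) [0..<W])"

lemma set_edge_list: "set edge_list = edge"
proof (rule set_eqI)
  fix g :: "qb \<times> qb"
  obtain p q where g: "g = (p, q)" by (cases g)
  show "g \<in> set edge_list \<longleftrightarrow> g \<in> edge"
  proof
    assume "g \<in> set edge_list"
    then show "g \<in> edge" unfolding edge_list_def
      by (auto split: if_splits intro: edge.intros simp del: One_nat_def)
  next
    assume "g \<in> edge"
    then have "(p, q) \<in> edge" using g by simp
    then show "g \<in> set edge_list" unfolding edge_list_def g by (cases rule: edge.cases) (auto split: if_splits simp: image_iff)
  qed
qed

lemma map_singletons: "concat (map (\<lambda>j. [f j]) js) = map f js"
  by (induction js) auto

lemma rev_map_upt: "rev (map f [0..<n]) = map (\<lambda>j. f (n - Suc j)) [0..<n]" for n :: nat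
  by (rule nth_equalityI) (simp_all add: rev_nth)

definition feas_list :: "(nat \<Rightarrow> nat) \<Rightarrow> (qb \<times> qb) list" where
  "feas_list c0 = concat (map (\<lambda>i. concat (map (\<lambda>R.
     [(Dq i R, Gq i (c0 R))] @ [(Gq i (c0 R), Hq (c0 R))] @ [(Hq (c0 R), Pq i (c0 R) 0)] @
     concat (map (\<lambda>j. [(Pq i (c0 R) j, Pq i (c0 R) (Suc j))]) [0..<l - 1]) @
     [(Pq i (c0 R) (l - 1), Bq i R)] @
     concat (map (\<lambda>j. [(Pq i (c0 R) (l - 1 - Suc j), Pq i (c0 R) (Suc (l - 1 - Suc j)))]) [0..<l - 1]) @
     [(Hq (c0 R), Pq i (c0 R) 0)] @ [(Gq i (c0 R), Hq (c0 R))] @ [(Dq i R, Gq i (c0 R))]) [0..<M])) [0..<W])"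

lemma feas_list: "feas_list c0 = feas c0"
  unfolding feas_list_def feas_def blk_def up_def map_singletons rev_append rev_map_upt by simp

end

locale reduction =
  fixes a q d k :: nat and Nf :: "bool list \<Rightarrow> nat"
    and B :: "bool list \<Rightarrow> nat \<Rightarrow> nat \<Rightarrow> nat \<Rightarrow> nat \<Rightarrow> nat \<Rightarrow> nat \<Rightarrow> nat \<Rightarrow> nat \<Rightarrow> bool"
  assumes q: "0 < q" and cfN: "cf (\<lambda>x \<sigma>. Nf x)" and N: "\<And>x. 0 < Nf x"
    and cfB: "\<And>a1 a2 a3 a4. cp (\<lambda>x \<sigma>. B x (\<sigma> 0) (\<sigma> 1) (\<sigma> 2) (\<sigma> 3) a1 a2 a3 a4)"
    and dk: "d = gap_d a" "k = gap_k a q" and a: "0 < a"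
begin

definition M :: "bool list \<Rightarrow> nat" where "M x = Nf x ^ d * k ^ (q ^ d)"
text \<open>Chosen such that in the cheap circuit all gates outside the chains number at most
  \<open>k * W x * l x\<close>; the chains themselves account for twice that.\<close>

definition l :: "bool list \<Rightarrow> nat" where "l x = 6 + 3 * M x + M x * M x"
text \<open>Absorbs all terms of the depth bound that do not grow with the number of copies.\<close>

definition W :: "bool list \<Rightarrow> nat" where "W x = 2 * l x + 3 * M x + M x * M x"

abbreviation "rvalid x \<equiv> gap_graph.valid (Nf x) q d (B x)"
abbreviation "rvoid x \<equiv> gap_graph.void (Nf x) q d (B x)"
abbreviation "rok x \<equiv> gap_graph.ok (Nf x) q d (B x)"
abbreviation "rmem x \<equiv> gap_graph.mem (Nf x) q d k (B x)"
abbreviation "rfree x \<equiv> gap_graph.free (Nf x) q d k (B x)"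

definition c0 :: "bool list \<Rightarrow> nat \<Rightarrow> nat" where "c0 x R = (\<Sum>v<k. of_bool (\<forall>c<Suc v. \<not> rmem x R c))"

abbreviation "rnum2 x \<equiv> map_prod (net.num (M x) k (W x) (l x)) (net.num (M x) k (W x) (l x))"

definition S where "S x = map (rnum2 x) (net.edge_list (M x) k (W x) (l x) (rmem x) (rfree x))"
definition gates where "gates x = map (rnum2 x) (net.feas_list (M x) (W x) (l x) (c0 x))"

definition inst :: "bool list \<Rightarrow> gcm_inst" where
  "inst x = \<lparr>gi_n = 2 * (W x * M x), gi_m = k + W x * k + W x * k * l x, gi_s = length (gates x),
     gi_S = S x, gi_gates = gates x\<rparr>"

text \<open>A void vertex already refutes satisfiability, and it can be detected in polynomial time.
  The threshold 0 then makes the instance a correct negative one, since the optimum is positive; the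
  rank bound is needed only in the other case.\<close>

definition thr :: "(nat \<Rightarrow> nat \<Rightarrow> nat) \<Rightarrow> bool list \<Rightarrow> nat" where
  "thr f x = (if \<exists>R<M x. rvoid x R then 0 else f (W x) (l x))"

lemma cf_M: "cf (\<lambda>x \<sigma>. M x)" unfolding M_def by (intro cf_mult cf_power cf_const cfN)
lemma cf_l: "cf (\<lambda>x \<sigma>. l x)" unfolding l_def by (intro cf_add cf_mult cf_const cf_M)
lemma cf_W: "cf (\<lambda>x \<sigma>. W x)" unfolding W_def by (intro cf_add cf_mult cf_const cf_M cf_l)

lemma cf_win: "cf A \<Longrightarrow> cf (\<lambda>x \<sigma>. gap_graph.win (Nf x) (A x \<sigma>) j)"
  unfolding gap_graph.win_def by (intro cf_mod cf_div cf_power cfN)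

lemma cf_pal: "cf A \<Longrightarrow> cf (\<lambda>x \<sigma>. gap_graph.pal (Nf x) d k (A x \<sigma>) s)"
  unfolding gap_graph.pal_def by (intro cf_mod cf_div cf_power cf_mult cfN cf_const)

lemma cp_B: "cf A1 \<Longrightarrow> cf A2 \<Longrightarrow> cf A3 \<Longrightarrow> cf A4 \<Longrightarrow>
    cp (\<lambda>x \<sigma>. B x (A1 x \<sigma>) (A2 x \<sigma>) (A3 x \<sigma>) (A4 x \<sigma>) a1 a2 a3 a4)"
  by (rule cf_comp4[where f = "\<lambda>x v1 v2 v3 v4. of_bool (B x v1 v2 v3 v4 a1 a2 a3 a4)", OF cfB])

lemma cp_valid: "cf A \<Longrightarrow> cp (\<lambda>x \<sigma>. rvalid x (A x \<sigma>) s)"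
  unfolding gap_graph.valid_def
  by (intro cp_conj cp_all_const cp_imp cp_eq cp_not cp_B cf_win cf_const cp_const)

lemma cp_void: "cf A \<Longrightarrow> cp (\<lambda>x \<sigma>. rvoid x (A x \<sigma>))"
  unfolding gap_graph.void_def by (intro cp_all_const cp_not cp_valid)

lemma cp_ok: "cf A \<Longrightarrow> cp (\<lambda>x \<sigma>. rok x (A x \<sigma>) s)"
  unfolding gap_graph.ok_def by (intro cp_disj cp_valid cp_void)

lemma cp_mem: "cf A \<Longrightarrow> cf C \<Longrightarrow> cp (\<lambda>x \<sigma>. rmem x (A x \<sigma>) (C x \<sigma>))"
  unfolding gap_graph.mem_def by (intro cp_ex_const cp_conj cp_ok cp_eq cf_pal)

lemma cp_free: "cf A \<Longrightarrow> cf C \<Longrightarrow> cp (\<lambda>x \<sigma>. rfree x (A x \<sigma>) (C x \<sigma>))"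
  unfolding gap_graph.free_def gap_graph.cons_def
  by (intro cp_ex_const cp_all_const cp_imp cp_conj cp_ok cp_eq cp_not cf_pal cf_win cp_const)

lemma cf_c0: "cf A \<Longrightarrow> cf (\<lambda>x \<sigma>. c0 x (A x \<sigma>))"
  unfolding c0_def
  by (rule cf_comp1[where f = "\<lambda>x R. \<Sum>v<k. of_bool (\<forall>c<Suc v. \<not> rmem x R c)", OF cf_first[where P = rmem]])
    (intro cp_mem cf_var)

lemmas num_simps = net.num.simps map_prod_simp list.map map_append map_concat map_map comp_def

lemmas pl_intros = pl_append pl_for pl_if pl_nil pl_pair cf_add cf_mult cf_sub cf_Suc cf_const cf_var cf_M cf_l cf_W cf_c0 cp_mem cp_free

lemma if_map: "map f (if c then xs else []) = (if c then map f xs else [])" by simp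

lemma pl_S: "pl (\<lambda>x \<sigma>. S x)"
  unfolding S_def net.edge_list_def num_simps if_map by (intro pl_intros)

lemma pl_gates: "pl (\<lambda>x \<sigma>. gates x)"
  unfolding gates_def net.feas_list_def num_simps by (intro pl_intros)

lemma computable:
  assumes "cf (\<lambda>x \<sigma>. f (W x) (l x))"
  shows "poly_time_computable (\<lambda>x. enc_gap (inst x, thr f x))"
proof -
  have t: "cf (\<lambda>x \<sigma>. thr f x)" unfolding thr_def by (intro cf_if cp_ex cp_void cf_var cf_M cf_const assms)
  have g: "cf (\<lambda>x \<sigma>. length (gates x))" using pl_gates by (simp add: pl_def)
  have "pe (\<lambda>x \<sigma>. enc_nat (gi_n (inst x)) @ enc_nat (gi_m (inst x)) @ enc_nat (gi_s (inst x)) @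
     enc_pairs (gi_S (inst x)) @ enc_pairs (gi_gates (inst x)) @ enc_nat (thr f x))"
    unfolding inst_def gcm_inst.simps
    by (intro pe_append pe_nat pe_enc_pairs pl_S pl_gates cf_add cf_mult cf_const cf_W cf_M cf_l g t)
  from poly_time_pe[OF this] show ?thesis unfolding enc_gap_def prod.case .
qed

lemma k0: "0 < k" unfolding dk by (rule gap_k_pos)

lemma M0: "0 < M x" using N[of x] k0 by (simp add: M_def)

lemma c0_mem: "c0 x R < k \<and> rmem x R (c0 x R)"
proof -
  interpret gap_graph "Nf x" q d k "B x" .
  have "\<exists>s<q ^ d. ok R s"
  proof (cases "void R")
    case True
    then show ?thesis using q by (intro exI[of _ 0]) (simp add: ok_def)
  next
    case False
    then show ?thesis unfolding void_def ok_def by blast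
  qed
  then obtain s where "s < q ^ d" "ok R s" by blast
  then have "mem R (pal R s)" unfolding mem_def by blast
  from first_works[of "pal R s" k "mem R", OF pal_less[OF k0] this] show ?thesis unfolding c0_def .
qed

lemma net_inst: "net_inst (M x) k (W x) (l x) (rmem x) (rfree x) (inst x) (c0 x)"
proof -
  interpret net "M x" k "W x" "l x" "rmem x" "rfree x" .
  show ?thesis
  proof
    show "0 < M x" "0 < k" "0 < W x" "0 < l x" using M0 k0 by (simp_all add: W_def l_def)
    show "c0 x R < k \<and> rmem x R (c0 x R)" for R by (rule c0_mem)
    show "gi_n (inst x) = nd" "gi_m (inst x) = na" "gi_s (inst x) = length (gi_gates (inst x))"
      by (simp_all add: inst_def nd_def na_def)
    show "set (gi_S (inst x)) = map_prod num num ` edge" by (simp add: inst_def S_def set_edge_list)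
    show "gi_gates (inst x) = map (map_prod num num) (feas (c0 x))" by (simp add: inst_def gates_def feas_list)
  qed
qed

lemma yes:
  assumes "gap_graph.sat (Nf x) q (B x)"
  shows "\<not> (\<exists>R<M x. rvoid x R)" "gcm_opt_size (inst x) \<le> 3 * k * W x * l x" "gcm_opt_depth (inst x) \<le> 7 * W x"
proof -
  interpret gap_graph "Nf x" q d k "B x" .
  interpret I: net_inst "M x" k "W x" "l x" "rmem x" "rfree x" "inst x" "c0 x" by (rule net_inst)
  have sc: "(\<forall>R. \<not> void R) \<and> (\<exists>col. (\<forall>R. \<exists>s < q ^ d. ok R s \<and> pal R s = col R) \<and>
    (\<forall>R R'. R \<noteq> R' \<longrightarrow> col R = col R' \<longrightarrow> free R' R))" by (rule sat_coloring[OF assms N])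
  then show "\<not> (\<exists>R<M x. void R)" by simp
  obtain col where col: "\<And>R. \<exists>s < q ^ d. ok R s \<and> pal R s = col R" "\<And>R R'. R \<noteq> R' \<Longrightarrow> col R = col R' \<Longrightarrow> free R' R"
    using sc by blast
  have c: "col R < k \<and> mem R (col R)" for R
  proof -
    obtain s where "s < q ^ d" "ok R s" "pal R s = col R" using col(1) by blast
    then show ?thesis using pal_less[OF k0, of R s] unfolding mem_def by auto
  qed
  have "gcm_opt_size (inst x) \<le> W x * (3 * M x + M x * M x) + 6 * W x * k + 2 * W x * k * l x"
    and dp: "gcm_opt_depth (inst x) \<le> 6 * W x + 2 * l x + 3 * M x + M x * M x"
    using I.opt_le_coloring[of col] c col(2) by blast+
  moreover have "W x * (3 * M x + M x * M x) + 6 * W x * k \<le> W x * k * l x"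
  proof -
    have "1 * (W x * (3 * M x + M x * M x)) \<le> k * (W x * (3 * M x + M x * M x))"
      by (rule mult_le_mono1) (use k0 in simp)
    then show ?thesis by (simp add: l_def algebra_simps)
  qed
  ultimately show "gcm_opt_size (inst x) \<le> 3 * k * W x * l x" by (simp add: algebra_simps)
  show "gcm_opt_depth (inst x) \<le> 7 * W x" using dp by (simp add: W_def)
qed

text \<open>More than \<open>a * k\<close> forms have to cross the cuts in every copy. For size this
  is multiplied by the length of the chains; for depth it is shared among \<open>k\<close>
  hubs.\<close>

lemma no:
  assumes unsat: "\<not> gap_graph.sat (Nf x) q (B x)" and nv: "\<not> (\<exists>R<M x. rvoid x R)"
  shows "W x * l x * (a * k + 1) \<le> gcm_opt_size (inst x)" "W x * (a * k + 1) \<le> k * gcm_opt_depth (inst x)"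
proof -
  interpret gap_graph "Nf x" q d k "B x" .
  interpret I: net_inst "M x" k "W x" "l x" "rmem x" "rfree x" "inst x" "c0 x" by (rule net_inst)
  have Mv: "M x = verts" by (simp add: M_def verts_def)
  have "I.rank_exceeds (a * k)"
    unfolding I.rank_exceeds_def unfolding Mv
  proof (intro allI impI)
    fix ps u
    assume u: "\<forall>R<verts. \<forall>c<k. u R c \<in> spn (ps c)"
      "\<forall>R<verts. \<forall>c<k. \<forall>R'<verts. u R c R' \<longrightarrow> mem R c \<and> mem R' c"
      "\<forall>R<verts. \<forall>R'<verts. \<not> free R' R \<longrightarrow> odd (card {c. c < k \<and> u R c R'}) = (R = R')"
    show "a * k < (\<Sum>c<k. length (ps c))"
      by (rule unsat_rank[OF dk(2,1) N unsat, where u = u]) (use nv u Mv in auto)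
  qed
  then show "W x * l x * (a * k + 1) \<le> gcm_opt_size (inst x)" "W x * (a * k + 1) \<le> k * gcm_opt_depth (inst x)"
    by (rule I.opt_size_ge, rule I.opt_depth_ge)
qed

lemma valid: "gcm_valid (inst x)" "0 < gcm_opt_size (inst x)" "0 < gcm_opt_depth (inst x)"
  using net_inst.valid_inst[OF net_inst] net_inst.opt_pos[OF net_inst] by blast+

end

theorem theorem5p3:
  fixes \<alpha> :: real
  assumes "\<alpha> \<ge> 1"
  shows "NP_hard_to_approx gcm_opt_size \<alpha> \<and> NP_hard_to_approx gcm_opt_depth \<alpha>"
proof -
  \<comment> \<open>Cheap circuits have depth at most \<open>7 * W\<close> and size at most
    \<open>3 * k * W * l\<close>, against more than \<open>a * W\<close> and
    \<open>a * k * W * l\<close> in the unsatisfiable case; the larger factor 7 serves both.\<close>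
  define a where "a = nat \<lceil>7 * \<alpha>\<rceil>"
  have a: "7 * \<alpha> \<le> real a" unfolding a_def by linarith
  have a0: "0 < a" using a assms by (cases a) auto
  have "\<exists>g :: bool list \<Rightarrow> gcm_inst \<times> nat. poly_time_computable (\<lambda>x. enc_gap (g x)) \<and>
           (\<forall>x. gcm_valid (fst (g x)) \<and> (L x \<longrightarrow> real (gcm_opt_size (fst (g x))) \<le> real (snd (g x))) \<and>
                (\<not> L x \<longrightarrow> real (gcm_opt_size (fst (g x))) > \<alpha> * real (snd (g x))))"
       "\<exists>g :: bool list \<Rightarrow> gcm_inst \<times> nat. poly_time_computable (\<lambda>x. enc_gap (g x)) \<and>
           (\<forall>x. gcm_valid (fst (g x)) \<and> (L x \<longrightarrow> real (gcm_opt_depth (fst (g x))) \<le> real (snd (g x))) \<and>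
                (\<not> L x \<longrightarrow> real (gcm_opt_depth (fst (g x))) > \<alpha> * real (snd (g x))))"
    if L: "in_NP L" for L
  proof -
    obtain q Nf and B :: "bool list \<Rightarrow> nat \<Rightarrow> nat \<Rightarrow> nat \<Rightarrow> nat \<Rightarrow> nat \<Rightarrow> nat \<Rightarrow> nat \<Rightarrow> nat \<Rightarrow> bool"
      where csp: "0 < q" "cf (\<lambda>x \<sigma>. Nf x)" "\<And>x. 0 < Nf x"
        "\<And>a1 a2 a3 a4. cp (\<lambda>x \<sigma>. B x (\<sigma> 0) (\<sigma> 1) (\<sigma> 2) (\<sigma> 3) a1 a2 a3 a4)"
        "\<And>x. L x \<longleftrightarrow> (\<exists>A. (\<forall>v<Nf x. A v < q) \<and>
          (\<forall>v1<Nf x. \<forall>v2<Nf x. \<forall>v3<Nf x. \<forall>v4<Nf x. \<not> B x v1 v2 v3 v4 (A v1) (A v2) (A v3) (A v4)))"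
      by (rule NP_constraints[OF L]; rule that; assumption)
    interpret r: reduction a q "gap_d a" "gap_k a q" Nf B
      by unfold_locales (use csp(1-4) a0 in auto)
    let ?k = "gap_k a q"
    have sat: "L x \<longleftrightarrow> gap_graph.sat (Nf x) q (B x)" for x
      unfolding gap_graph.sat_def by (rule csp(5))
    \<comment> \<open>Both measures at once: \<open>n\<close> is \<open>k * W * l\<close> or
      \<open>W\<close>, and \<open>thr\<close> is the factor 3 or 7 of the cheap circuit.\<close>
    have big: "\<alpha> * real (thr * n) < real m" if "thr \<le> 7" "0 < n" "n * a + 1 \<le> m" for thr n m :: nat
    proof -
      have "\<alpha> * real (thr * n) \<le> \<alpha> * (7 * real n)" using that(1) assms by (intro mult_left_mono) (auto simp: mult_right_mono)
      also have "\<dots> = (7 * \<alpha>) * real n" by simp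
      also have "\<dots> \<le> real a * real n" using a by (rule mult_right_mono) simp
      also have "\<dots> < real m" using that(3) by (metis less_eq_Suc_le Suc_eq_plus1 mult.commute of_nat_less_iff of_nat_mult)
      finally show ?thesis .
    qed
    have sz: "\<alpha> * real (r.thr (\<lambda>W l. 3 * ?k * W * l) x) < real (gcm_opt_size (r.inst x))" if "\<not> L x" for x
    proof (cases "\<exists>R<r.M x. r.rvoid x R")
      case True
      then show ?thesis using r.valid by (simp add: r.thr_def)
    next
      case False
      let ?n = "?k * r.W x * r.l x"
      have n0: "0 < ?n" using r.k0 r.M0[of x] by (simp add: r.W_def r.l_def)
      have "?n * a + 1 \<le> r.W x * r.l x * (a * ?k + 1)" using n0 by (simp add: algebra_simps)
      also have "\<dots> \<le> gcm_opt_size (r.inst x)" using r.no(1) that False sat by blast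
      finally show ?thesis using big[of 3 ?n] n0 False by (simp add: r.thr_def mult.assoc)
    qed
    have dp: "\<alpha> * real (r.thr (\<lambda>W l. 7 * W) x) < real (gcm_opt_depth (r.inst x))" if "\<not> L x" for x
    proof (cases "\<exists>R<r.M x. r.rvoid x R")
      case True
      then show ?thesis using r.valid by (simp add: r.thr_def)
    next
      case False
      have w0: "0 < r.W x" by (simp add: r.W_def r.l_def)
      have "?k * (r.W x * a) < r.W x * (a * ?k + 1)" using w0 by (simp add: algebra_simps)
      also have "\<dots> \<le> ?k * gcm_opt_depth (r.inst x)" using r.no(2) that False sat by blast
      finally have "r.W x * a < gcm_opt_depth (r.inst x)" by simp
      then show ?thesis using big[of 7 "r.W x"] w0 False by (simp add: r.thr_def)
    qed
    show "\<exists>g :: bool list \<Rightarrow> gcm_inst \<times> nat. poly_time_computable (\<lambda>x. enc_gap (g x)) \<and>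
           (\<forall>x. gcm_valid (fst (g x)) \<and> (L x \<longrightarrow> real (gcm_opt_size (fst (g x))) \<le> real (snd (g x))) \<and>
                (\<not> L x \<longrightarrow> real (gcm_opt_size (fst (g x))) > \<alpha> * real (snd (g x))))"
    proof (intro exI[of _ "\<lambda>x. (r.inst x, r.thr (\<lambda>W l. 3 * ?k * W * l) x)"] conjI allI impI)
      show "poly_time_computable (\<lambda>x. enc_gap (r.inst x, r.thr (\<lambda>W l. 3 * ?k * W * l) x))"
        by (rule r.computable) (intro cf_mult cf_const r.cf_W r.cf_l)
    qed (use r.valid(1) r.yes(1,2) sat sz in \<open>auto simp: r.thr_def\<close>)
    show "\<exists>g :: bool list \<Rightarrow> gcm_inst \<times> nat. poly_time_computable (\<lambda>x. enc_gap (g x)) \<and>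
           (\<forall>x. gcm_valid (fst (g x)) \<and> (L x \<longrightarrow> real (gcm_opt_depth (fst (g x))) \<le> real (snd (g x))) \<and>
                (\<not> L x \<longrightarrow> real (gcm_opt_depth (fst (g x))) > \<alpha> * real (snd (g x))))"
    proof (intro exI[of _ "\<lambda>x. (r.inst x, r.thr (\<lambda>W l. 7 * W) x)"] conjI allI impI)
      show "poly_time_computable (\<lambda>x. enc_gap (r.inst x, r.thr (\<lambda>W l. 7 * W) x))"
        by (rule r.computable) (intro cf_mult cf_const r.cf_W)
    qed (use r.valid(1) r.yes(1,3) sat dp in \<open>auto simp: r.thr_def\<close>)
  qed
  then show ?thesis unfolding NP_hard_to_approx_def by blast
qed

end
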